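(* Let $n\ge1$ be an integer, let $Z$ be a metric space, let $X\subseteq Z$ be Ahlfors $n$-regular and let $\mathscr{Y}$ be a class of Ahlfors $n$-regular subsets of $Z$ such that $X\in\mathrm{VBP}(\mathscr{Y})$. Let $\beta\in\mathrm{Co}(X)$. Suppose that there is a constant $K>0$ such that for every $Y\in\mathscr{Y}$ there exists a coefficient $\beta_Y\in\mathrm{Co}(Z)$ with the following two properties: (1) $\beta_Y\in\mathrm{WC}(X)\cup\mathrm{WC}(Y)$, with constants depending only on $n$, the Ahlfors regularity constants of $X$ and $Y$, and the VBP constant (that is, the weak Carleson constants $C=C(\epsilon)$ and the function $f$ from the definition of a coefficient depend on $Y$ only through its regularity constant); (2) for every Christ-David lattice $\mathscr{D}(X)$ of $X$ and every $Q\in\mathscr{D}(X)$, $$\beta(c_0B_Q)\le K\left(\frac{\mathscr{H}^n(Q\setminus Y)}{\ell(Q)^n}+\beta_Y(c_0B_Q)\right).$$ Then $\beta\in\mathrm{WC}(X)$.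
   Context: $B(x,r)$ is the closed ball; $B_Q=B(x_Q,\ell(Q))$ and $c_0B_Q=B(x_Q,c_0\ell(Q))$ with $c_0=1/500$. Hausdorff measure: $\mathscr{H}^n(F)=\lim_{\delta\to0}\inf\{\sum_i\mathrm{diam}(E_i)^n:F\subseteq\bigcup_iE_i,\ \mathrm{diam}(E_i)<\delta\}$. A space $W$ is Ahlfors $n$-regular with constant $C_0$ if $C_0^{-1}r^n\le\mathscr{H}^n(B(x,r)\cap W)\le C_0r^n$ for all $x\in W$, $0<r<\mathrm{diam}(W)$. Christ-David lattice of a doubling space $W$: fix $\rho<1/1000$ and maximal $\rho^k$-nets $W_k$ ($k\in\mathbb{Z}$) of $W$. A Christ-David lattice is $\mathscr{D}(W)=\bigcup_k\mathscr{D}_k$, with $\mathscr{D}_k$ a collection of Borel subsets ("cubes") of $W$, such that: (i) $W=\bigcup_{Q\in\mathscr{D}_k}Q$; (ii) if $Q\cap Q'\ne\emptyset$ then $Q\subseteq Q'$ or $Q'\subseteq Q$; (iii) for $Q\in\mathscr{D}_k$ put $\ell(Q)=5\rho^k$; there is $x_Q\in W_k$ with $B(x_Q,c_0\ell(Q))\cap W\subseteq Q\subseteq B(x_Q,\ell(Q))$, and $W_k=\{x_Q:Q\in\mathscr{D}_k\}$; (iv) if $W$ is Ahlfors $n$-regular, there is $C\ge1$ with $\mathscr{H}^n(\{x\in Q:d(x,W\setminus Q)\le\eta\rho^k\})\lesssim\eta^{1/C}\ell(Q)^n$ for $Q\in\mathscr{D}_k$, $\eta>0$. (Cubes carry their generation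 $k$.) Coefficients: $\beta:W\times[0,\mathrm{diam}(W))\to\mathbb{R}$ is a coefficient on $W$, written $\beta\in\mathrm{Co}(W)$, if there is an increasing, doubling function $f:\mathbb{R}\to\mathbb{R}$ ($f(2s)\le C_ff(s)$ for $s\ge1$) with $f(1)=1$ such that $\beta(y,t)\le f(r/t)\beta(x,r)$ whenever $x,y\in W$, $0<t<r$, $B(y,t)\subseteq B(x,r)$. One writes $\beta(B(x,r))=\beta(x,r)$ and $\beta(Q)=\beta(B_Q)$. Conditions involving $\beta(x,r)$ are imposed only for radii $r$ at which $\beta$ is defined. Weak Carleson condition: for $W$ doubling with a Christ-David lattice $\mathscr{D}(W)$, $\beta\in\mathrm{WC}(W)$ means that $\beta$ is a coefficient and for every $\epsilon>0$ there is $C>0$ such that $\sum_{Q\in\mathscr{D}(W),\,Q\subseteq R,\ \beta(Q)>\epsilon}\ell(Q)^n\le C\ell(R)^n$ for all $R\in\mathscr{D}(W)$. For $\beta_Y\in\mathrm{Co}(Z)$ and $W\subseteq Z$, "$\beta_Y\in\mathrm{WC}(W)$" means that this inequality holds for the values $\beta_Y(Q)=\beta_Y(x_Q,\ell(Q))$, $Q\in\mathscr{D}(W)$. Very big pieces: $X\in\mathrm{VBP}(\mathscr{Y})$ means that for every $\epsilon>0$ there is $C_0>0$ (the VBP constant) such that for every $x\in X$ and $0<r<\mathrm{diam}(X)$ there is $Y\in\mathscr{Y}$, Ahlfors $n$-regular with constant $C_0$, with $\mathscr{H}^n(B(x,r)\cap X\cap Y)\ge(1-\epsilon)\mathscr{H}^n(B(x,r)\cap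 X)$.
   Formalization: Every Y in the class is additionally assumed H^n-measurable (e.g. Borel); for arbitrary regular subsets the claim fails. X and every Y are assumed doubling and equipped with a Christ-David lattice, as the definition of WC presupposes. *)

theory Defs
  imports "HOL-Analysis.Analysis"
begin

text \<open>The ambient metric space \<open>Z\<close> is a type of class \<^class>\<open>metric_space\<close>; all other spaces are
  subsets of it, and \<open>B(x,r)\<close> is the ball \<^term>\<open>cball x r\<close> of the ambient space.
  The library's \<^const>\<open>diameter\<close> is real-valued, hence arbitrary on unbounded sets; the diameter
  used here takes the value \<open>\<infinity>\<close> there (and \<open>0\<close> on the empty set).\<close>

definition ediam :: "'a::metric_space set \<Rightarrow> ennreal" where
  "ediam S = (SUP x\<in>S. SUP y\<in>S. ennreal (dist x y))"

text \<open>An outer measure, defined on all subsets. Covers are sequences; finite covers are padded with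
  empty sets, which cost \<open>0\<close> if \<open>n \<ge> 1\<close>.\<close>

definition hausdorff_pre :: "nat \<Rightarrow> real \<Rightarrow> 'a::metric_space set \<Rightarrow> ennreal" where
  "hausdorff_pre n \<delta> F =
     (INF E\<in>{E :: nat \<Rightarrow> 'a set. F \<subseteq> (\<Union>i. E i) \<and> (\<forall>i. ediam (E i) < ennreal \<delta>)}.
        \<Sum>i. ediam (E i) ^ n)"

definition hausdorff :: "nat \<Rightarrow> 'a::metric_space set \<Rightarrow> ennreal" where
  "hausdorff n F = Lim (at_right 0) (\<lambda>\<delta>. hausdorff_pre n \<delta> F)"

text \<open>Measurability in the sense of Caratheodory.\<close>

definition hausdorff_measurable :: "nat \<Rightarrow> 'a::metric_space set \<Rightarrow> bool" where
  "hausdorff_measurable n A \<longleftrightarrow> A \<in> lambda_system UNIV UNIV (hausdorff n)"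

definition ahlfors_regular :: "nat \<Rightarrow> real \<Rightarrow> 'a::metric_space set \<Rightarrow> bool" where
  "ahlfors_regular n C\<^sub>0 W \<longleftrightarrow> 0 < C\<^sub>0 \<and>
     (\<forall>x\<in>W. \<forall>r>0. ennreal r < ediam W \<longrightarrow>
        ennreal (inverse C\<^sub>0 * r ^ n) \<le> hausdorff n (cball x r \<inter> W) \<and>
        hausdorff n (cball x r \<inter> W) \<le> ennreal (C\<^sub>0 * r ^ n))"

definition doubling_space :: "'a::metric_space set \<Rightarrow> bool" where
  "doubling_space W \<longleftrightarrow>
     (\<exists>N::nat. \<forall>x\<in>W. \<forall>r>0. \<exists>A. A \<subseteq> W \<and> finite A \<and> card A \<le> N \<and>
        cball x r \<inter> W \<subseteq> (\<Union>y\<in>A. cball y (r / 2)))"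

definition separated :: "real \<Rightarrow> 'a::metric_space set \<Rightarrow> bool" where
  "separated s N \<longleftrightarrow> (\<forall>x\<in>N. \<forall>y\<in>N. x \<noteq> y \<longrightarrow> s \<le> dist x y)"

definition maximal_net :: "real \<Rightarrow> 'a::metric_space set \<Rightarrow> 'a set \<Rightarrow> bool" where
  "maximal_net s W N \<longleftrightarrow> N \<subseteq> W \<and> separated s N \<and>
     (\<forall>M. N \<subseteq> M \<and> M \<subseteq> W \<and> separated s M \<longrightarrow> M = N)"

definition c\<^sub>0 :: real where
  "c\<^sub>0 = 1 / 500"

text \<open>The side length \<open>\<ell>(Q)\<close> of a cube of generation \<open>k\<close>.\<close>

definition side :: "real \<Rightarrow> int \<Rightarrow> real" where
  "side \<rho> k = 5 * \<rho> powi k"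

text \<open>A cube is a pair of a generation \<open>k\<close> and a set \<open>Q \<in> cubes L k\<close>: the same set may occur in
  several generations, with different side lengths and centres.\<close>

record 'a lattice_data =
  net :: "int \<Rightarrow> 'a set"
  cubes :: "int \<Rightarrow> 'a set set"
  centre :: "int \<Rightarrow> 'a set \<Rightarrow> 'a"

text \<open>In the last clause the distance to \<open>W - Q\<close> is an infimum in \<^typ>\<open>ennreal\<close>, so that it is
  \<open>\<infinity>\<close> if \<open>Q = W\<close> (whereas \<^const>\<open>infdist\<close> would be \<open>0\<close>). The constants \<open>C\<close> and \<open>A\<close>, the latter
  implicit in the relation \<open>\<lesssim>\<close>, do not depend on \<open>Q\<close> and \<open>\<eta>\<close>.\<close>

definition christ_david_lattice ::
    "nat \<Rightarrow> real \<Rightarrow> 'a::metric_space set \<Rightarrow> 'a lattice_data \<Rightarrow> bool" where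
  "christ_david_lattice n \<rho> W L \<longleftrightarrow>
     doubling_space W \<and>
     (\<forall>k. maximal_net (\<rho> powi k) W (net L k)) \<and>
     (\<forall>k. cubes L k \<subseteq> sets (restrict_space borel W)) \<and>
     (\<forall>k. W = \<Union> (cubes L k)) \<and>
     (\<forall>k j. \<forall>Q\<in>cubes L k. \<forall>Q'\<in>cubes L j. Q \<inter> Q' \<noteq> {} \<longrightarrow> Q \<subseteq> Q' \<or> Q' \<subseteq> Q) \<and>
     (\<forall>k. \<forall>Q\<in>cubes L k. cball (centre L k Q) (c\<^sub>0 * side \<rho> k) \<inter> W \<subseteq> Q \<and>
        Q \<subseteq> cball (centre L k Q) (side \<rho> k)) \<and>
     (\<forall>k. net L k = centre L k ` cubes L k) \<and>
     ((\<exists>C\<^sub>0. ahlfors_regular n C\<^sub>0 W) \<longrightarrow>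
       (\<exists>C\<ge>1. \<exists>A>0. \<forall>k. \<forall>Q\<in>cubes L k. \<forall>\<eta>>0.
          hausdorff n {x\<in>Q. (INF y\<in>W - Q. ennreal (dist x y)) \<le> ennreal (\<eta> * \<rho> powi k)}
            \<le> ennreal (A * \<eta> powr (1 / C) * side \<rho> k ^ n)))"

text \<open>A coefficient on \<open>W\<close> is a function on \<open>W \<times> [0, diam W)\<close>; it is represented by a total
  function of which only the values on that domain are ever used.\<close>

definition coefficient_with ::
    "(real \<Rightarrow> real) \<Rightarrow> 'a::metric_space set \<Rightarrow> ('a \<Rightarrow> real \<Rightarrow> real) \<Rightarrow> bool" where
  "coefficient_with f W \<beta> \<longleftrightarrow>
     mono f \<and> (\<exists>C\<^sub>f. \<forall>s\<ge>1. f (2 * s) \<le> C\<^sub>f * f s) \<and> f 1 = 1 \<and>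
     (\<forall>x\<in>W. \<forall>y\<in>W. \<forall>t r. 0 < t \<and> t < r \<and> ennreal r < ediam W \<and> cball y t \<subseteq> cball x r \<longrightarrow>
        \<beta> y t \<le> f (r / t) * \<beta> x r)"

definition coefficient :: "'a::metric_space set \<Rightarrow> ('a \<Rightarrow> real \<Rightarrow> real) \<Rightarrow> bool" where
  "coefficient W \<beta> \<longleftrightarrow> (\<exists>f. coefficient_with f W \<beta>)"

text \<open>The Carleson packing inequality of \<open>\<beta>\<close> on \<open>W\<close> at level \<open>\<epsilon>\<close> with constant \<open>C\<close>. The sum is over
  cubes \<open>(k, Q)\<close>. For a coefficient on a larger space, its restriction to
  \<open>W \<times> [0, diam W)\<close> is meant.\<close>

definition carleson_packing ::
    "nat \<Rightarrow> real \<Rightarrow> 'a::metric_space set \<Rightarrow> 'a lattice_data \<Rightarrow> ('a \<Rightarrow> real \<Rightarrow> real) \<Rightarrow>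
      real \<Rightarrow> real \<Rightarrow> bool" where
  "carleson_packing n \<rho> W L \<beta> \<epsilon> C \<longleftrightarrow>
     (\<forall>j. \<forall>R\<in>cubes L j.
        (\<Sum>\<^sub>\<infinity>(k, Q)\<in>{(k, Q). Q \<in> cubes L k \<and> Q \<subseteq> R \<and> ennreal (side \<rho> k) < ediam W \<and>
                           \<beta> (centre L k Q) (side \<rho> k) > \<epsilon>}. ennreal (side \<rho> k ^ n))
          \<le> ennreal (C * side \<rho> j ^ n))"

definition weak_carleson ::
    "nat \<Rightarrow> real \<Rightarrow> 'a::metric_space set \<Rightarrow> 'a lattice_data \<Rightarrow> ('a \<Rightarrow> real \<Rightarrow> real) \<Rightarrow> bool" where
  "weak_carleson n \<rho> W L \<beta> \<longleftrightarrow>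
     coefficient W \<beta> \<and> (\<forall>\<epsilon>>0. \<exists>C>0. carleson_packing n \<rho> W L \<beta> \<epsilon> C)"

definition very_big_pieces :: "nat \<Rightarrow> 'a::metric_space set \<Rightarrow> 'a set set \<Rightarrow> bool" where
  "very_big_pieces n X \<Y> \<longleftrightarrow>
     (\<forall>\<epsilon>>0. \<exists>C\<^sub>0>0. \<forall>x\<in>X. \<forall>r>0. ennreal r < ediam X \<longrightarrow>
        (\<exists>Y\<in>\<Y>. ahlfors_regular n C\<^sub>0 Y \<and>
           hausdorff n (cball x r \<inter> X \<inter> Y) \<ge> ennreal (1 - \<epsilon>) * hausdorff n (cball x r \<inter> X)))"

end

theory Submission
  imports Defs
begin

text \<open>
  A bad pair is a generation \<open>k\<close> and a net point \<open>x\<close> of that generation at which \<open>\<beta>\<close> exceeds the level \<open>\<epsilon>\<close> on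
  the ball of radius \<open>\<ell> = 5 \<rho>^k\<close>. Since boundedly many cubes share a centre, it suffices to bound the mass
  \<open>\<Sum> \<rho>^(k n)\<close> of the bad pairs in a ball of radius \<open>\<rho>^j\<close>, with \<open>k \<ge> j\<close>, by a multiple of \<open>\<rho>^(j n)\<close>.

  The estimate by a piece \<open>Y\<close> concerns the balls \<open>c\<^sub>0 B_Q\<close>, and for a single lattice these balls need not
  cover the space at any scale. It is available for all lattices, however, so a lattice may be made to
  measure for each bad pair: the one of \<open>cube_system_with_centre\<close> has a cube \<open>Q\<close> of generation
  \<open>k - 1\<close> with centre \<open>x\<close>, and \<open>\<rho> < 1/1000\<close> makes \<open>c\<^sub>0 B_Q\<close> larger than the ball of radius \<open>5 \<rho>^k\<close>. It keeps
  the fine cubes of a given lattice and rebuilds the coarse ones. That its cubes have small boundaries is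
  automatic by \<open>small_boundary\<close>: the boundary of a cube is porous, because finer cubes have centres deep
  inside of it, and porous sets lose a fixed proportion of their neighbourhoods at every scale.

  Now take a ball and a piece \<open>Y\<close> that covers all of it but a small proportion. By
  \<open>bad_pair_near_piece\<close>, a bad pair in the ball falls under one of two heads. Either \<open>X - Y\<close> is noticeable at the
  location and scale of the pair; by the Vitali covering lemma such pairs lie in balls whose total mass is at
  most half of that of the initial ball (\<open>stopping_family\<close>). Or the coefficient of \<open>Y\<close> is large there and \<open>Y\<close>
  passes nearby; such pairs are packed by the weak Carleson condition, on \<open>X\<close> or on \<open>Y\<close>
  (\<open>packing_transfer\<close>). Repeating the argument inside the stopped balls, with new pieces, bounds the total
  mass by a geometric series (\<open>stopping_time_packing\<close>).

  All measure theory that is needed is contained in two properties of the Hausdorff measure, finite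
  subadditivity and superadditivity on sets at positive distance, and in the measurability of the pieces.
\<close>

section \<open>Hausdorff measure as a metric outer measure\<close>

lemma ediam_empty [simp]: "ediam {} = 0"
  by (simp add: ediam_def bot_ennreal)

lemma ediam_mono: "A \<subseteq> B \<Longrightarrow> ediam A \<le> ediam B"
  unfolding ediam_def by (intro SUP_mono; force intro!: SUP_subset_mono)

lemma dist_le_ediam: "x \<in> S \<Longrightarrow> y \<in> S \<Longrightarrow> ennreal (dist x y) \<le> ediam S"
  unfolding ediam_def by (intro SUP_upper2[of x] SUP_upper2[of y]) auto

lemma hausdorff_pre_antimono: "\<delta> \<le> \<delta>' \<Longrightarrow> hausdorff_pre n \<delta>' F \<le> hausdorff_pre n \<delta> F"
  unfolding hausdorff_pre_def
  by (rule INF_superset_mono) (auto intro: less_le_trans ennreal_leI)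

text \<open>The premeasures increase as \<open>\<delta>\<close> decreases, so their limit at \<open>0\<close> exists and is a supremum.\<close>

lemma hausdorff_eq_SUP: "hausdorff n F = (SUP \<delta>\<in>{0<..}. hausdorff_pre n \<delta> F)"
proof -
  let ?s = "SUP \<delta>\<in>{0<..}. hausdorff_pre n \<delta> F"
  have "((\<lambda>\<delta>. hausdorff_pre n \<delta> F) \<longlongrightarrow> ?s) (at_right 0)"
  proof (rule order_tendstoI)
    fix a assume "a < ?s"
    then obtain d where d: "d > 0" "a < hausdorff_pre n d F"
      by (auto simp: less_SUP_iff)
    show "\<forall>\<^sub>F x in at_right 0. a < hausdorff_pre n x F"
      unfolding eventually_at_right_field
      using d hausdorff_pre_antimono[of _ d n F] by (metis less_eq_real_def order_less_le_trans)
  next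
    fix a assume a: "?s < a"
    have "hausdorff_pre n x F \<le> ?s" if "x > 0" for x
      using that by (intro SUP_upper) auto
    then show "\<forall>\<^sub>F x in at_right 0. hausdorff_pre n x F < a"
      unfolding eventually_at_right_field using a by (metis order_le_less_trans zero_less_one)
  qed
  then show ?thesis
    unfolding hausdorff_def by (intro tendsto_Lim) auto
qed

lemma hausdorff_pre_le_hausdorff: "\<delta> > 0 \<Longrightarrow> hausdorff_pre n \<delta> F \<le> hausdorff n F"
  unfolding hausdorff_eq_SUP by (intro SUP_upper) auto

lemma hausdorff_leI:
  assumes "\<And>\<delta>. \<delta> > 0 \<Longrightarrow> hausdorff_pre n \<delta> F \<le> c"
  shows "hausdorff n F \<le> c"
  unfolding hausdorff_eq_SUP using assms by (intro SUP_least) auto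

lemma hausdorff_mono: "A \<subseteq> B \<Longrightarrow> hausdorff n A \<le> hausdorff n B"
proof (rule hausdorff_leI)
  fix \<delta> :: real assume "A \<subseteq> B" "\<delta> > 0"
  then have "hausdorff_pre n \<delta> A \<le> hausdorff_pre n \<delta> B"
    unfolding hausdorff_pre_def by (intro INF_superset_mono) auto
  also have "\<dots> \<le> hausdorff n B" using \<open>\<delta> > 0\<close> by (rule hausdorff_pre_le_hausdorff)
  finally show "hausdorff_pre n \<delta> A \<le> hausdorff n B" .
qed

lemma hausdorff_empty [simp]:
  assumes "n \<ge> 1" shows "hausdorff n {} = 0"
proof -
  have "hausdorff_pre n \<delta> {} \<le> 0" if "\<delta> > 0" for \<delta>
    unfolding hausdorff_pre_def
    by (rule INF_lower2[of "\<lambda>_. {}"]) (use that assms in \<open>auto simp: power_0_left\<close>)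
  then show ?thesis using hausdorff_leI[of n "{}" 0] by auto
qed

lemma le_add_INF_ennreal:
  fixes g :: "'b \<Rightarrow> ennreal"
  assumes "\<And>b. b \<in> T \<Longrightarrow> c \<le> K + g b"
  shows "c \<le> K + (INF b\<in>T. g b)"
proof (cases "K = top")
  case False
  then have "c - K \<le> (INF b\<in>T. g b)"
    using assms by (intro INF_greatest) (auto simp: ennreal_minus_le_iff)
  then have "K + (c - K) \<le> K + (INF b\<in>T. g b)" by (rule add_left_mono)
  then show ?thesis
    by (cases "K \<le> c") (auto simp: add_diff_self_ennreal intro: order_trans[of c K])
qed auto

lemma le_INF_add_INF_ennreal:
  fixes f :: "'b \<Rightarrow> ennreal" and g :: "'c \<Rightarrow> ennreal"
  assumes "\<And>a b. a \<in> S \<Longrightarrow> b \<in> T \<Longrightarrow> c \<le> f a + g b"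
  shows "c \<le> (INF a\<in>S. f a) + (INF b\<in>T. g b)"
  by (metis add.commute assms le_add_INF_ennreal)

text \<open>Covers of the two sets are interleaved into one sequence.\<close>

lemma hausdorff_pre_Un:
  "hausdorff_pre n \<delta> (A \<union> B) \<le> hausdorff_pre n \<delta> A + hausdorff_pre n \<delta> B"
proof -
  have main: "hausdorff_pre n \<delta> (A \<union> B) \<le> (\<Sum>i. ediam (E i) ^ n) + (\<Sum>i. ediam (F i) ^ n)"
    if E: "A \<subseteq> (\<Union>i. E i)" "\<forall>i. ediam (E i) < ennreal \<delta>"
      and F: "B \<subseteq> (\<Union>i. F i)" "\<forall>i. ediam (F i) < ennreal \<delta>" for E F :: "nat \<Rightarrow> 'a set"
  proof -
    define G where "G i = (if even i then E (i div 2) else F (i div 2))" for i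
    have "A \<union> B \<subseteq> (\<Union>i. G i)"
    proof
      fix z assume "z \<in> A \<union> B"
      then consider i where "z \<in> E i" | i where "z \<in> F i" using E F by blast
      then show "z \<in> (\<Union>i. G i)"
      proof cases
        case 1 then have "z \<in> G (2 * i)" by (simp add: G_def)
        then show ?thesis by blast
      next
        case 2 then have "z \<in> G (2 * i + 1)" by (simp add: G_def)
        then show ?thesis by blast
      qed
    qed
    moreover have "\<forall>i. ediam (G i) < ennreal \<delta>" using E F by (simp add: G_def)
    ultimately have "hausdorff_pre n \<delta> (A \<union> B) \<le> (\<Sum>i. ediam (G i) ^ n)"
      unfolding hausdorff_pre_def by (intro INF_lower) auto
    also have "\<dots> \<le> (\<Sum>i. ediam (E i) ^ n) + (\<Sum>i. ediam (F i) ^ n)"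
    proof (rule suminf_le_const)
      fix N
      have eq: "(\<Sum>i<2 * N. ediam (G i) ^ n) = (\<Sum>i<N. ediam (E i) ^ n) + (\<Sum>i<N. ediam (F i) ^ n)"
        by (induction N) (simp_all add: G_def algebra_simps)
      have "(\<Sum>i<N. ediam (G i) ^ n) \<le> (\<Sum>i<2 * N. ediam (G i) ^ n)"
        by (intro sum_mono2) auto
      also have "\<dots> \<le> (\<Sum>i. ediam (E i) ^ n) + (\<Sum>i. ediam (F i) ^ n)"
        unfolding eq by (intro add_mono sum_le_suminf) auto
      finally show "(\<Sum>i<N. ediam (G i) ^ n) \<le> (\<Sum>i. ediam (E i) ^ n) + (\<Sum>i. ediam (F i) ^ n)" .
    qed auto
    finally show ?thesis .
  qed
  then show ?thesis
    unfolding hausdorff_pre_def[of n \<delta> A] hausdorff_pre_def[of n \<delta> B]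
    by (intro le_INF_add_INF_ennreal) auto
qed

lemma hausdorff_Un: "hausdorff n (A \<union> B) \<le> hausdorff n A + hausdorff n B"
  by (rule hausdorff_leI)
     (meson add_mono hausdorff_pre_Un hausdorff_pre_le_hausdorff order_trans)

lemma hausdorff_UN:
  assumes "n \<ge> 1" "finite I"
  shows "hausdorff n (\<Union>i\<in>I. A i) \<le> (\<Sum>i\<in>I. hausdorff n (A i))"
  using assms(2)
proof induction
  case empty then show ?case using assms(1) by simp
next
  case (insert i I)
  then show ?case
    using hausdorff_Un[of n "A i" "\<Union>i\<in>I. A i"] by (auto intro: order_trans add_left_mono)
qed

text \<open>The Hausdorff measure is a metric outer measure: a set that is smaller than the distance of
  two sets meets at most one of them, so every fine cover of their union splits into two covers.\<close>

lemma hausdorff_separated_Un: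
  assumes n: "n \<ge> 1" and s: "s > 0" and sep: "\<And>a b. a \<in> A \<Longrightarrow> b \<in> B \<Longrightarrow> s \<le> dist a b"
  shows "hausdorff n A + hausdorff n B \<le> hausdorff n (A \<union> B)"
proof -
  have pre: "hausdorff_pre n \<delta> A + hausdorff_pre n \<delta> B \<le> hausdorff_pre n \<delta> (A \<union> B)"
    if "\<delta> \<le> s" for \<delta>
    unfolding hausdorff_pre_def[of n \<delta> "A \<union> B"]
  proof (rule INF_greatest, clarify)
    fix E :: "nat \<Rightarrow> 'a set"
    assume E: "A \<union> B \<subseteq> (\<Union>i. E i)" "\<forall>i. ediam (E i) < ennreal \<delta>"
    define F where "F S i = (if E i \<inter> S = {} then {} else E i)" for S i
    have F: "hausdorff_pre n \<delta> S \<le> (\<Sum>i. ediam (F S i) ^ n)" if SAB: "S \<subseteq> A \<union> B" for S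
    proof -
      have "ediam (F S i) < ennreal \<delta>" for i
        using E(2) le_less_trans[of 0 "ediam (E i)" "ennreal \<delta>"] by (simp add: F_def)
      moreover have "S \<subseteq> (\<Union>i. F S i)"
      proof
        fix z assume z: "z \<in> S"
        then obtain i where "z \<in> E i" using E(1) SAB by blast
        then have "z \<in> F S i" using z by (auto simp: F_def)
        then show "z \<in> (\<Union>i. F S i)" by blast
      qed
      ultimately show ?thesis
        unfolding hausdorff_pre_def by (intro INF_lower) auto
    qed
    have one: "E i \<inter> A = {} \<or> E i \<inter> B = {}" for i
    proof (rule ccontr)
      assume "\<not> ?thesis"
      then obtain a b where ab: "a \<in> E i" "a \<in> A" "b \<in> E i" "b \<in> B" by blast
      have "ennreal (dist a b) < ennreal \<delta>"
        using dist_le_ediam[OF ab(1,3)] E(2) by (metis le_less_trans)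
      then show False using sep[OF ab(2,4)] \<open>\<delta> \<le> s\<close> by (auto simp: ennreal_less_iff)
    qed
    have "hausdorff_pre n \<delta> A + hausdorff_pre n \<delta> B
        \<le> (\<Sum>i. ediam (F A i) ^ n) + (\<Sum>i. ediam (F B i) ^ n)"
      by (intro add_mono F) auto
    also have "\<dots> = (\<Sum>i. ediam (F A i) ^ n + ediam (F B i) ^ n)"
      by (rule suminf_add) auto
    also have "\<dots> \<le> (\<Sum>i. ediam (E i) ^ n)"
    proof (rule suminf_le)
      fix i show "ediam (F A i) ^ n + ediam (F B i) ^ n \<le> ediam (E i) ^ n"
        using one[of i] n by (auto simp: F_def power_0_left)
    qed auto
    finally show "hausdorff_pre n \<delta> A + hausdorff_pre n \<delta> B \<le> (\<Sum>i. ediam (E i) ^ n)" .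
  qed
  have le: "hausdorff_pre n \<delta> A + hausdorff_pre n \<delta>' B \<le> hausdorff n (A \<union> B)"
    if "\<delta> > 0" "\<delta>' > 0" for \<delta> \<delta>'
  proof -
    define d where "d = min s (min \<delta> \<delta>')"
    have "hausdorff_pre n \<delta> A + hausdorff_pre n \<delta>' B \<le> hausdorff_pre n d A + hausdorff_pre n d B"
      by (intro add_mono hausdorff_pre_antimono) (auto simp: d_def)
    also have "\<dots> \<le> hausdorff_pre n d (A \<union> B)" by (rule pre) (simp add: d_def)
    also have "\<dots> \<le> hausdorff n (A \<union> B)"
      by (rule hausdorff_pre_le_hausdorff) (use s that in \<open>auto simp: d_def\<close>)
    finally show ?thesis .
  qed
  have "hausdorff n A + hausdorff_pre n \<delta>' B \<le> hausdorff n (A \<union> B)" if "\<delta>' > 0" for \<delta>'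
    unfolding hausdorff_eq_SUP[of n A]
    by (subst ennreal_SUP_add_left[symmetric]) (auto intro!: SUP_least le that)
  then show ?thesis
    unfolding hausdorff_eq_SUP[of n B]
    by (subst add.commute, subst ennreal_SUP_add_left[symmetric])
       (auto intro!: SUP_least simp: add.commute)
qed

lemma hausdorff_separated_UN:
  assumes n: "n \<ge> 1" and s: "s > 0" and "finite I"
    and sep: "\<And>i j a b. i \<in> I \<Longrightarrow> j \<in> I \<Longrightarrow> i \<noteq> j \<Longrightarrow> a \<in> A i \<Longrightarrow> b \<in> A j \<Longrightarrow> s \<le> dist a b"
  shows "(\<Sum>i\<in>I. hausdorff n (A i)) \<le> hausdorff n (\<Union>i\<in>I. A i)"
  using \<open>finite I\<close> sep
proof induction
  case empty then show ?case by simp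
next
  case (insert i I)
  have "(\<Sum>j\<in>I. hausdorff n (A j)) \<le> hausdorff n (\<Union>j\<in>I. A j)"
    using insert by blast
  moreover have "hausdorff n (A i) + hausdorff n (\<Union>j\<in>I. A j) \<le> hausdorff n (A i \<union> (\<Union>j\<in>I. A j))"
    by (rule hausdorff_separated_Un[OF n s]) (use insert in auto)
  ultimately show ?case
    using insert.hyps by (auto intro: order_trans add_left_mono)
qed

section \<open>Regular sets and separated nets\<close>

lemma ahlfors_lower:
  assumes "ahlfors_regular n C W" "x \<in> W" "r > 0" "ennreal r < ediam W"
  shows "ennreal (inverse C * r ^ n) \<le> hausdorff n (cball x r \<inter> W)"
  using assms unfolding ahlfors_regular_def by blast

lemma ahlfors_upper_local:
  assumes "ahlfors_regular n C W" "x \<in> W" "r > 0" "ennreal r < ediam W"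
  shows "hausdorff n (cball x r \<inter> W) \<le> ennreal (C * r ^ n)"
  using assms unfolding ahlfors_regular_def by blast

lemma ahlfors_pos: "ahlfors_regular n C W \<Longrightarrow> 0 < C"
  unfolding ahlfors_regular_def by blast

lemma ahlfors_regular_mono:
  assumes W: "ahlfors_regular n C W" and "C \<le> C'"
  shows "ahlfors_regular n C' W"
proof -
  have C: "0 < C" by (rule ahlfors_pos[OF W])
  have "ennreal (inverse C' * r ^ n) \<le> hausdorff n (cball x r \<inter> W) \<and>
        hausdorff n (cball x r \<inter> W) \<le> ennreal (C' * r ^ n)"
    if x: "x \<in> W" "r > 0" "ennreal r < ediam W" for x r
  proof
    have "inverse C' * r ^ n \<le> inverse C * r ^ n"
      using C assms(2) x(2) by (intro mult_right_mono le_imp_inverse_le) auto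
    then show "ennreal (inverse C' * r ^ n) \<le> hausdorff n (cball x r \<inter> W)"
      using ahlfors_lower[OF W x] ennreal_leI order_trans by blast
    have "C * r ^ n \<le> C' * r ^ n"
      using assms(2) x(2) by (intro mult_right_mono) auto
    then show "hausdorff n (cball x r \<inter> W) \<le> ennreal (C' * r ^ n)"
      using ahlfors_upper_local[OF W x] ennreal_leI order_trans by blast
  qed
  then show ?thesis unfolding ahlfors_regular_def using C assms(2) by auto
qed

text \<open>Regularity speaks of radii below the diameter only; on a bounded set, the doubling property
  extends the upper bound to all radii, since it covers the set by boundedly many balls of half its
  diameter.\<close>

lemma ahlfors_upper:
  assumes n: "n \<ge> 1" and reg: "ahlfors_regular n C W" and dbl: "doubling_space W"
    and diam: "0 < ediam W"
  obtains C\<^sub>1 where "C\<^sub>1 > 0" "\<And>z r. r > 0 \<Longrightarrow> hausdorff n (cball z r \<inter> W) \<le> ennreal (C\<^sub>1 * r ^ n)"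
proof -
  have C: "0 < C" by (rule ahlfors_pos[OF reg])
  obtain N :: nat where N: "\<And>x r. x \<in> W \<Longrightarrow> r > 0 \<Longrightarrow> \<exists>A. A \<subseteq> W \<and> finite A \<and> card A \<le> N \<and>
        cball x r \<inter> W \<subseteq> (\<Union>y\<in>A. cball y (r / 2))"
    using dbl unfolding doubling_space_def by blast
  define C\<^sub>2 where "C\<^sub>2 = (real N + 1) * C"
  have C2: "C \<le> C\<^sub>2" "C\<^sub>2 > 0" using C by (auto simp: C\<^sub>2_def algebra_simps intro: add_pos_nonneg)
  have upper: "hausdorff n (cball w r \<inter> W) \<le> ennreal (C\<^sub>2 * r ^ n)" if w: "w \<in> W" and r: "r > 0" for w r
  proof (cases "ennreal r < ediam W")
    case True
    have "C * r ^ n \<le> C\<^sub>2 * r ^ n" using C2 r by (intro mult_right_mono) auto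
    then show ?thesis using ahlfors_upper_local[OF reg w r True] ennreal_leI order_trans by blast
  next
    case False
    then have "ediam W \<le> ennreal r" by simp
    then obtain d where d: "ediam W = ennreal d" "0 < d" "d \<le> r"
      using diam r by (cases "ediam W" rule: ennreal_cases) (auto simp: ennreal_less_zero_iff top_unique)
    obtain A where A: "A \<subseteq> W" "finite A" "card A \<le> N" "cball w d \<inter> W \<subseteq> (\<Union>y\<in>A. cball y (d / 2))"
      using N[OF w d(2)] by blast
    have "W \<subseteq> cball w d"
      using dist_le_ediam[OF w, of _ ] d by auto
    then have "hausdorff n (cball w r \<inter> W) \<le> hausdorff n (\<Union>y\<in>A. cball y (d / 2) \<inter> W)"
      using A(4) by (intro hausdorff_mono) blast
    also have "\<dots> \<le> (\<Sum>y\<in>A. hausdorff n (cball y (d / 2) \<inter> W))"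
      by (rule hausdorff_UN[OF n A(2)])
    also have "\<dots> \<le> (\<Sum>y\<in>A. ennreal (C * (d / 2) ^ n))"
      using A(1) d by (intro sum_mono ahlfors_upper_local[OF reg]) (auto simp: ennreal_less_iff)
    also have "\<dots> = ennreal (card A * (C * (d / 2) ^ n))"
      using C d by (simp add: ennreal_mult ennreal_of_nat_eq_real_of_nat)
    also have "\<dots> \<le> ennreal (C\<^sub>2 * r ^ n)"
    proof -
      have "card A * (C * (d / 2) ^ n) \<le> (real N + 1) * (C * r ^ n)"
        using A(3) C d by (intro mult_mono power_mono) auto
      then show ?thesis by (simp add: C\<^sub>2_def mult.assoc ennreal_leI)
    qed
    finally show ?thesis .
  qed
  have "hausdorff n (cball z r \<inter> W) \<le> ennreal ((C\<^sub>2 * 2 ^ n) * r ^ n)" if r: "r > 0" for z r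
  proof (cases "cball z r \<inter> W = {}")
    case True then show ?thesis using n by simp
  next
    case False
    then obtain w where w: "w \<in> W" "dist z w \<le> r" by auto
    have "cball z r \<subseteq> cball w (2 * r)"
    proof
      fix u assume "u \<in> cball z r"
      then show "u \<in> cball w (2 * r)" using w dist_triangle[of w u z] by (simp add: dist_commute)
    qed
    then have "hausdorff n (cball z r \<inter> W) \<le> hausdorff n (cball w (2 * r) \<inter> W)"
      by (intro hausdorff_mono) blast
    also have "\<dots> \<le> ennreal (C\<^sub>2 * (2 * r) ^ n)" using upper[OF w(1), of "2 * r"] r by simp
    finally show ?thesis by (simp add: power_mult_distrib mult.assoc)
  qed
  then show ?thesis using that[of "C\<^sub>2 * 2 ^ n"] C2 by auto
qed

text \<open>The balls of radius \<open>s / 3\<close> around \<open>s\<close>-separated points are at distance at least \<open>s / 3\<close> from each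
  other, so the metric outer measure is superadditive on them, and each of them has mass at least
  comparable to \<open>s ^ n\<close>.\<close>

lemma card_separated_bound:
  assumes n: "n \<ge> 1" and reg: "ahlfors_regular n C W"
    and N: "separated s N" "N \<subseteq> W" "N \<subseteq> cball z r" and s: "0 < s" "ennreal (s / 3) < ediam W"
    and U: "hausdorff n (cball z (r + s) \<inter> W) \<le> ennreal U" "U \<ge> 0"
  shows "finite N" and "real (card N) * (s / 3) ^ n \<le> C * U"
proof -
  have C: "0 < C" by (rule ahlfors_pos[OF reg])
  have bound: "real (card F) * (s / 3) ^ n \<le> C * U" if F: "F \<subseteq> N" "finite F" for F
  proof -
    have "(\<Sum>y\<in>F. ennreal (inverse C * (s / 3) ^ n)) \<le> (\<Sum>y\<in>F. hausdorff n (cball y (s / 3) \<inter> W))"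
      using F N s by (intro sum_mono ahlfors_lower[OF reg]) auto
    also have "\<dots> \<le> hausdorff n (\<Union>y\<in>F. cball y (s / 3) \<inter> W)"
    proof (rule hausdorff_separated_UN[OF n _ F(2), of "s / 3"])
      fix i j a b assume *: "i \<in> F" "j \<in> F" "i \<noteq> j" "a \<in> cball i (s / 3) \<inter> W" "b \<in> cball j (s / 3) \<inter> W"
      then have "s \<le> dist i j" using F N(1) unfolding separated_def by blast
      moreover have "dist i j \<le> dist i a + dist a b + dist b j"
        using dist_triangle[of i j a] dist_triangle[of a j b] by linarith
      ultimately show "s / 3 \<le> dist a b" using * by (simp add: dist_commute)
    qed (use s in auto)
    also have "\<dots> \<le> hausdorff n (cball z (r + s) \<inter> W)"
    proof (intro hausdorff_mono subsetI)
      fix u assume "u \<in> (\<Union>y\<in>F. cball y (s / 3) \<inter> W)"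
      then obtain y where *: "y \<in> F" "u \<in> cball y (s / 3)" "u \<in> W" by blast
      then have "dist z y \<le> r" using F N(3) by auto
      then show "u \<in> cball z (r + s) \<inter> W" using * s dist_triangle[of z u y] by auto
    qed
    also have "\<dots> \<le> ennreal U" by (rule U(1))
    finally have "ennreal (card F * (inverse C * (s / 3) ^ n)) \<le> ennreal U"
      using C s by (simp add: ennreal_mult ennreal_of_nat_eq_real_of_nat)
    then have "card F * (inverse C * (s / 3) ^ n) \<le> U" using U(2) by (simp add: ennreal_le_iff)
    then show ?thesis using C by (simp add: field_simps)
  qed
  have "card F \<le> nat \<lceil>C * U / (s / 3) ^ n\<rceil>" if "F \<subseteq> N" "finite F" for F
  proof -
    have "card F \<le> C * U / (s / 3) ^ n" using bound[OF that] s by (simp add: pos_le_divide_eq)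
    then show ?thesis by linarith
  qed
  then show fin: "finite N" using finite_if_finite_subsets_card_bdd by blast
  show "real (card N) * (s / 3) ^ n \<le> C * U" by (rule bound[OF order_refl fin])
qed

lemma maximal_net_dense:
  assumes "maximal_net s W N" "z \<in> W" "s > 0"
  shows "\<exists>y\<in>N. dist z y < s"
proof (rule ccontr)
  assume "\<not> ?thesis"
  then have far: "s \<le> dist z y" if "y \<in> N" for y using that by (metis not_le)
  have N: "N \<subseteq> W" "separated s N" "\<And>M. N \<subseteq> M \<Longrightarrow> M \<subseteq> W \<Longrightarrow> separated s M \<Longrightarrow> M = N"
    using assms(1) unfolding maximal_net_def by auto
  have "separated s (insert z N)"
    using N(2) far unfolding separated_def by (auto simp: dist_commute)
  then have "insert z N = N" using N assms(2) by (intro N(3)) auto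
  then have "z \<in> N" by blast
  then show False using far[of z] assms(3) by simp
qed

lemma maximal_net_exists:
  assumes "x \<in> W" "s > 0"
  obtains N where "maximal_net s W N" "x \<in> N"
proof -
  let ?S = "{N. N \<subseteq> W \<and> separated s N \<and> x \<in> N}"
  have "\<exists>M\<in>?S. \<forall>N\<in>?S. M \<subseteq> N \<longrightarrow> N = M"
  proof (rule subset_Zorn_nonempty)
    have "{x} \<in> ?S" using assms by (simp add: separated_def)
    then show "?S \<noteq> {}" by blast
    fix \<C> assume \<C>: "\<C> \<noteq> {}" "subset.chain ?S \<C>"
    have "separated s (\<Union>\<C>)" unfolding separated_def
    proof clarify
      fix a b A B assume *: "a \<in> A" "A \<in> \<C>" "b \<in> B" "B \<in> \<C>" "a \<noteq> b"
      have "A \<union> B \<in> \<C>"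
        using *(2,4) \<C>(2) unfolding subset_chain_def by (metis sup.absorb1 sup.absorb2)
      then have "separated s (A \<union> B)" using \<C>(2) unfolding subset_chain_def by auto
      then show "s \<le> dist a b" using *(1,3,5) unfolding separated_def by simp
    qed
    then show "\<Union>\<C> \<in> ?S" using \<C> unfolding subset_chain_def by blast
  qed
  then obtain M where "M \<in> ?S" "\<forall>N\<in>?S. M \<subseteq> N \<longrightarrow> N = M" by blast
  then have "maximal_net s W M" "x \<in> M" unfolding maximal_net_def by auto
  then show ?thesis by (rule that)
qed

section \<open>Systems of cubes\<close>

lemma scale_antimono:
  fixes \<rho> :: real
  assumes "0 < \<rho>" "\<rho> < 1 / 1000" "k \<le> l"
  shows "\<rho> powi l \<le> \<rho> powi k"
  using assms by (intro power_int_decreasing) auto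

lemma scale_add1: "0 < \<rho> \<Longrightarrow> (\<rho>::real) powi (k + 1) = \<rho> * \<rho> powi k"
  by (simp add: power_int_add)

lemma scale_less:
  fixes \<rho> :: real
  assumes "0 < \<rho>" "\<rho> < 1 / 1000" "k < l"
  shows "1000 * \<rho> powi l < \<rho> powi k"
proof -
  have "\<rho> powi l \<le> \<rho> powi (k + 1)" using assms by (intro scale_antimono) auto
  also have "\<dots> = \<rho> * \<rho> powi k" using assms by (simp add: scale_add1)
  finally have "1000 * \<rho> powi l \<le> (1000 * \<rho>) * \<rho> powi k" by simp
  also have "\<dots> < 1 * \<rho> powi k" using assms by (intro mult_strict_right_mono) auto
  finally show ?thesis by simp
qed

text \<open>The part of a Christ-David lattice that does not involve measure: all clauses except the doubling
  property and the small boundaries. The radii \<open>c\<^sub>0 \<ell>(Q)\<close> and \<open>\<ell>(Q)\<close> are evaluated to \<open>\<rho> powi k / 100\<close> and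
  \<open>5 * \<rho> powi k\<close>.\<close>

locale cube_system =
  fixes \<rho> :: real and W :: "'a::metric_space set" and L :: "'a lattice_data"
  assumes rho: "0 < \<rho>" "\<rho> < 1 / 1000"
    and maximal_net: "\<And>k. maximal_net (\<rho> powi k) W (net L k)"
    and cubes_borel: "\<And>k. cubes L k \<subseteq> sets (restrict_space borel W)"
    and cover: "\<And>k. W = \<Union> (cubes L k)"
    and nested: "\<And>k j Q Q'. Q \<in> cubes L k \<Longrightarrow> Q' \<in> cubes L j \<Longrightarrow> Q \<inter> Q' \<noteq> {} \<Longrightarrow> Q \<subseteq> Q' \<or> Q' \<subseteq> Q"
    and inner: "\<And>k Q. Q \<in> cubes L k \<Longrightarrow> cball (centre L k Q) (\<rho> powi k / 100) \<inter> W \<subseteq> Q"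
    and outer: "\<And>k Q. Q \<in> cubes L k \<Longrightarrow> Q \<subseteq> cball (centre L k Q) (5 * \<rho> powi k)"
    and net_eq: "\<And>k. net L k = centre L k ` cubes L k"
begin

lemma scale_pos [simp]: "0 < \<rho> powi k"
  using rho by simp

lemma net_subset: "net L k \<subseteq> W"
  using maximal_net unfolding maximal_net_def by blast

lemma net_separated: "separated (\<rho> powi k) (net L k)"
  using maximal_net unfolding maximal_net_def by blast

lemma cube_subset: "Q \<in> cubes L k \<Longrightarrow> Q \<subseteq> W"
  using cover by blast

lemma centre_in_net: "Q \<in> cubes L k \<Longrightarrow> centre L k Q \<in> net L k"
  by (simp add: net_eq)

lemma centre_mem: assumes "Q \<in> cubes L k" shows "centre L k Q \<in> Q"
proof -
  have "centre L k Q \<in> cball (centre L k Q) (\<rho> powi k / 100) \<inter> W"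
    using centre_in_net[OF assms] net_subset by (auto simp: less_imp_le)
  then show ?thesis using inner[OF assms] by blast
qed

lemma cube_near:
  assumes "z \<in> W" obtains Q where "Q \<in> cubes L k" "dist z (centre L k Q) < \<rho> powi k"
  using maximal_net_dense[OF maximal_net[of k] assms] that by (force simp: net_eq)

text \<open>A finer cube is smaller than the ball around the centre of a coarser cube, so it cannot
  contain the latter properly.\<close>

lemma finer_subset:
  assumes P: "P \<in> cubes L k" and S: "S \<in> cubes L l" and "k < l" "P \<inter> S \<noteq> {}"
  shows "S \<subseteq> P"
proof (rule ccontr)
  assume "\<not> S \<subseteq> P"
  then have "P \<subseteq> S" using nested[OF P S] assms(4) by blast
  then have c: "centre L k P \<in> S" using centre_mem[OF P] by blast
  have "S \<subseteq> cball (centre L k P) (\<rho> powi k / 100) \<inter> W"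
  proof
    fix u assume u: "u \<in> S"
    have "dist (centre L k P) u \<le> dist (centre L l S) (centre L k P) + dist (centre L l S) u"
      by (rule dist_triangle3)
    also have "\<dots> \<le> 10 * \<rho> powi l" using subsetD[OF outer[OF S] u] subsetD[OF outer[OF S] c] by simp
    also have "\<dots> \<le> \<rho> powi k / 100" using scale_less[OF rho \<open>k < l\<close>] by simp
    finally show "u \<in> cball (centre L k P) (\<rho> powi k / 100) \<inter> W" using u cube_subset[OF S] by auto
  qed
  then show False using inner[OF P] \<open>\<not> S \<subseteq> P\<close> by blast
qed

lemma cube_eq_Union:
  assumes Q: "Q \<in> cubes L k"
  shows "Q = \<Union> {S \<in> cubes L (k + 1). centre L (k + 1) S \<in> Q}"
proof (intro equalityI subsetI)
  fix u assume u: "u \<in> Q"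
  then obtain S where S: "S \<in> cubes L (k + 1)" "u \<in> S" using cube_subset[OF Q] cover[of "k + 1"] by blast
  then have "S \<subseteq> Q" using finer_subset[OF Q S(1)] u by auto
  then show "u \<in> \<Union> {S \<in> cubes L (k + 1). centre L (k + 1) S \<in> Q}"
    using S centre_mem[OF S(1)] by blast
next
  fix u assume "u \<in> \<Union> {S \<in> cubes L (k + 1). centre L (k + 1) S \<in> Q}"
  then obtain S where S: "S \<in> cubes L (k + 1)" "centre L (k + 1) S \<in> Q" "u \<in> S" by blast
  then have "S \<subseteq> Q" using finer_subset[OF Q S(1)] centre_mem[OF S(1)] by auto
  then show "u \<in> Q" using S by blast
qed

text \<open>Cubes of one generation may be nested, and a net point may be the centre of several cubes.
  Their number is bounded all the same, because a cube is determined by the net points of the next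
  generation that it contains.\<close>

lemma inj_on_cube_net: "inj_on (\<lambda>Q. Q \<inter> net L (k + 1)) (cubes L k)"
proof (rule inj_onI)
  fix Q Q' assume *: "Q \<in> cubes L k" "Q' \<in> cubes L k" "Q \<inter> net L (k + 1) = Q' \<inter> net L (k + 1)"
  then have "{S \<in> cubes L (k + 1). centre L (k + 1) S \<in> Q} = {S \<in> cubes L (k + 1). centre L (k + 1) S \<in> Q'}"
    using centre_in_net by blast
  then show "Q = Q'" using cube_eq_Union[OF *(1)] cube_eq_Union[OF *(2)] by simp
qed

lemma finite_cubes_in:
  assumes fin: "finite (net L (k + 1) \<inter> B)"
  shows "finite {Q \<in> cubes L k. Q \<subseteq> B}"
    and "card {Q \<in> cubes L k. Q \<subseteq> B} \<le> 2 ^ card (net L (k + 1) \<inter> B)"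
proof -
  have inj: "inj_on (\<lambda>Q. Q \<inter> net L (k + 1)) {Q \<in> cubes L k. Q \<subseteq> B}"
    by (rule inj_on_subset[OF inj_on_cube_net]) auto
  have sub: "(\<lambda>Q. Q \<inter> net L (k + 1)) ` {Q \<in> cubes L k. Q \<subseteq> B} \<subseteq> Pow (net L (k + 1) \<inter> B)" by blast
  show "finite {Q \<in> cubes L k. Q \<subseteq> B}"
    by (rule inj_on_finite[OF inj sub]) (simp only: finite_Pow_iff fin)
  show "card {Q \<in> cubes L k. Q \<subseteq> B} \<le> 2 ^ card (net L (k + 1) \<inter> B)"
    using card_inj_on_le[OF inj sub] fin by (simp only: finite_Pow_iff card_Pow fin)
qed

end

lemma c0_side: "c\<^sub>0 * side \<rho> k = \<rho> powi k / 100"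
  by (simp add: c\<^sub>0_def side_def)

lemma christ_david_lattice_cube_system:
  assumes "christ_david_lattice n \<rho> W L" "0 < \<rho>" "\<rho> < 1 / 1000"
  shows "cube_system \<rho> W L"
proof
  fix k j Q Q'
  note L = assms(1)[unfolded christ_david_lattice_def, unfolded c0_side, unfolded side_def]
  have 1: "\<forall>k. maximal_net (\<rho> powi k) W (net L k)"
    using L by (elim conjE) assumption
  have 2: "\<forall>k. cubes L k \<subseteq> sets (restrict_space borel W)"
    using L by (elim conjE) assumption
  have 3: "\<forall>k. W = \<Union> (cubes L k)"
    using L by (elim conjE) assumption
  have 4: "\<forall>k j. \<forall>Q\<in>cubes L k. \<forall>Q'\<in>cubes L j. Q \<inter> Q' \<noteq> {} \<longrightarrow> Q \<subseteq> Q' \<or> Q' \<subseteq> Q"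
    using L by (elim conjE) assumption
  have 5: "\<forall>k. \<forall>Q\<in>cubes L k. cball (centre L k Q) (\<rho> powi k / 100) \<inter> W \<subseteq> Q \<and>
      Q \<subseteq> cball (centre L k Q) (5 * \<rho> powi k)"
    using L by (elim conjE) assumption
  have 6: "\<forall>k. net L k = centre L k ` cubes L k"
    using L by (elim conjE) assumption
  show "maximal_net (\<rho> powi k) W (net L k)" "cubes L k \<subseteq> sets (restrict_space borel W)"
    "W = \<Union> (cubes L k)" "net L k = centre L k ` cubes L k"
    using 1 2 3 6 by blast+
  show "Q \<in> cubes L k \<Longrightarrow> Q' \<in> cubes L j \<Longrightarrow> Q \<inter> Q' \<noteq> {} \<Longrightarrow> Q \<subseteq> Q' \<or> Q' \<subseteq> Q"
    using 4 by blast
  show "Q \<in> cubes L k \<Longrightarrow> cball (centre L k Q) (\<rho> powi k / 100) \<inter> W \<subseteq> Q"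
    "Q \<in> cubes L k \<Longrightarrow> Q \<subseteq> cball (centre L k Q) (5 * \<rho> powi k)"
    using 5 by blast+
qed (use assms in auto)

section \<open>Porosity and small boundaries\<close>

lemma ennreal_lose_proportion:
  fixes a a' S :: ennreal
  assumes sum: "a' + S \<le> a" and q: "ennreal q \<le> S" and U: "a \<le> ennreal U"
    and "0 \<le> q" "0 \<le> U" "0 \<le> c" "c * U \<le> q" "1 - c \<le> \<theta>" "0 \<le> \<theta>"
  shows "a' \<le> ennreal \<theta> * a"
proof -
  obtain v where v: "a = ennreal v" "v \<ge> 0" using U by (cases a rule: ennreal_cases) (auto simp: top_unique)
  have "a' \<le> a' + S" by simp
  then have "a' \<le> ennreal v" using sum v by (metis order_trans)
  then obtain v' where v': "a' = ennreal v'" "v' \<ge> 0" by (cases a' rule: ennreal_cases) (auto simp: top_unique)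
  have "a' + ennreal q \<le> a" using add_left_mono[OF q, of a'] sum by (rule order_trans)
  then have 1: "v' + q \<le> v"
    using v v' \<open>0 \<le> q\<close> by (simp add: ennreal_plus[symmetric] ennreal_le_iff del: ennreal_plus)
  have "v \<le> U" using U v \<open>0 \<le> U\<close> by (simp add: ennreal_le_iff)
  then have "c * v \<le> c * U" using \<open>0 \<le> c\<close> by (rule mult_left_mono)
  then have "v' \<le> (1 - c) * v" using 1 \<open>c * U \<le> q\<close> by (simp add: algebra_simps)
  also have "\<dots> \<le> \<theta> * v" using v \<open>1 - c \<le> \<theta>\<close> by (intro mult_right_mono) auto
  finally show ?thesis using v v' \<open>0 \<le> \<theta>\<close> by (simp add: ennreal_mult[symmetric] ennreal_leI)
qed

text \<open>The holes around a maximal \<open>40 t\<close>-separated subset of \<open>E\<close> are disjoint, and they carry a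
  fixed proportion of the mass of the \<open>20 t\<close>-neighbourhood of \<open>E\<close>. They are lost when this
  neighbourhood shrinks to one that is thinner than the holes.\<close>

lemma porous_step:
  assumes n: "n \<ge> 1" and reg: "ahlfors_regular n C W" and C1: "C\<^sub>1 > 0"
    and upper: "\<And>z r. r > 0 \<Longrightarrow> hausdorff n (cball z r \<inter> W) \<le> ennreal (C\<^sub>1 * r ^ n)"
  obtains \<theta> :: real where "1 / 2 \<le> \<theta>" "\<theta> < 1"
    "\<And>E z R t t'. E \<subseteq> W \<Longrightarrow> E \<subseteq> cball z R \<Longrightarrow> 0 < t \<Longrightarrow> ennreal t < ediam W \<Longrightarrow> t' \<le> t / 16000 \<Longrightarrow>
       (\<And>e. e \<in> E \<Longrightarrow> \<exists>p\<in>W. dist e p \<le> 5 * t \<and> (\<forall>u\<in>E. t / 200 < dist p u)) \<Longrightarrow>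
       hausdorff n {w \<in> W. \<exists>e\<in>E. dist w e \<le> 20 * t'}
         \<le> ennreal \<theta> * hausdorff n {w \<in> W. \<exists>e\<in>E. dist w e \<le> 20 * t}"
proof
  have C: "0 < C" by (rule ahlfors_pos[OF reg])
  define c where "c = (1 / 400) ^ n / (C * C\<^sub>1 * 60 ^ n)"
  have c: "c > 0" using C C1 by (simp add: c_def)
  define \<theta> where "\<theta> = max (1 / 2) (1 - c)"
  show "1 / 2 \<le> \<theta>" "\<theta> < 1" using c by (auto simp: \<theta>_def)
  fix E :: "'a set" and z R and t t' :: real
  assume E: "E \<subseteq> W" "E \<subseteq> cball z R" and t: "0 < t" "ennreal t < ediam W" "t' \<le> t / 16000"
    and holes: "\<And>e. e \<in> E \<Longrightarrow> \<exists>p\<in>W. dist e p \<le> 5 * t \<and> (\<forall>u\<in>E. t / 200 < dist p u)"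
  let ?V = "\<lambda>r. {w \<in> W. \<exists>e\<in>E. dist w e \<le> r}"
  show "hausdorff n (?V (20 * t')) \<le> ennreal \<theta> * hausdorff n (?V (20 * t))"
  proof (cases "E = {}")
    case True
    then have "?V (20 * t') = {}" by simp
    then show ?thesis using n by (simp only: hausdorff_empty) simp
  next
    case False
    then obtain e\<^sub>0 where e0: "e\<^sub>0 \<in> E" by blast
    then have R: "R \<ge> 0" using E(2) by (metis mem_cball subsetD zero_le_dist order_trans)
    obtain F where F: "maximal_net (40 * t) E F"
      using maximal_net_exists[OF e0, of "40 * t"] t by auto
    then have FE: "F \<subseteq> E" and Fsep: "separated (40 * t) F" unfolding maximal_net_def by auto
    have "separated t F" using Fsep t(1) unfolding separated_def by fastforce
    moreover have "F \<subseteq> W" "F \<subseteq> cball z R" using FE E by auto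
    moreover have "ennreal (t / 3) < ediam W"
      using t(1) by (intro le_less_trans[OF ennreal_leI t(2)]) simp
    moreover have "hausdorff n (cball z (R + t) \<inter> W) \<le> ennreal (C\<^sub>1 * (R + t) ^ n)"
      using R t by (intro upper) auto
    ultimately have Ffin: "finite F"
      using card_separated_bound(1)[OF n reg, of t F z R] t C1 R by auto
    obtain p where p: "\<And>e. e \<in> E \<Longrightarrow> p e \<in> W" "\<And>e. e \<in> E \<Longrightarrow> dist e (p e) \<le> 5 * t"
        "\<And>e u. e \<in> E \<Longrightarrow> u \<in> E \<Longrightarrow> t / 200 < dist (p e) u"
      using holes by metis
    define H where "H e = cball (p e) (t / 400) \<inter> W" for e
    have Hdist: "dist e u \<le> 6 * t" if "e \<in> E" "u \<in> H e" for e u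
      using that p(2)[OF that(1)] dist_triangle[of e u "p e"] t by (auto simp: H_def)
    have q: "ennreal (inverse C * (t / 400) ^ n) \<le> hausdorff n (H e)" if "e \<in> F" for e
    proof -
      have "ennreal (inverse C * (t / 400) ^ n) \<le> hausdorff n (cball (p e) (t / 400) \<inter> W)"
        using that FE p t by (intro ahlfors_lower[OF reg]) (auto intro: le_less_trans[OF ennreal_leI t(2)])
      then show ?thesis unfolding H_def .
    qed
    have Hsum: "(\<Sum>e\<in>F. hausdorff n (H e)) \<le> hausdorff n (\<Union>e\<in>F. H e)"
    proof (rule hausdorff_separated_UN[OF n t(1) Ffin])
      fix i j a b assume *: "i \<in> F" "j \<in> F" "i \<noteq> j" "a \<in> H i" "b \<in> H j"
      then have "40 * t \<le> dist i j" using Fsep unfolding separated_def by blast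
      moreover have "dist i j \<le> dist i a + dist a b + dist b j"
        using dist_triangle[of i j a] dist_triangle[of a j b] by linarith
      moreover have "dist i a \<le> 6 * t" "dist b j \<le> 6 * t"
        using Hdist[of i a] Hdist[of j b] * FE by (auto simp: dist_commute)
      ultimately show "t \<le> dist a b" using t by linarith
    qed
    have "hausdorff n (?V (20 * t')) + hausdorff n (\<Union>e\<in>F. H e)
        \<le> hausdorff n (?V (20 * t') \<union> (\<Union>e\<in>F. H e))"
    proof (rule hausdorff_separated_Un[OF n, of "t / 800"])
      fix v u assume "v \<in> ?V (20 * t')" "u \<in> (\<Union>e\<in>F. H e)"
      then obtain a e where *: "a \<in> E" "dist v a \<le> 20 * t'" "e \<in> E" "dist (p e) u \<le> t / 400"
        using FE by (auto simp: H_def)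
      have "t / 200 < dist (p e) a" using p(3) * by blast
      also have "\<dots> \<le> dist (p e) u + dist v u + dist v a"
        using dist_triangle[of "p e" a u] dist_triangle[of u a v] by (simp add: dist_commute)
      finally show "t / 800 \<le> dist v u" using * t by linarith
    qed (use t in auto)
    also have "\<dots> \<le> hausdorff n (?V (20 * t))"
    proof (intro hausdorff_mono subsetI)
      fix u assume "u \<in> ?V (20 * t') \<union> (\<Union>e\<in>F. H e)"
      then show "u \<in> ?V (20 * t)"
      proof
        assume "u \<in> ?V (20 * t')"
        then show ?thesis using t by force
      next
        assume "u \<in> (\<Union>e\<in>F. H e)"
        then obtain e where "e \<in> F" "u \<in> H e" by blast
        then show ?thesis using Hdist[of e u] FE t by (auto simp: dist_commute H_def intro!: bexI[of _ e])
      qed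
    qed
    finally have sum: "hausdorff n (?V (20 * t')) + (\<Sum>e\<in>F. hausdorff n (H e)) \<le> hausdorff n (?V (20 * t))"
      using Hsum by (meson add_left_mono order_trans)
    have "hausdorff n (?V (20 * t)) \<le> hausdorff n (\<Union>e\<in>F. cball e (60 * t) \<inter> W)"
    proof (intro hausdorff_mono subsetI)
      fix v assume "v \<in> ?V (20 * t)"
      then obtain e where e: "v \<in> W" "e \<in> E" "dist v e \<le> 20 * t" by blast
      obtain y where y: "y \<in> F" "dist e y < 40 * t" using maximal_net_dense[OF F e(2)] t by auto
      have "dist y v \<le> 60 * t" using e y dist_triangle[of y v e] by (simp add: dist_commute)
      then show "v \<in> (\<Union>e\<in>F. cball e (60 * t) \<inter> W)" using y e by auto
    qed
    also have "\<dots> \<le> (\<Sum>e\<in>F. hausdorff n (cball e (60 * t) \<inter> W))" by (rule hausdorff_UN[OF n Ffin])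
    also have "\<dots> \<le> (\<Sum>e\<in>F. ennreal (C\<^sub>1 * (60 * t) ^ n))" using t by (intro sum_mono upper) auto
    also have "\<dots> = ennreal (card F * (C\<^sub>1 * (60 * t) ^ n))"
      using C1 t by (simp add: ennreal_mult ennreal_of_nat_eq_real_of_nat)
    finally have V: "hausdorff n (?V (20 * t)) \<le> ennreal (card F * (C\<^sub>1 * (60 * t) ^ n))" .
    have "(\<Sum>e\<in>F. ennreal (inverse C * (t / 400) ^ n)) \<le> (\<Sum>e\<in>F. hausdorff n (H e))"
      by (intro sum_mono q)
    then have S: "ennreal (card F * (inverse C * (t / 400) ^ n)) \<le> (\<Sum>e\<in>F. hausdorff n (H e))"
      using C t by (simp add: ennreal_mult ennreal_of_nat_eq_real_of_nat)
    have gen: "a / (C * C\<^sub>1 * b) * (C\<^sub>1 * (b * x)) = inverse C * (a * x)" if "b \<noteq> 0" for a b x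
      using C C1 that by (simp add: field_simps)
    have "(60 * t) ^ n = 60 ^ n * t ^ n" "(1 / 400 * t) ^ n = (1 / 400) ^ n * t ^ n"
      by (rule power_mult_distrib)+
    then have "c * (C\<^sub>1 * (60 * t) ^ n) = inverse C * (1 / 400 * t) ^ n"
      using gen[of "60 ^ n" "(1 / 400) ^ n" "t ^ n"] by (simp only: c_def) simp
    then have "c * (C\<^sub>1 * (60 * t) ^ n) = inverse C * (t / 400) ^ n" by simp
    then have "c * (card F * (C\<^sub>1 * (60 * t) ^ n)) \<le> card F * (inverse C * (t / 400) ^ n)"
      by (metis mult.left_commute order_refl)
    then show ?thesis
      using ennreal_lose_proportion[OF sum S V, of c \<theta>] C C1 t c by (auto simp: \<theta>_def)
  qed
qed

context cube_system
begin

lemma scale_nonneg [simp]: "0 \<le> \<rho> powi k"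
  using rho by simp

text \<open>Around the centre of a finer cube \<open>P\<close> through a boundary point \<open>e\<close> there is room: the ball of radius
  \<open>\<rho> powi i / 100\<close> stays in \<open>P\<close>, hence in \<open>Q\<close>, so the points of the ball of half that radius are far from
  the complement of \<open>Q\<close>.\<close>

lemma boundary_holes:
  assumes Q: "Q \<in> cubes L k" and "k < i" and \<eta>: "\<eta> * \<rho> powi k < \<rho> powi i / 200"
    and E: "E = {x \<in> Q. (INF y\<in>W - Q. ennreal (dist x y)) \<le> ennreal (\<eta> * \<rho> powi k)}" and e: "e \<in> E"
  shows "\<exists>p\<in>W. dist e p \<le> 5 * \<rho> powi i \<and> (\<forall>u\<in>E. \<rho> powi i / 200 < dist p u)"
proof -
  have "e \<in> W" using e E cube_subset[OF Q] by auto
  then obtain P where P: "P \<in> cubes L i" "e \<in> P" using cover[of i] by blast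
  have PQ: "P \<subseteq> Q" using finer_subset[OF Q P(1) \<open>k < i\<close>] e E P(2) by blast
  have "\<rho> powi i / 200 < dist (centre L i P) u" if u: "u \<in> E" for u
  proof (rule ccontr)
    assume near: "\<not> ?thesis"
    have "ennreal (\<rho> powi i / 200) \<le> (INF y\<in>W - Q. ennreal (dist u y))"
    proof (rule INF_greatest)
      fix y assume y: "y \<in> W - Q"
      then have "\<rho> powi i / 100 < dist (centre L i P) y" using inner[OF P(1)] PQ by force
      then have "\<rho> powi i / 200 \<le> dist u y"
        using near dist_triangle[of "centre L i P" y u] by simp
      then show "ennreal (\<rho> powi i / 200) \<le> ennreal (dist u y)" by (rule ennreal_leI)
    qed
    also have "\<dots> \<le> ennreal (\<eta> * \<rho> powi k)" using u E by simp
    finally have "\<rho> powi i / 200 \<le> \<eta> * \<rho> powi k \<or> \<rho> powi i / 200 \<le> 0"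
      by (metis ennreal_le_iff2)
    then show False using \<eta> scale_pos[of i] by linarith
  qed
  moreover have "dist e (centre L i P) \<le> 5 * \<rho> powi i"
    using subsetD[OF outer[OF P(1)] P(2)] by (simp add: dist_commute)
  moreover have "centre L i P \<in> W" using centre_mem[OF P(1)] cube_subset[OF P(1)] by blast
  ultimately show ?thesis by blast
qed

text \<open>The boundary of a cube is porous: near each of its points there is, at every finer scale, the
  centre of a finer cube inside the same cube. Hence the layer of width \<open>\<eta> \<rho> powi k\<close> loses a fixed
  proportion of its mass with every second generation between \<open>1\<close> and \<open>\<eta>\<close>, and the remaining mass is
  a power of \<open>\<eta>\<close>.\<close>

lemma small_boundary:
  assumes n: "n \<ge> 1" and reg: "ahlfors_regular n C W" and dbl: "doubling_space W" and diam: "0 < ediam W"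
  shows "\<exists>C\<ge>1. \<exists>A>0. \<forall>k. \<forall>Q\<in>cubes L k. \<forall>\<eta>>0.
          hausdorff n {x\<in>Q. (INF y\<in>W - Q. ennreal (dist x y)) \<le> ennreal (\<eta> * \<rho> powi k)}
            \<le> ennreal (A * \<eta> powr (1 / C) * side \<rho> k ^ n)"
proof -
  obtain C\<^sub>1 where C1: "C\<^sub>1 > 0" and upper: "\<And>z r. r > 0 \<Longrightarrow> hausdorff n (cball z r \<inter> W) \<le> ennreal (C\<^sub>1 * r ^ n)"
    using ahlfors_upper[OF n reg dbl diam] by blast
  obtain \<theta> where \<theta>: "1 / 2 \<le> \<theta>" "\<theta> < 1" and
    step: "\<And>E z R t t'. E \<subseteq> W \<Longrightarrow> E \<subseteq> cball z R \<Longrightarrow> 0 < t \<Longrightarrow> ennreal t < ediam W \<Longrightarrow> t' \<le> t / 16000 \<Longrightarrow>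
       (\<And>e. e \<in> E \<Longrightarrow> \<exists>p\<in>W. dist e p \<le> 5 * t \<and> (\<forall>u\<in>E. t / 200 < dist p u)) \<Longrightarrow>
       hausdorff n {w \<in> W. \<exists>e\<in>E. dist w e \<le> 20 * t'}
         \<le> ennreal \<theta> * hausdorff n {w \<in> W. \<exists>e\<in>E. dist w e \<le> 20 * t}"
    using porous_step[OF n reg C1 upper] by blast
  \<comment> \<open>the exponent for which losing the factor \<open>\<theta>\<close> per two generations is a power of the width\<close>
  define \<alpha> where "\<alpha> = ln \<theta> / (2 * ln \<rho>)"
  have ln\<rho>: "ln \<rho> < 0" and ln\<theta>: "ln \<theta> < 0" using rho \<theta> by auto
  have "\<alpha> > 0" using ln\<rho> ln\<theta> by (simp add: \<alpha>_def divide_neg_neg)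
  have "ln \<rho> \<le> ln \<theta>" using rho \<theta> by (subst ln_le_cancel_iff) auto
  then have "2 * ln \<rho> \<le> ln \<theta>" using ln\<rho> by linarith
  then have "\<alpha> \<le> 1" using ln\<rho> by (simp add: \<alpha>_def neg_divide_le_eq)
  have \<theta>_pow: "\<theta> ^ m = (\<rho> ^ (2 * m)) powr \<alpha>" for m
  proof -
    have "(\<rho> ^ (2 * m)) powr \<alpha> = exp (\<alpha> * (2 * m * ln \<rho>))"
      using rho by (simp add: powr_def ln_realpow)
    also have "\<alpha> * (2 * m * ln \<rho>) = m * ln \<theta>" using ln\<rho> by (simp add: \<alpha>_def)
    also have "exp (m * ln \<theta>) = \<theta> ^ m" using \<theta> by (simp add: exp_of_nat_mult)
    finally show ?thesis by simp
  qed
  define A where "A = C\<^sub>1 * 2 ^ n * (200 / \<rho>) powr \<alpha>"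
  have "A > 0" using C1 rho by (simp add: A_def)
  have bound: "hausdorff n {x\<in>Q. (INF y\<in>W - Q. ennreal (dist x y)) \<le> ennreal (\<eta> * \<rho> powi k)}
            \<le> ennreal (A * \<eta> powr \<alpha> * side \<rho> k ^ n)"
    (is "hausdorff n ?E \<le> _") if Q: "Q \<in> cubes L k" and \<eta>: "\<eta> > 0" for k Q \<eta>
  proof (cases "Q = W")
    case True
    then have "?E = {}" by (auto simp: top_unique)
    then show ?thesis using n by (simp only: hausdorff_empty) simp
  next
    case False
    have small: "ennreal (\<rho> powi k / 100) < ediam W"
    proof (rule ccontr)
      assume "\<not> ?thesis"
      then have "ediam W \<le> ennreal (\<rho> powi k / 100)" by simp
      then have "ennreal (dist (centre L k Q) w) \<le> ennreal (\<rho> powi k / 100)" if "w \<in> W" for w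
        using dist_le_ediam[of "centre L k Q" W w] that centre_mem[OF Q] cube_subset[OF Q]
        by (meson order_trans subsetD)
      then have "dist (centre L k Q) w \<le> \<rho> powi k / 100" if "w \<in> W" for w
        using that scale_pos[of k] by (subst (asm) ennreal_le_iff) auto
      then have "W \<subseteq> Q" using inner[OF Q] by auto
      then show False using False cube_subset[OF Q] by blast
    qed
    \<comment> \<open>the layer is shrunk through the scales of every second generation below \<open>k\<close>\<close>
    define V where "V l = {w \<in> W. \<exists>e\<in>?E. dist w e \<le> 20 * \<rho> powi (k + 1 + 2 * int l)}" for l
    have EW: "?E \<subseteq> W" "?E \<subseteq> cball (centre L k Q) (5 * \<rho> powi k)"
      using cube_subset[OF Q] outer[OF Q] by auto
    have small_l: "ennreal (\<rho> powi (k + 1 + 2 * int l)) < ediam W" for l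
    proof -
      have "\<rho> powi (k + 1 + 2 * int l) \<le> \<rho> powi k / 100"
        using scale_less[OF rho, of k "k + 1 + 2 * int l"] scale_pos[of "k + 1 + 2 * int l"]
        by linarith
      then show ?thesis using small ennreal_leI le_less_trans by blast
    qed
    have pw: "\<rho> powi (k + 1 + 2 * int l) = \<rho> ^ (2 * l + 1) * \<rho> powi k" for l
    proof -
      have eq: "k + 1 + 2 * int l = k + int (2 * l + 1)" by simp
      have "\<rho> powi (k + int (2 * l + 1)) = \<rho> powi k * \<rho> powi int (2 * l + 1)"
        by (rule power_int_add) (use rho in auto)
      then show ?thesis unfolding eq power_int_of_nat by (rule trans) (rule mult.commute)
    qed
    have V_step: "hausdorff n (V (Suc l)) \<le> ennreal \<theta> * hausdorff n (V l)"
      if "200 * \<eta> < \<rho> ^ (2 * l + 1)" for l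
      unfolding V_def
    proof (rule step[OF EW])
      have eq: "k + 1 + 2 * int (Suc l) = (k + 1 + 2 * int l) + 1 + 1" by simp
      have "\<rho> powi (k + 1 + 2 * int (Suc l)) = (\<rho> * \<rho>) * \<rho> powi (k + 1 + 2 * int l)"
        unfolding eq using rho by (simp only: scale_add1 mult.assoc)
      also have "\<dots> \<le> (1 / 1000 * (1 / 1000)) * \<rho> powi (k + 1 + 2 * int l)"
        using rho by (intro mult_right_mono mult_mono) auto
      finally show "\<rho> powi (k + 1 + 2 * int (Suc l)) \<le> \<rho> powi (k + 1 + 2 * int l) / 16000"
        using scale_pos[of "k + 1 + 2 * int (Suc l)"] scale_pos[of "k + 1 + 2 * int l"] by linarith
      fix e assume e: "e \<in> ?E"
      have "200 * \<eta> * \<rho> powi k < \<rho> ^ (2 * l + 1) * \<rho> powi k"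
        using that by (intro mult_strict_right_mono) auto
      then have "\<eta> * \<rho> powi k < \<rho> powi (k + 1 + 2 * int l) / 200" by (simp add: pw)
      then show "\<exists>p\<in>W. dist e p \<le> 5 * \<rho> powi (k + 1 + 2 * int l) \<and>
          (\<forall>u\<in>?E. \<rho> powi (k + 1 + 2 * int l) / 200 < dist p u)"
        by (intro boundary_holes[OF Q _ _ refl e]) auto
    qed (use small_l in auto)
    have "\<exists>m. \<rho> ^ (2 * m + 1) \<le> 200 * \<eta>"
    proof -
      obtain N where "\<rho> ^ N < 200 * \<eta>" using real_arch_pow_inv[of "200 * \<eta>" \<rho>] rho \<eta> by auto
      moreover have "\<rho> ^ (2 * N + 1) \<le> \<rho> ^ N" using rho by (intro power_decreasing) auto
      ultimately show ?thesis by (intro exI[of _ N]) linarith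
    qed
    \<comment> \<open>the first scale that is comparable to the width of the layer, where the holes end\<close>
    define m where "m = (LEAST m. \<rho> ^ (2 * m + 1) \<le> 200 * \<eta>)"
    have m: "\<rho> ^ (2 * m + 1) \<le> 200 * \<eta>"
      unfolding m_def by (rule LeastI_ex) fact
    have m_less: "200 * \<eta> < \<rho> ^ (2 * l + 1)" if "l < m" for l
      using not_less_Least[of l "\<lambda>m. \<rho> ^ (2 * m + 1) \<le> 200 * \<eta>"] that by (simp add: m_def)
    have V_le: "l \<le> m \<Longrightarrow> hausdorff n (V l) \<le> ennreal (\<theta> ^ l) * hausdorff n (V 0)" for l
    proof (induction l)
      case (Suc l)
      have "hausdorff n (V (Suc l)) \<le> ennreal \<theta> * hausdorff n (V l)"
        using Suc.prems by (intro V_step m_less) simp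
      also have "\<dots> \<le> ennreal \<theta> * (ennreal (\<theta> ^ l) * hausdorff n (V 0))"
        using Suc by (intro mult_left_mono) auto
      finally show ?case using \<theta> by (simp add: ennreal_mult mult.assoc)
    qed simp
    have "hausdorff n (V 0) \<le> hausdorff n (cball (centre L k Q) (6 * \<rho> powi k) \<inter> W)"
    proof (intro hausdorff_mono subsetI)
      fix w assume "w \<in> V 0"
      then obtain e where e: "w \<in> W" "e \<in> ?E" "dist w e \<le> 20 * \<rho> powi (k + 1)" by (auto simp: V_def)
      have "dist (centre L k Q) w \<le> 5 * \<rho> powi k + 20 * \<rho> powi (k + 1)"
        using subsetD[OF EW(2) e(2)] e(3) dist_triangle[of "centre L k Q" w e] by (simp add: dist_commute)
      also have "\<dots> \<le> 6 * \<rho> powi k"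
        using scale_less[OF rho, of k "k + 1"] scale_pos[of "k + 1"] by linarith
      finally show "w \<in> cball (centre L k Q) (6 * \<rho> powi k) \<inter> W" using e by simp
    qed
    also have "\<dots> \<le> ennreal (C\<^sub>1 * (6 * \<rho> powi k) ^ n)" by (rule upper) simp
    finally have V0: "hausdorff n (V 0) \<le> ennreal (C\<^sub>1 * (6 * \<rho> powi k) ^ n)" .
    have "hausdorff n ?E \<le> hausdorff n (V m)"
      using EW(1) scale_pos by (intro hausdorff_mono) (force simp: V_def intro: less_imp_le)
    also have "\<dots> \<le> ennreal (\<theta> ^ m) * ennreal (C\<^sub>1 * (6 * \<rho> powi k) ^ n)"
      using V_le[of m] V0 by (meson mult_left_mono order_refl order_trans zero_le)
    also have "\<dots> = ennreal (\<theta> ^ m * (C\<^sub>1 * (6 * \<rho> powi k) ^ n))"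
      using \<theta> by (simp add: ennreal_mult')
    also have "\<dots> \<le> ennreal (A * \<eta> powr \<alpha> * side \<rho> k ^ n)"
    proof (rule ennreal_leI)
      have "\<theta> ^ m \<le> (200 / \<rho> * \<eta>) powr \<alpha>"
        unfolding \<theta>_pow
      proof (rule powr_mono2)
        show "\<rho> ^ (2 * m) \<le> 200 / \<rho> * \<eta>" using m rho by (simp add: field_simps)
      qed (use \<open>\<alpha> > 0\<close> rho in auto)
      also have "\<dots> = (200 / \<rho>) powr \<alpha> * \<eta> powr \<alpha>" by (rule powr_mult)
      finally have 1: "\<theta> ^ m \<le> (200 / \<rho>) powr \<alpha> * \<eta> powr \<alpha>" .
      have "(6 * \<rho> powi k) ^ n \<le> (2 * (5 * \<rho> powi k)) ^ n"
        using scale_pos[of k] by (intro power_mono) auto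
      then have "(6 * \<rho> powi k) ^ n \<le> 2 ^ n * side \<rho> k ^ n"
        by (simp only: power_mult_distrib side_def)
      then have "\<theta> ^ m * (C\<^sub>1 * (6 * \<rho> powi k) ^ n)
          \<le> ((200 / \<rho>) powr \<alpha> * \<eta> powr \<alpha>) * (C\<^sub>1 * (2 ^ n * side \<rho> k ^ n))"
        using 1 C1 \<theta> by (intro mult_mono) auto
      then show "\<theta> ^ m * (C\<^sub>1 * (6 * \<rho> powi k) ^ n) \<le> A * \<eta> powr \<alpha> * side \<rho> k ^ n"
        by (simp add: A_def mult_ac)
    qed
    finally show ?thesis .
  qed
  have \<alpha>: "1 / (1 / \<alpha>) = \<alpha>" "1 \<le> 1 / \<alpha>" using \<open>\<alpha> > 0\<close> \<open>\<alpha> \<le> 1\<close> by auto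
  show ?thesis
    by (intro exI[of _ "1 / \<alpha>"] exI[of _ A] conjI allI ballI impI)
      (simp_all only: \<alpha> \<open>A > 0\<close> bound)
qed

end

lemma (in cube_system) christ_david_lattice:
  assumes "n \<ge> 1" "ahlfors_regular n C W" "doubling_space W" "0 < ediam W"
  shows "christ_david_lattice n \<rho> W L"
  unfolding christ_david_lattice_def c0_side
  using maximal_net cubes_borel cover nested inner outer net_eq small_boundary[OF assms]
  by (intro conjI allI ballI impI) (auto simp: side_def assms(3))

section \<open>Lattices with a prescribed centre\<close>

text \<open>Given one more maximal net \<open>N\<close> at the scale of generation \<open>k - 1\<close>, a new system of cubes is built in
  which \<open>N\<close> replaces the net of that generation. The cubes of the generations \<open>\<ge> k\<close> are kept. The coarser
  cubes cannot be kept, since a cube around a point of \<open>N\<close> may straddle their boundaries; they are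
  replaced by the fibres of an ancestor map on the old cubes of generation \<open>k\<close>. Building upwards from
  existing cubes makes the new cubes finite unions of Borel sets.\<close>

locale recentring = cube_system \<rho> W L
  for \<rho> :: real and W :: "'a::metric_space set" and L :: "'a lattice_data" +
  fixes k :: int and N :: "'a set"
  assumes new_net: "maximal_net (\<rho> powi (k - 1)) W N"
    and finite_net: "\<And>z r. finite (net L (k + 1) \<inter> cball z r)"
begin

text \<open>Cubes of one generation may be nested, so the partition that generation \<open>k\<close> induces consists of
  unions of chains of cubes.\<close>

definition block :: "'a \<Rightarrow> 'a set" where
  "block z = \<Union> {Q \<in> cubes L k. z \<in> Q}"

definition coarse_net :: "int \<Rightarrow> 'a set" where
  "coarse_net i = (if i = k - 1 then N else net L i)"

text \<open>A net point at distance less than half the scale is unique and must be chosen: this puts a ball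
  around every net point into its fibre. Otherwise any near net point will do.\<close>

definition parent :: "int \<Rightarrow> 'a \<Rightarrow> 'a" where
  "parent i y = (SOME w. w \<in> coarse_net i \<and> dist y w < \<rho> powi i \<and>
     (\<forall>w'\<in>coarse_net i. dist y w' < \<rho> powi i / 2 \<longrightarrow> w' = w))"

text \<open>The starting point is chosen from the block of \<open>z\<close> and not from \<open>z\<close>, which makes the ancestors
  constant on blocks, so that every fibre is a union of blocks. The \<open>m\<close>-th ancestor has generation
  \<open>k - 1 - m\<close>.\<close>

primrec ancestor :: "nat \<Rightarrow> 'a \<Rightarrow> 'a" where
  "ancestor 0 z = parent (k - 1) (SOME e. e \<in> block z)"
| "ancestor (Suc m) z = parent (k - 1 - int (Suc m)) (ancestor m z)"

definition fibre :: "nat \<Rightarrow> 'a \<Rightarrow> 'a set" where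
  "fibre m w = {z \<in> W. ancestor m z = w}"

definition recentred :: "'a lattice_data" where
  "recentred = \<lparr>net = (\<lambda>i. if i < k then coarse_net i else net L i),
     cubes = (\<lambda>i. if i < k then fibre (nat (k - 1 - i)) ` coarse_net i else cubes L i),
     centre = (\<lambda>i T. if i < k then ancestor (nat (k - 1 - i)) (SOME z. z \<in> T) else centre L i T)\<rparr>"

lemma maximal_coarse_net: "maximal_net (\<rho> powi i) W (coarse_net i)"
  using new_net maximal_net by (simp add: coarse_net_def)

lemma coarse_net_subset: "coarse_net i \<subseteq> W"
  using maximal_coarse_net unfolding maximal_net_def by blast

lemma parent:
  assumes "y \<in> W"
  shows "parent i y \<in> coarse_net i" and "dist y (parent i y) < \<rho> powi i"
    and "w \<in> coarse_net i \<Longrightarrow> dist y w < \<rho> powi i / 2 \<Longrightarrow> parent i y = w"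
proof -
  have sep: "separated (\<rho> powi i) (coarse_net i)"
    using maximal_coarse_net unfolding maximal_net_def by blast
  have "\<exists>w. w \<in> coarse_net i \<and> dist y w < \<rho> powi i \<and>
     (\<forall>w'\<in>coarse_net i. dist y w' < \<rho> powi i / 2 \<longrightarrow> w' = w)"
  proof (cases "\<exists>w\<in>coarse_net i. dist y w < \<rho> powi i / 2")
    case True
    then obtain w where w: "w \<in> coarse_net i" "dist y w < \<rho> powi i / 2" by blast
    have "w' = w" if "w' \<in> coarse_net i" "dist y w' < \<rho> powi i / 2" for w'
    proof (rule ccontr)
      assume "w' \<noteq> w"
      then have "\<rho> powi i \<le> dist w' w" using sep that(1) w(1) unfolding separated_def by blast
      then show False using that(2) w(2) dist_triangle3[of w' w y] by linarith
    qed
    moreover have "dist y w < \<rho> powi i" using w(2) scale_pos[of i] by linarith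
    ultimately show ?thesis using w(1) by blast
  next
    case False
    then show ?thesis using maximal_net_dense[OF maximal_coarse_net[of i] assms] by auto
  qed
  from someI_ex[OF this]
  show "parent i y \<in> coarse_net i" "dist y (parent i y) < \<rho> powi i"
    "w \<in> coarse_net i \<Longrightarrow> dist y w < \<rho> powi i / 2 \<Longrightarrow> parent i y = w"
    unfolding parent_def[symmetric] by blast+
qed

lemma block_subset:
  assumes "Q \<in> cubes L k" "z \<in> Q" "z' \<in> Q"
  shows "block z \<subseteq> block z'"
proof
  fix u assume "u \<in> block z"
  then obtain Q' where Q': "Q' \<in> cubes L k" "z \<in> Q'" "u \<in> Q'" by (auto simp: block_def)
  then have "Q \<subseteq> Q' \<or> Q' \<subseteq> Q" using nested[of Q k Q' k] assms by blast
  then show "u \<in> block z'" using assms Q' by (auto simp: block_def)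
qed

lemma block_eq: "Q \<in> cubes L k \<Longrightarrow> z \<in> Q \<Longrightarrow> z' \<in> Q \<Longrightarrow> block z = block z'"
  using block_subset by blast

lemma block_near:
  assumes "u \<in> block z" shows "u \<in> W" and "dist z u \<le> 10 * \<rho> powi k"
proof -
  obtain Q where Q: "Q \<in> cubes L k" "z \<in> Q" "u \<in> Q" using assms by (auto simp: block_def)
  then show "u \<in> W" using cube_subset by blast
  show "dist z u \<le> 10 * \<rho> powi k"
    using subsetD[OF outer[OF Q(1)] Q(2)] subsetD[OF outer[OF Q(1)] Q(3)]
      dist_triangle3[of z u "centre L k Q"] by simp
qed

lemma some_block: "z \<in> W \<Longrightarrow> (SOME e. e \<in> block z) \<in> block z"
  using cover[of k] by (intro someI_ex[of "\<lambda>e. e \<in> block z"]) (auto simp: block_def)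

lemma ancestor_mem: "z \<in> W \<Longrightarrow> ancestor m z \<in> coarse_net (k - 1 - int m)"
proof (induction m)
  case 0
  then show ?case using block_near(1)[OF some_block] by (simp add: parent)
next
  case (Suc m)
  then show ?case using coarse_net_subset by (auto intro: parent(1))
qed

text \<open>The distances to successive ancestors grow geometrically, so the last step dominates.\<close>

lemma ancestor_near: "z \<in> W \<Longrightarrow> dist z (ancestor m z) \<le> 2 * \<rho> powi (k - 1 - int m)"
proof (induction m)
  case 0
  define e where "e = (SOME e. e \<in> block z)"
  have e: "e \<in> W" "dist z e \<le> 10 * \<rho> powi k"
    using block_near[OF some_block[OF 0]] by (auto simp: e_def)
  have "dist z (parent (k - 1) e) \<le> 10 * \<rho> powi k + \<rho> powi (k - 1)"
    using e parent(2)[OF e(1), of "k - 1"] dist_triangle[of z "parent (k - 1) e" e] by linarith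
  also have "\<dots> \<le> 2 * \<rho> powi (k - 1)"
    using scale_less[OF rho, of "k - 1" k] scale_pos[of k] by linarith
  finally show ?case by (simp add: e_def)
next
  case (Suc m)
  have W: "ancestor m z \<in> W" using ancestor_mem[OF Suc.prems] coarse_net_subset by blast
  let ?i = "k - 1 - int (Suc m)"
  have "dist z (parent ?i (ancestor m z)) \<le> 2 * \<rho> powi (k - 1 - int m) + \<rho> powi ?i"
    using Suc parent(2)[OF W, of ?i] dist_triangle[of z "parent ?i (ancestor m z)" "ancestor m z"]
    by linarith
  also have "\<dots> \<le> 2 * \<rho> powi ?i"
    using scale_less[OF rho, of ?i "k - 1 - int m"] scale_pos[of "k - 1 - int m"] by linarith
  finally show ?case by simp
qed

text \<open>All earlier ancestors of \<open>z\<close> are still close to \<open>w\<close> at the scale of \<open>w\<close>, so the last choice has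
  to be \<open>w\<close>.\<close>

lemma ancestor_inner:
  assumes "z \<in> W" "w \<in> coarse_net (k - 1 - int m)" "dist z w \<le> \<rho> powi (k - 1 - int m) / 100"
  shows "ancestor m z = w"
proof (cases m)
  case 0
  define e where "e = (SOME e. e \<in> block z)"
  have e: "e \<in> W" "dist z e \<le> 10 * \<rho> powi k"
    using block_near[OF some_block[OF assms(1)]] by (auto simp: e_def)
  have "dist z w \<le> \<rho> powi (k - 1) / 100" using assms(3) by (simp add: 0)
  then have "dist z e + dist z w < \<rho> powi (k - 1) / 2"
    using e scale_less[OF rho, of "k - 1" k] scale_pos[of "k - 1"] scale_pos[of k] by linarith
  with dist_triangle3[of e w z] have "dist e w < \<rho> powi (k - 1) / 2" by linarith
  then show ?thesis using parent(3)[OF e(1), of w "k - 1"] assms(2) by (simp add: 0 e_def)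
next
  case (Suc l)
  have W: "ancestor l z \<in> W" using ancestor_mem[OF assms(1)] coarse_net_subset by blast
  have "dist (ancestor l z) w \<le> dist z (ancestor l z) + dist z w" by (rule dist_triangle3)
  also have "\<dots> < \<rho> powi (k - 1 - int m) / 2"
    using ancestor_near[OF assms(1), of l] assms(3) scale_pos[of "k - 1 - int m"]
      scale_less[OF rho, of "k - 1 - int m" "k - 1 - int l"] Suc by linarith
  finally show ?thesis using parent(3)[OF W, of w "k - 1 - int m"] assms(2) by (simp add: Suc)
qed

lemma ancestor_block: "Q \<in> cubes L k \<Longrightarrow> z \<in> Q \<Longrightarrow> z' \<in> Q \<Longrightarrow> ancestor m z = ancestor m z'"
  using block_eq[of Q z z'] by (induction m) auto

lemma ancestor_mono:
  assumes "m \<le> m'" "ancestor m z = ancestor m z'"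
  shows "ancestor m' z = ancestor m' z'"
  using assms(1) by (induction rule: dec_induct) (auto simp: assms(2))

lemma fibre_mem: assumes "w \<in> coarse_net (k - 1 - int m)" shows "w \<in> fibre m w"
  using assms ancestor_inner[of w w m] coarse_net_subset by (auto simp: fibre_def)

lemma ancestor_some_fibre:
  "w \<in> coarse_net (k - 1 - int m) \<Longrightarrow> ancestor m (SOME z. z \<in> fibre m w) = w"
  using someI[of "\<lambda>z. z \<in> fibre m w", OF fibre_mem] by (simp add: fibre_def)

lemma fine_cube_in_fibre:
  assumes S: "S \<in> cubes L l" "k \<le> l" and z: "z \<in> S" "z \<in> fibre m w"
  shows "S \<subseteq> fibre m w"
proof -
  obtain Q where Q: "Q \<in> cubes L k" "S \<subseteq> Q"
  proof (cases "l = k")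
    case False
    obtain Q where Q: "Q \<in> cubes L k" "z \<in> Q" using cube_subset[OF S(1)] z(1) cover[of k] by blast
    then show ?thesis using that finer_subset[OF Q(1) S(1)] False S(2) z(1) by auto
  qed (use S that in blast)
  show ?thesis
  proof
    fix u assume u: "u \<in> S"
    have "ancestor m u = ancestor m z"
      using Q(2) u z(1) by (intro ancestor_block[OF Q(1)]) auto
    then show "u \<in> fibre m w" using cube_subset[OF S(1)] u z(2) by (auto simp: fibre_def)
  qed
qed

text \<open>A fibre is bounded, and only finitely many old cubes lie in a bounded set.\<close>

lemma fibre_borel: "fibre m w \<in> sets (restrict_space borel W)"
proof -
  have "fibre m w \<subseteq> cball w (2 * \<rho> powi (k - 1 - int m))"
    using ancestor_near by (auto simp: fibre_def dist_commute)
  then have "finite (net L (k + 1) \<inter> fibre m w)"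
    using finite_subset[OF Int_mono[OF order_refl] finite_net] by blast
  then have fin: "finite {Q \<in> cubes L k. Q \<subseteq> fibre m w}" by (rule finite_cubes_in(1))
  have "z \<in> \<Union> {Q \<in> cubes L k. Q \<subseteq> fibre m w}" if z: "z \<in> fibre m w" for z
  proof -
    have "z \<in> W" using z by (simp add: fibre_def)
    then obtain Q where "Q \<in> cubes L k" "z \<in> Q" using cover[of k] by blast
    then show ?thesis using fine_cube_in_fibre[of Q k z m w] z by auto
  qed
  then have "fibre m w = \<Union> {Q \<in> cubes L k. Q \<subseteq> fibre m w}" by blast
  moreover have "\<Union> {Q \<in> cubes L k. Q \<subseteq> fibre m w} \<in> sets (restrict_space borel W)"
    using cubes_borel[of k] by (intro sets.finite_Union fin) auto
  ultimately show ?thesis by simp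
qed

lemma generation:
  assumes "i < k" obtains m where "nat (k - 1 - i) = m" "i = k - 1 - int m"
  using that[of "nat (k - 1 - i)"] assms by simp

lemma recentred_simps:
  "net recentred i = (if i < k then coarse_net i else net L i)"
  "cubes recentred i = (if i < k then fibre (nat (k - 1 - i)) ` coarse_net i else cubes L i)"
  "centre recentred i T = (if i < k then ancestor (nat (k - 1 - i)) (SOME z. z \<in> T) else centre L i T)"
  by (simp_all add: recentred_def)

lemma recentred_nested_aux:
  assumes T: "T \<in> cubes recentred i" and S: "S \<in> cubes recentred j" and "i \<le> j" "T \<inter> S \<noteq> {}"
  shows "S \<subseteq> T \<or> T \<subseteq> S"
proof (cases "i < k")
  case False
  then show ?thesis using nested[of S j T i] T S assms(3,4) by (auto simp: recentred_simps)
next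
  case True
  then obtain m where m: "nat (k - 1 - i) = m" "i = k - 1 - int m" by (rule generation)
  obtain w where w: "w \<in> coarse_net i" "T = fibre m w" using T True m by (auto simp: recentred_simps)
  obtain z where z: "z \<in> T" "z \<in> S" using assms(4) by blast
  show ?thesis
  proof (cases "j < k")
    case True
    then obtain l where l: "nat (k - 1 - j) = l" "j = k - 1 - int l" by (rule generation)
    obtain v where v: "v \<in> coarse_net j" "S = fibre l v" using S True l by (auto simp: recentred_simps)
    have "l \<le> m" using m l \<open>i \<le> j\<close> by simp
    have "S \<subseteq> T"
    proof
      fix u assume "u \<in> S"
      then have "u \<in> W" "ancestor l u = ancestor l z" using z v by (auto simp: fibre_def)
      then show "u \<in> T" using ancestor_mono[OF \<open>l \<le> m\<close>, of u z] z w by (auto simp: fibre_def)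
    qed
    then show ?thesis ..
  next
    case False
    then show ?thesis using fine_cube_in_fibre[of S j z m w] S z w by (auto simp: recentred_simps)
  qed
qed

lemma recentred_cube_system: "cube_system \<rho> W recentred"
proof
  fix i
  show "maximal_net (\<rho> powi i) W (net recentred i)"
    using maximal_net maximal_coarse_net by (simp add: recentred_simps)
  show "cubes recentred i \<subseteq> sets (restrict_space borel W)"
    using cubes_borel fibre_borel by (auto simp: recentred_simps)
  show "W = \<Union> (cubes recentred i)"
  proof (cases "i < k")
    case True
    then obtain m where m: "nat (k - 1 - i) = m" "i = k - 1 - int m" by (rule generation)
    have "z \<in> fibre m (ancestor m z)" "ancestor m z \<in> coarse_net i" if "z \<in> W" for z
      using that ancestor_mem[OF that, of m] m(2) by (auto simp: fibre_def)
    moreover have "fibre m w \<subseteq> W" for w by (auto simp: fibre_def)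
    ultimately show ?thesis using True m(1) by (auto simp: recentred_simps)
  qed (use cover in \<open>simp add: recentred_simps\<close>)
  show "net recentred i = centre recentred i ` cubes recentred i"
  proof (cases "i < k")
    case True
    then obtain m where m: "nat (k - 1 - i) = m" "i = k - 1 - int m" by (rule generation)
    show ?thesis
      using True m(1) ancestor_some_fibre[of _ m] m(2) by (auto simp: recentred_simps image_image)
  qed (use net_eq in \<open>simp add: recentred_simps\<close>)
next
  fix i j Q Q' assume "Q \<in> cubes recentred i" "Q' \<in> cubes recentred j" "Q \<inter> Q' \<noteq> {}"
  then show "Q \<subseteq> Q' \<or> Q' \<subseteq> Q"
    using recentred_nested_aux[of Q i Q' j] recentred_nested_aux[of Q' j Q i] by (cases "i \<le> j") auto
next
  fix i T assume T: "T \<in> cubes recentred i"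
  have "cball (centre recentred i T) (\<rho> powi i / 100) \<inter> W \<subseteq> T \<and>
    T \<subseteq> cball (centre recentred i T) (5 * \<rho> powi i)"
  proof (cases "i < k")
    case True
    then obtain m where m: "nat (k - 1 - i) = m" "i = k - 1 - int m" by (rule generation)
    obtain w where w: "w \<in> coarse_net i" "T = fibre m w" using T True m by (auto simp: recentred_simps)
    have c: "centre recentred i T = w"
      using ancestor_some_fibre[of w m] w m True by (simp add: recentred_simps)
    have "z \<in> T" if "z \<in> W" "dist w z \<le> \<rho> powi i / 100" for z
      using ancestor_inner[OF that(1), of w m] that w m(2) by (simp add: fibre_def dist_commute)
    moreover have "dist w z \<le> 5 * \<rho> powi i" if "z \<in> T" for z
    proof -
      have "dist w z \<le> 2 * \<rho> powi i"
        using ancestor_near[of z m] that w m(2) by (auto simp: fibre_def dist_commute)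
      then show ?thesis using scale_pos[of i] by linarith
    qed
    ultimately show ?thesis unfolding c by auto
  next
    case False
    then show ?thesis using T inner outer by (auto simp: recentred_simps)
  qed
  then show "cball (centre recentred i T) (\<rho> powi i / 100) \<inter> W \<subseteq> T"
    "T \<subseteq> cball (centre recentred i T) (5 * \<rho> powi i)" by auto
qed (rule rho)+

end

lemma (in cube_system) cube_system_with_centre:
  assumes "x \<in> W" and fin: "\<And>k z r. finite (net L k \<inter> cball z r)"
  obtains L' Q where "cube_system \<rho> W L'" "Q \<in> cubes L' k" "centre L' k Q = x"
proof -
  obtain N where N: "maximal_net (\<rho> powi k) W N" "x \<in> N"
    using maximal_net_exists[OF assms(1), of "\<rho> powi k"] by auto
  interpret recentring \<rho> W L "k + 1" N
    using N(1) fin by unfold_locales auto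
  have "x \<in> net recentred k" using N(2) by (simp add: recentred_simps coarse_net_def)
  then have "x \<in> centre recentred k ` cubes recentred k"
    using cube_system.net_eq[OF recentred_cube_system, of k] by simp
  then show ?thesis using that recentred_cube_system by blast
qed

section \<open>Covering and stopping time arguments\<close>

lemma sum_UN_le:
  fixes f :: "'b \<Rightarrow> real"
  assumes "finite I" "\<And>i. i \<in> I \<Longrightarrow> finite (A i)" "\<And>x. 0 \<le> f x"
  shows "(\<Sum>x\<in>(\<Union>i\<in>I. A i). f x) \<le> (\<Sum>i\<in>I. \<Sum>x\<in>A i. f x)"
  using assms(1,2)
proof induction
  case (insert i I)
  have "(\<Sum>x\<in>A i \<union> (\<Union>i\<in>I. A i). f x) \<le> (\<Sum>x\<in>A i. f x) + (\<Sum>x\<in>(\<Union>i\<in>I. A i). f x)"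
    using insert.prems insert.hyps assms(3) by (subst sum.union_inter[symmetric]) (auto intro: sum_nonneg)
  also have "\<dots> \<le> (\<Sum>x\<in>A i. f x) + (\<Sum>i\<in>I. \<Sum>x\<in>A i. f x)"
    using insert by (intro add_left_mono) auto
  finally show ?case using insert.hyps by simp
qed simp

lemma sum_le_infsum_ennreal:
  fixes f :: "'b \<Rightarrow> ennreal"
  assumes "finite F" "F \<subseteq> A"
  shows "sum f F \<le> infsum f A"
  using assms by (subst nonneg_infsum_complete) (auto intro!: SUP_upper)

lemma infsum_le_ennreal:
  fixes f :: "'b \<Rightarrow> ennreal"
  assumes "\<And>F. finite F \<Longrightarrow> F \<subseteq> A \<Longrightarrow> sum f F \<le> c"
  shows "infsum f A \<le> c"
  using assms by (subst nonneg_infsum_complete) (auto intro!: SUP_least)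

text \<open>The Vitali covering lemma for a finite family: choose a ball of maximal radius, discard the
  balls that it meets, and repeat.\<close>

lemma finite_vitali:
  fixes c :: "'i \<Rightarrow> 'a::metric_space" and r :: "'i \<Rightarrow> real"
  assumes "finite T" and r: "\<And>t. t \<in> T \<Longrightarrow> 0 \<le> r t"
  shows "\<exists>S\<subseteq>T. (\<forall>s\<in>S. \<forall>t\<in>S. s \<noteq> t \<longrightarrow> r s + r t < dist (c s) (c t)) \<and>
     (\<forall>t\<in>T. \<exists>s\<in>S. r t \<le> r s \<and> dist (c s) (c t) \<le> r s + r t)"
  using assms
  proof (induction T rule: finite_psubset_induct)
    case (psubset T)
    show ?case
    proof (cases "T = {}")
      case False
      then have "Max (r ` T) \<in> r ` T" using psubset.hyps by (intro Max_in) auto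
      then obtain s where s: "s \<in> T" "Max (r ` T) = r s" by blast
      have max: "r t \<le> r s" if "t \<in> T" for t
        unfolding s(2)[symmetric] using that psubset.hyps by (intro Max_ge) auto
      define T' where "T' = {t \<in> T. r s + r t < dist (c s) (c t)}"
      have "s \<notin> T'" using psubset.prems[OF s(1)] by (simp add: T'_def)
      moreover have "T' \<subseteq> T" by (auto simp: T'_def)
      ultimately have "T' \<subset> T" using s(1) by blast
      then obtain S where S: "S \<subseteq> T'" "\<forall>s\<in>S. \<forall>t\<in>S. s \<noteq> t \<longrightarrow> r s + r t < dist (c s) (c t)"
          "\<forall>t\<in>T'. \<exists>s\<in>S. r t \<le> r s \<and> dist (c s) (c t) \<le> r s + r t"
        using psubset.IH[of T'] psubset.prems by (metis psubsetE subsetD)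
      show ?thesis
      proof (intro exI[of _ "insert s S"] conjI ballI impI)
        show "insert s S \<subseteq> T" using S(1) s(1) by (auto simp: T'_def)
        fix a b assume "a \<in> insert s S" "b \<in> insert s S" "a \<noteq> b"
        then show "r a + r b < dist (c a) (c b)"
          using S(1,2) by (auto simp: T'_def dist_commute add.commute subset_iff)
      next
        fix t assume t: "t \<in> T"
        show "\<exists>s\<in>insert s S. r t \<le> r s \<and> dist (c s) (c t) \<le> r s + r t"
        proof (cases "t \<in> T'")
          case True then show ?thesis using S(3) by blast
        next
          case False then show ?thesis using t max by (auto simp: T'_def)
        qed
      qed
    qed simp
  qed

definition window :: "real \<Rightarrow> (int \<times> 'a::metric_space) set \<Rightarrow> 'a \<Rightarrow> int \<Rightarrow> int \<Rightarrow> (int \<times> 'a) set" where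
  "window \<rho> B x k m = {p \<in> B. k \<le> fst p \<and> fst p \<le> m \<and> dist x (snd p) \<le> \<rho> powi k}"

text \<open>The stopping time argument. Every window is packed outside of the windows of a family that
  carries at most half of the mass; the total mass is then bounded by a geometric series, here by
  induction on the number of generations.\<close>

lemma stopping_time_packing:
  assumes fin: "\<And>x k m. good x k \<Longrightarrow> finite (window \<rho> B x k m)" and "0 < \<rho>" "0 \<le> A"
    and step: "\<And>x k m. good x k \<Longrightarrow> \<exists>S. finite S \<and> (\<forall>s\<in>S. good (snd s) (fst s) \<and> k < fst s) \<and>
      (\<Sum>s\<in>S. (\<rho> powi fst s) ^ n) \<le> (\<rho> powi k) ^ n / 2 \<and>
      (\<Sum>p\<in>window \<rho> B x k m - (\<Union>s\<in>S. window \<rho> B (snd s) (fst s) m). (\<rho> powi fst p) ^ n)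
        \<le> A * (\<rho> powi k) ^ n"
    and "good x k"
  shows "(\<Sum>p\<in>window \<rho> B x k m. (\<rho> powi fst p) ^ n) \<le> 2 * A * (\<rho> powi k) ^ n"
  using \<open>good x k\<close>
proof (induction "nat (m + 1 - k)" arbitrary: x k rule: less_induct)
  case (less k x)
  have nonneg: "0 \<le> (\<rho> powi i) ^ n" for i using \<open>0 < \<rho>\<close> by simp
  show ?case
  proof (cases "m < k")
    case True
    then have "window \<rho> B x k m = {}" by (auto simp: window_def)
    then show ?thesis using \<open>0 \<le> A\<close> nonneg by simp
  next
    case False
    obtain S where S: "finite S" "\<And>s. s \<in> S \<Longrightarrow> good (snd s) (fst s)" "\<And>s. s \<in> S \<Longrightarrow> k < fst s"
      "(\<Sum>s\<in>S. (\<rho> powi fst s) ^ n) \<le> (\<rho> powi k) ^ n / 2"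
      "(\<Sum>p\<in>window \<rho> B x k m - (\<Union>s\<in>S. window \<rho> B (snd s) (fst s) m). (\<rho> powi fst p) ^ n)
        \<le> A * (\<rho> powi k) ^ n"
      using step[OF less.prems, of m] by blast
    let ?w = "\<lambda>p. (\<rho> powi fst p) ^ n" and ?U = "\<Union>s\<in>S. window \<rho> B (snd s) (fst s) m"
    have fU: "finite ?U" using S(1,2) fin by auto
    have "sum ?w (window \<rho> B x k m) \<le> sum ?w ((window \<rho> B x k m - ?U) \<union> ?U)"
      using fU fin[OF less.prems] nonneg by (intro sum_mono2) auto
    also have "\<dots> = sum ?w (window \<rho> B x k m - ?U) + sum ?w ?U"
      using fU fin[OF less.prems] by (intro sum.union_disjoint) auto
    also have "sum ?w ?U \<le> (\<Sum>s\<in>S. sum ?w (window \<rho> B (snd s) (fst s) m))"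
      using S(1,2) fin nonneg by (intro sum_UN_le) auto
    also have "\<dots> \<le> (\<Sum>s\<in>S. 2 * A * (\<rho> powi fst s) ^ n)"
      using S(2,3) False by (intro sum_mono less.hyps) auto
    also have "\<dots> = 2 * A * (\<Sum>s\<in>S. (\<rho> powi fst s) ^ n)" by (simp add: sum_distrib_left)
    also have "\<dots> \<le> 2 * A * ((\<rho> powi k) ^ n / 2)"
      using S(4) \<open>0 \<le> A\<close> by (intro mult_left_mono) auto
    finally show ?thesis using S(5) by simp
  qed
qed

section \<open>Packing of net points\<close>

lemma coefficient_withD:
  assumes "coefficient_with f W \<beta>" "x \<in> W" "y \<in> W" "0 < t" "t < r" "ennreal r < ediam W"
    "cball y t \<subseteq> cball x r"
  shows "\<beta> y t \<le> f (r / t) * \<beta> x r"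
  using assms unfolding coefficient_with_def by blast

text \<open>Regularity bounds balls with centre in the set and radius below the diameter; \<open>C\<^sub>1\<close> is a constant
  for the upper bound at all centres and radii.\<close>

locale regular_cube_system = cube_system \<rho> W L
  for \<rho> :: real and W :: "'a::metric_space set" and L :: "'a lattice_data" +
  fixes n :: nat and C C\<^sub>1 :: real
  assumes n: "n \<ge> 1" and reg: "ahlfors_regular n C W" and C1: "C\<^sub>1 > 0"
    and upper: "\<And>z r. r > 0 \<Longrightarrow> hausdorff n (cball z r \<inter> W) \<le> ennreal (C\<^sub>1 * r ^ n)"
begin

lemma C: "C > 0"
  by (rule ahlfors_pos[OF reg])

lemma net_count:
  assumes "ennreal (\<rho> powi k / 3) < ediam W" "0 \<le> r"
  shows "finite (net L k \<inter> cball z r)"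
    and "real (card (net L k \<inter> cball z r)) * (\<rho> powi k) ^ n \<le> C * C\<^sub>1 * 3 ^ n * (r + \<rho> powi k) ^ n"
proof -
  have sep: "separated (\<rho> powi k) (net L k \<inter> cball z r)"
    using net_separated unfolding separated_def by blast
  have "hausdorff n (cball z (r + \<rho> powi k) \<inter> W) \<le> ennreal (C\<^sub>1 * (r + \<rho> powi k) ^ n)"
    using assms(2) scale_pos[of k] by (intro upper) linarith
  note bound = card_separated_bound[OF n reg sep _ _ scale_pos assms(1) this]
  show "finite (net L k \<inter> cball z r)"
    using net_subset C1 assms(2) by (intro bound(1)) auto
  have "real (card (net L k \<inter> cball z r)) * (\<rho> powi k / 3) ^ n \<le> C * (C\<^sub>1 * (r + \<rho> powi k) ^ n)"
    using net_subset C1 assms(2) by (intro bound(2)) auto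
  then show "real (card (net L k \<inter> cball z r)) * (\<rho> powi k) ^ n \<le> C * C\<^sub>1 * 3 ^ n * (r + \<rho> powi k) ^ n"
    by (simp add: power_divide field_simps)
qed

lemma finite_net: "finite (net L k \<inter> cball z r)"
proof (cases "ennreal (\<rho> powi k / 3) < ediam W")
  case True
  then show ?thesis using net_count(1)[OF True, of r z] by (cases "0 \<le> r") auto
next
  case False
  have "x = y" if "x \<in> net L k" "y \<in> net L k" for x y
  proof (rule ccontr)
    assume "x \<noteq> y"
    then have "\<rho> powi k \<le> dist x y" using net_separated[of k] that unfolding separated_def by blast
    moreover have "ennreal (dist x y) \<le> ennreal (\<rho> powi k / 3)"
      using dist_le_ediam[of x W y] that net_subset[of k] False by (meson not_less order_trans subsetD)
    then have "dist x y \<le> \<rho> powi k / 3" using scale_pos[of k] by (subst (asm) ennreal_le_iff) auto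
    ultimately show False using scale_pos[of k] by linarith
  qed
  then have "\<exists>x. net L k \<subseteq> {x}" by (cases "net L k = {}") blast+
  then show ?thesis using finite_subset[of "net L k" "{_}"] by auto
qed

text \<open>A net point of \<open>W\<close> near \<open>V\<close> is charged to a cube of \<open>V\<close> of the preceding generation whose centre is so
  close that its ball contains that of the net point; the packing on \<open>V\<close> controls these cubes. The diameter
  of \<open>V\<close> has to exceed the scale, because the bound must be the same for all \<open>V\<close> with one regularity
  constant, and this constant bounds the number of cubes of \<open>V\<close> near a ball only below the diameter.\<close>

lemma packing_transfer:
  assumes V: "cube_system \<rho> V M" and regV: "ahlfors_regular n C' V"
    and pack: "carleson_packing n \<rho> V M \<gamma> \<epsilon>' A" and "0 \<le> A"
    and \<gamma>: "coefficient_with f UNIV \<gamma>" and f: "f 500 * \<epsilon>' \<le> \<epsilon>"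
    and k1: "ennreal (28 * \<rho> powi k1) < ediam V" "ennreal (28 * \<rho> powi k1) < ediam W"
    and T: "finite T" "\<And>p. p \<in> T \<Longrightarrow> k1 < fst p \<and> snd p \<in> net L (fst p) \<and> dist z (snd p) \<le> \<rho> powi k1 \<and>
      \<epsilon> < \<gamma> (snd p) (\<rho> powi (fst p - 1) / 100) \<and> (\<exists>v\<in>V. dist (snd p) v \<le> \<rho> powi (fst p))"
  shows "(\<Sum>p\<in>T. (\<rho> powi fst p) ^ n)
    \<le> (C * C\<^sub>1 * 6 ^ n) * (2 ^ nat \<lfloor>C' * C' * (84 / \<rho>) ^ n\<rfloor> * A * (\<rho> powi k1) ^ n)"
proof -
  interpret V: cube_system \<rho> V M by (rule V)
  let ?w = "\<lambda>k::int. (\<rho> powi k) ^ n"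
  have mono: "\<rho> powi l \<le> \<rho> powi k1" if "k1 \<le> l" for l using that by (rule scale_antimono[OF rho])
  have f1: "mono f" "f 1 = 1" using \<gamma> unfolding coefficient_with_def by auto
  have f500: "f 500 > 0" using monoD[OF f1(1), of 1 500] f1(2) by simp
  have "\<forall>p\<in>T. \<exists>S. S \<in> cubes M (fst p - 1) \<and>
      dist (snd p) (centre M (fst p - 1) S) \<le> 11 / 10 * \<rho> powi (fst p - 1)"
  proof
    fix p assume "p \<in> T"
    then obtain v where v: "v \<in> V" "dist (snd p) v \<le> \<rho> powi (fst p)" using T(2) by blast
    obtain S where S: "S \<in> cubes M (fst p - 1)" "dist v (centre M (fst p - 1) S) < \<rho> powi (fst p - 1)"
      using V.cube_near[OF v(1)] by blast
    have "dist (snd p) (centre M (fst p - 1) S) \<le> 11 / 10 * \<rho> powi (fst p - 1)"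
      using S(2) v(2) dist_triangle[of "snd p" "centre M (fst p - 1) S" v]
        scale_less[OF rho, of "fst p - 1" "fst p"] scale_pos[of "fst p"] scale_pos[of "fst p - 1"] by linarith
    then show "\<exists>S. S \<in> cubes M (fst p - 1) \<and>
      dist (snd p) (centre M (fst p - 1) S) \<le> 11 / 10 * \<rho> powi (fst p - 1)" using S(1) by blast
  qed
  then obtain \<sigma> where \<sigma>: "\<And>p. p \<in> T \<Longrightarrow> \<sigma> p \<in> cubes M (fst p - 1)"
      "\<And>p. p \<in> T \<Longrightarrow> dist (snd p) (centre M (fst p - 1) (\<sigma> p)) \<le> 11 / 10 * \<rho> powi (fst p - 1)"
    by metis
  define \<phi> where "\<phi> p = (fst p - 1, \<sigma> p)" for p
  \<comment> \<open>every pair is charged to a cube of \<open>V\<close> that is bad for \<open>\<gamma>\<close>\<close>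
  have bad: "\<epsilon>' < \<gamma> (centre M (fst p - 1) (\<sigma> p)) (side \<rho> (fst p - 1))"
    "ennreal (side \<rho> (fst p - 1)) < ediam V" if p: "p \<in> T" for p
  proof -
    let ?l = "fst p - 1" and ?c = "centre M (fst p - 1) (\<sigma> p)"
    have "side \<rho> ?l \<le> 28 * \<rho> powi k1" 
      using mono[of ?l] T(2)[OF p] scale_pos[of k1] unfolding side_def by linarith
    then show small: "ennreal (side \<rho> ?l) < ediam V" using k1(1) ennreal_leI le_less_trans by blast
    have "ediam V \<le> ediam (UNIV :: 'a set)" by (rule ediam_mono) simp
    then have "ennreal (side \<rho> ?l) < ediam (UNIV :: 'a set)" using small by (rule less_le_trans[rotated])
    moreover have "cball (snd p) (\<rho> powi ?l / 100) \<subseteq> cball ?c (side \<rho> ?l)"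
    proof
      fix u assume "u \<in> cball (snd p) (\<rho> powi ?l / 100)"
      then have "dist (snd p) u \<le> \<rho> powi ?l / 100" by simp
      then have "dist ?c u \<le> 5 * \<rho> powi ?l"
        using \<sigma>(2)[OF p] dist_triangle3[of ?c u "snd p"] scale_pos[of ?l] by linarith
      then show "u \<in> cball ?c (side \<rho> ?l)" by (simp add: side_def)
    qed
    moreover have "\<rho> powi ?l / 100 < side \<rho> ?l" unfolding side_def using scale_pos[of ?l] by linarith
    moreover have "side \<rho> ?l / (\<rho> powi ?l / 100) = 500" using rho by (simp add: side_def)
    ultimately have "\<gamma> (snd p) (\<rho> powi ?l / 100) \<le> f 500 * \<gamma> ?c (side \<rho> ?l)"
      using coefficient_withD[OF \<gamma> UNIV_I UNIV_I, of "\<rho> powi ?l / 100" "side \<rho> ?l" "snd p" ?c]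
        scale_pos[of ?l] by simp
    then have "f 500 * \<epsilon>' < f 500 * \<gamma> ?c (side \<rho> ?l)"
      using f T(2)[OF p] by linarith
    then show "\<epsilon>' < \<gamma> ?c (side \<rho> ?l)" using f500 by simp
  qed
  \<comment> \<open>a cube is charged boundedly often\<close>
  have charge: "(\<Sum>p\<in>{p \<in> T. \<phi> p = y}. ?w (fst p)) \<le> (C * C\<^sub>1 * 6 ^ n) * ?w (fst y)" if y: "y \<in> \<phi> ` T" for y
  proof -
    obtain l S where yl: "y = (l, S)" by (cases y)
    have l: "k1 \<le> l" using y yl T(2) by (auto simp: \<phi>_def)
    let ?N = "net L (l + 1) \<inter> cball (centre M l S) (11 / 10 * \<rho> powi l)"
    have "ennreal (\<rho> powi (l + 1) / 3) < ediam W"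
    proof -
      have "\<rho> powi (l + 1) / 3 \<le> 28 * \<rho> powi k1"
        using mono[of "l + 1"] l scale_pos[of k1] scale_pos[of "l + 1"] by linarith
      then show ?thesis using k1(2) ennreal_leI le_less_trans by blast
    qed
    note N = net_count[OF this, of "11 / 10 * \<rho> powi l" "centre M l S"]
    have sub: "{p \<in> T. \<phi> p = y} \<subseteq> Pair (l + 1) ` ?N"
    proof
      fix p assume p: "p \<in> {p \<in> T. \<phi> p = y}"
      then have "fst p = l + 1" "S = \<sigma> p" using yl by (auto simp: \<phi>_def)
      then have "snd p \<in> ?N" using p T(2)[of p] \<sigma>(2)[of p] by (auto simp: dist_commute)
      then show "p \<in> Pair (l + 1) ` ?N" using \<open>fst p = l + 1\<close> by (metis image_eqI prod.collapse)
    qed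
    have "(\<Sum>p\<in>{p \<in> T. \<phi> p = y}. ?w (fst p)) = (\<Sum>p\<in>{p \<in> T. \<phi> p = y}. ?w (l + 1))"
      using yl by (intro sum.cong) (auto simp: \<phi>_def)
    also have "\<dots> = real (card {p \<in> T. \<phi> p = y}) * ?w (l + 1)" by simp
    also have "\<dots> \<le> real (card ?N) * ?w (l + 1)"
    proof -
      have "card {p \<in> T. \<phi> p = y} \<le> card ?N"
        using surj_card_le[OF N(1) sub] by simp
      then show ?thesis by (intro mult_right_mono) auto
    qed
    also have "\<dots> \<le> C * C\<^sub>1 * 3 ^ n * (11 / 10 * \<rho> powi l + \<rho> powi (l + 1)) ^ n"
      by (rule N(2)) simp
    also have "\<dots> \<le> C * C\<^sub>1 * 3 ^ n * (2 * \<rho> powi l) ^ n"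
    proof -
      have "11 / 10 * \<rho> powi l + \<rho> powi (l + 1) \<le> 2 * \<rho> powi l"
        using scale_less[OF rho, of l "l + 1"] scale_pos[of "l + 1"] scale_pos[of l] by linarith
      then show ?thesis using C C1 by (intro mult_left_mono power_mono) auto
    qed
    also have "\<dots> = (C * C\<^sub>1 * (3 * 2) ^ n) * ?w l" by (simp only: power_mult_distrib mult_ac)
    finally show ?thesis using yl by simp
  qed
  \<comment> \<open>the charged cubes lie in boundedly many cubes of generation \<open>k1\<close>\<close>
  define \<R> where "\<R> = {R \<in> cubes M k1. R \<subseteq> cball z (13 * \<rho> powi k1)}"
  let ?NV = "net M (k1 + 1) \<inter> cball z (13 * \<rho> powi k1)"
  have NV: "finite ?NV" "card ?NV \<le> nat \<lfloor>C' * C' * (84 / \<rho>) ^ n\<rfloor>"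
  proof -
    have "finite ?NV \<and> real (card ?NV) \<le> C' * C' * (84 / \<rho>) ^ n"
    proof (cases "?NV = {}")
      case True
      then show ?thesis using rho by (simp add: True)
    next
      case False
      then obtain v where v: "v \<in> ?NV" by blast
      then have vV: "v \<in> V" using V.net_subset by blast
      let ?s = "\<rho> powi (k1 + 1)"
      have C': "C' > 0" by (rule ahlfors_pos[OF regV])
      have sep: "separated ?s ?NV" using V.net_separated[of "k1 + 1"] unfolding separated_def by blast
      have s: "1000 * ?s < \<rho> powi k1" by (rule scale_less[OF rho]) simp
      have "cball z (13 * \<rho> powi k1 + ?s) \<subseteq> cball v (28 * \<rho> powi k1)"
      proof
        fix u assume "u \<in> cball z (13 * \<rho> powi k1 + ?s)"
        then have "dist z u \<le> 13 * \<rho> powi k1 + ?s" "dist z v \<le> 13 * \<rho> powi k1" using v by auto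
        then have "dist v u \<le> 28 * \<rho> powi k1"
          using dist_triangle3[of v u z] s scale_pos[of k1] scale_pos[of "k1 + 1"] by linarith
        then show "u \<in> cball v (28 * \<rho> powi k1)" by simp
      qed
      then have "hausdorff n (cball z (13 * \<rho> powi k1 + ?s) \<inter> V) \<le> hausdorff n (cball v (28 * \<rho> powi k1) \<inter> V)"
        by (intro hausdorff_mono) blast
      also have "\<dots> \<le> ennreal (C' * (28 * \<rho> powi k1) ^ n)"
        using vV k1(1) by (intro ahlfors_upper_local[OF regV]) auto
      finally have U: "hausdorff n (cball z (13 * \<rho> powi k1 + ?s) \<inter> V) \<le> ennreal (C' * (28 * \<rho> powi k1) ^ n)" .
      have sV: "ennreal (?s / 3) < ediam V"
      proof -
        have "?s / 3 \<le> 28 * \<rho> powi k1" using s scale_pos[of "k1 + 1"] scale_pos[of k1] by linarith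
        then show ?thesis using k1(1) ennreal_leI le_less_trans by blast
      qed
      note bound = card_separated_bound[OF n regV sep _ _ _ sV U]
      have fin: "finite ?NV" using V.net_subset C' by (intro bound(1)) auto
      have "real (card ?NV) * (?s / 3) ^ n \<le> C' * (C' * (28 * \<rho> powi k1) ^ n)"
        using V.net_subset C' by (intro bound(2)) auto
      also have "28 * \<rho> powi k1 = 84 / \<rho> * (?s / 3)" using rho by (simp add: scale_add1)
      finally have "real (card ?NV) * (?s / 3) ^ n \<le> (C' * C' * (84 / \<rho>) ^ n) * (?s / 3) ^ n"
        by (simp only: power_mult_distrib mult_ac)
      moreover have "0 < (?s / 3) ^ n" using scale_pos[of "k1 + 1"] by simp
      ultimately have "real (card ?NV) \<le> C' * C' * (84 / \<rho>) ^ n"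
        using mult_le_cancel_right_pos by blast
      then show ?thesis using fin by blast
    qed
    then show "finite ?NV" "card ?NV \<le> nat \<lfloor>C' * C' * (84 / \<rho>) ^ n\<rfloor>" by (auto simp: le_nat_floor)
  qed
  have \<R>: "finite \<R>" "real (card \<R>) \<le> 2 ^ nat \<lfloor>C' * C' * (84 / \<rho>) ^ n\<rfloor>"
  proof -
    show "finite \<R>" unfolding \<R>_def by (rule V.finite_cubes_in(1)[OF NV(1)])
    have "card \<R> \<le> 2 ^ card ?NV" unfolding \<R>_def by (rule V.finite_cubes_in(2)[OF NV(1)])
    also have "\<dots> \<le> 2 ^ nat \<lfloor>C' * C' * (84 / \<rho>) ^ n\<rfloor>" by (rule power_increasing[OF NV(2)]) simp
    finally show "real (card \<R>) \<le> 2 ^ nat \<lfloor>C' * C' * (84 / \<rho>) ^ n\<rfloor>"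
      by (simp only: of_nat_le_iff[symmetric, where ?'a = real]) simp
  qed
  define F where "F R = {y \<in> \<phi> ` T. snd y \<subseteq> R}" for R
  have cov: "\<phi> ` T \<subseteq> (\<Union>R\<in>\<R>. F R)"
  proof
    fix y assume "y \<in> \<phi> ` T"
    then obtain p where p: "p \<in> T" "y = \<phi> p" by blast
    let ?l = "fst p - 1" and ?c = "centre M (fst p - 1) (\<sigma> p)"
    have c: "?c \<in> \<sigma> p" using V.centre_mem \<sigma>(1)[OF p(1)] by blast
    have l: "k1 \<le> ?l" using T(2)[OF p(1)] by linarith
    have "\<exists>R\<in>cubes M k1. \<sigma> p \<subseteq> R"
    proof (cases "k1 = ?l")
      case True then show ?thesis using \<sigma>(1)[OF p(1)] by auto
    next
      case False
      have "?c \<in> V" using c V.cube_subset[OF \<sigma>(1)[OF p(1)]] by blast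
      then obtain R where R: "R \<in> cubes M k1" "?c \<in> R" using V.cover[of k1] by blast
      have "\<sigma> p \<subseteq> R" using V.finer_subset[OF R(1) \<sigma>(1)[OF p(1)]] l False R(2) c by auto
      then show ?thesis using R(1) by blast
    qed
    then obtain R where R: "R \<in> cubes M k1" "\<sigma> p \<subseteq> R" by blast
    have "R \<subseteq> cball z (13 * \<rho> powi k1)"
    proof
      fix u assume u: "u \<in> R"
      have "dist (centre M k1 R) u \<le> 5 * \<rho> powi k1" "dist (centre M k1 R) ?c \<le> 5 * \<rho> powi k1"
        using V.outer[OF R(1)] u R(2) c by auto
      then have "dist ?c u \<le> 10 * \<rho> powi k1"
        using dist_triangle3[of ?c u "centre M k1 R"] by linarith
      moreover have "dist z ?c \<le> \<rho> powi k1 + 11 / 10 * \<rho> powi k1"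
        using \<sigma>(2)[OF p(1)] mono[OF l] T(2)[OF p(1)] dist_triangle[of z ?c "snd p"] by linarith
      ultimately have "dist z u \<le> 13 * \<rho> powi k1"
        using dist_triangle[of z u ?c] scale_pos[of k1] by linarith
      then show "u \<in> cball z (13 * \<rho> powi k1)" by simp
    qed
    then have "R \<in> \<R>" using R(1) by (simp add: \<R>_def)
    moreover have "y \<in> F R" using p R(2) by (simp add: F_def \<phi>_def)
    ultimately show "y \<in> (\<Union>R\<in>\<R>. F R)" by blast
  qed
  have F: "(\<Sum>y\<in>F R. ?w (fst y)) \<le> A * ?w k1" if R: "R \<in> \<R>" for R
  proof -
    let ?I = "{(k, Q). Q \<in> cubes M k \<and> Q \<subseteq> R \<and> ennreal (side \<rho> k) < ediam V \<and> \<gamma> (centre M k Q) (side \<rho> k) > \<epsilon>'}"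
    have "finite (F R)" using T(1) by (simp add: F_def)
    moreover have "F R \<subseteq> ?I" using bad \<sigma>(1) by (auto simp: F_def \<phi>_def)
    ultimately have "(\<Sum>(k, Q)\<in>F R. ennreal (side \<rho> k ^ n)) \<le> (\<Sum>\<^sub>\<infinity>(k, Q)\<in>?I. ennreal (side \<rho> k ^ n))"
      by (rule sum_le_infsum_ennreal)
    also have "\<dots> \<le> ennreal (A * side \<rho> k1 ^ n)"
      using pack R unfolding carleson_packing_def \<R>_def by blast
    finally have "ennreal (\<Sum>y\<in>F R. side \<rho> (fst y) ^ n) \<le> ennreal (A * side \<rho> k1 ^ n)"
      by (simp add: case_prod_beta side_def)
    then have "(\<Sum>y\<in>F R. side \<rho> (fst y) ^ n) \<le> A * side \<rho> k1 ^ n"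
      using \<open>0 \<le> A\<close> by (subst (asm) ennreal_le_iff) (auto simp: side_def)
    then have "5 ^ n * (\<Sum>y\<in>F R. ?w (fst y)) \<le> 5 ^ n * (A * ?w k1)"
      by (simp add: side_def power_mult_distrib sum_distrib_left mult_ac)
    then show ?thesis by simp
  qed
  have "(\<Sum>p\<in>T. ?w (fst p)) = (\<Sum>y\<in>\<phi> ` T. \<Sum>p\<in>{p \<in> T. \<phi> p = y}. ?w (fst p))"
    by (rule sum.image_gen[OF T(1)])
  also have "\<dots> \<le> (\<Sum>y\<in>\<phi> ` T. (C * C\<^sub>1 * 6 ^ n) * ?w (fst y))" by (rule sum_mono[OF charge])
  also have "\<dots> = (C * C\<^sub>1 * 6 ^ n) * (\<Sum>y\<in>\<phi> ` T. ?w (fst y))" by (simp add: sum_distrib_left)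
  also have "(\<Sum>y\<in>\<phi> ` T. ?w (fst y)) \<le> (\<Sum>y\<in>(\<Union>R\<in>\<R>. F R). ?w (fst y))"
    using \<R>(1) T(1) by (intro sum_mono2 cov) (auto simp: F_def)
  also have "\<dots> \<le> (\<Sum>R\<in>\<R>. \<Sum>y\<in>F R. ?w (fst y))"
    using \<R>(1) T(1) by (intro sum_UN_le) (auto simp: F_def)
  also have "\<dots> \<le> (\<Sum>R\<in>\<R>. A * ?w k1)" by (rule sum_mono[OF F])
  also have "\<dots> = real (card \<R>) * (A * ?w k1)" by simp
  also have "\<dots> \<le> 2 ^ nat \<lfloor>C' * C' * (84 / \<rho>) ^ n\<rfloor> * (A * ?w k1)"
    using \<R>(2) \<open>0 \<le> A\<close> by (intro mult_right_mono) auto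
  finally show ?thesis using C C1 by (simp add: mult.assoc mult_left_mono)
qed

text \<open>A crude bound, for use with a bounded number of generations only.\<close>

lemma generations_sum:
  assumes T: "finite T" "\<And>p. p \<in> T \<Longrightarrow> snd p \<in> net L (fst p) \<and> dist z (snd p) \<le> r"
    and K: "fst ` T \<subseteq> K" "finite K"
    and k: "\<And>p. p \<in> T \<Longrightarrow> \<rho> powi fst p \<le> s \<and> ennreal (\<rho> powi fst p / 3) < ediam W" and r: "0 \<le> r"
    and s: "0 \<le> s"
  shows "(\<Sum>p\<in>T. (\<rho> powi fst p) ^ n) \<le> card K * (C * C\<^sub>1 * 3 ^ n * (r + s) ^ n)"
proof -
  have gen: "(\<Sum>p\<in>{p \<in> T. fst p = k}. (\<rho> powi fst p) ^ n) \<le> C * C\<^sub>1 * 3 ^ n * (r + s) ^ n"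
    if "k \<in> fst ` T" for k
  proof -
    have small: "ennreal (\<rho> powi k / 3) < ediam W" and ks: "\<rho> powi k \<le> s" using that k by auto
    let ?N = "net L k \<inter> cball z r"
    have sub: "{p \<in> T. fst p = k} \<subseteq> Pair k ` ?N"
    proof
      fix p assume "p \<in> {p \<in> T. fst p = k}"
      then show "p \<in> Pair k ` ?N" using T(2)[of p] by (cases p) auto
    qed
    have "(\<Sum>p\<in>{p \<in> T. fst p = k}. (\<rho> powi fst p) ^ n) = real (card {p \<in> T. fst p = k}) * (\<rho> powi k) ^ n"
      by simp
    also have "\<dots> \<le> real (card ?N) * (\<rho> powi k) ^ n"
      using surj_card_le[OF finite_net sub] by (intro mult_right_mono) auto
    also have "\<dots> \<le> C * C\<^sub>1 * 3 ^ n * (r + \<rho> powi k) ^ n" by (rule net_count(2)[OF small r])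
    also have "\<dots> \<le> C * C\<^sub>1 * 3 ^ n * (r + s) ^ n"
      using C C1 ks r by (intro mult_left_mono power_mono) auto
    finally show ?thesis .
  qed
  have "(\<Sum>p\<in>T. (\<rho> powi fst p) ^ n) = (\<Sum>k\<in>fst ` T. \<Sum>p\<in>{p \<in> T. fst p = k}. (\<rho> powi fst p) ^ n)"
    by (rule sum.image_gen[OF T(1)])
  also have "\<dots> \<le> (\<Sum>k\<in>fst ` T. C * C\<^sub>1 * 3 ^ n * (r + s) ^ n)" by (rule sum_mono[OF gen])
  also have "\<dots> = real (card (fst ` T)) * (C * C\<^sub>1 * 3 ^ n * (r + s) ^ n)" by simp
  also have "\<dots> \<le> real (card K) * (C * C\<^sub>1 * 3 ^ n * (r + s) ^ n)"
    using card_mono[OF K(2,1)] C C1 r s by (intro mult_right_mono) auto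
  finally show ?thesis .
qed

lemma finite_window:
  assumes "\<And>p. p \<in> B \<Longrightarrow> snd p \<in> net L (fst p)"
  shows "finite (window \<rho> B x k m)"
proof (rule finite_subset)
  show "window \<rho> B x k m \<subseteq> (\<Union>i\<in>{k..m}. Pair i ` (net L i \<inter> cball x (\<rho> powi k)))"
  proof
    fix p assume "p \<in> window \<rho> B x k m"
    then show "p \<in> (\<Union>i\<in>{k..m}. Pair i ` (net L i \<inter> cball x (\<rho> powi k)))"
      using assms[of p] by (intro UN_I[of "fst p"] image_eqI[of _ _ "snd p"]) (auto simp: window_def)
  qed
qed (simp add: finite_net)

text \<open>The stopped pairs are those in whose balls the set \<open>Z\<close> is not small. By the Vitali covering
  lemma their mass is controlled by the measure of \<open>Z\<close>.\<close>

lemma stopping_family: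
  assumes \<tau>: "\<tau> > 0" and T: "finite T" "\<And>p. p \<in> T \<Longrightarrow> k + 2 < fst p \<and> fst p \<le> m \<and> dist x (snd p) \<le> \<rho> powi k \<and>
      ennreal (\<tau> * (\<rho> powi fst p) ^ n) \<le> hausdorff n (cball (snd p) (5 * \<rho> powi (fst p - 1)) \<inter> Z)"
    and Z: "hausdorff n (cball x (2 * \<rho> powi k) \<inter> Z) \<le> ennreal (\<tau> * (\<rho> * \<rho>) ^ n / 2 * (\<rho> powi k) ^ n)"
  shows "\<exists>S. finite S \<and> (\<forall>s\<in>S. k < fst s \<and> snd s \<in> snd ` T) \<and>
     (\<Sum>s\<in>S. (\<rho> powi fst s) ^ n) \<le> (\<rho> powi k) ^ n / 2 \<and>
     (\<forall>p\<in>T. \<exists>s\<in>S. fst s \<le> fst p \<and> dist (snd s) (snd p) \<le> \<rho> powi fst s)"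
proof -
  have "\<exists>S\<subseteq>T. (\<forall>s\<in>S. \<forall>t\<in>S. s \<noteq> t \<longrightarrow>
         12 * \<rho> powi (fst s - 1) + 12 * \<rho> powi (fst t - 1) < dist (snd s) (snd t)) \<and>
     (\<forall>t\<in>T. \<exists>s\<in>S. 12 * \<rho> powi (fst t - 1) \<le> 12 * \<rho> powi (fst s - 1) \<and>
         dist (snd s) (snd t) \<le> 12 * \<rho> powi (fst s - 1) + 12 * \<rho> powi (fst t - 1))"
    by (rule finite_vitali[OF T(1)]) simp
  then obtain S where S: "S \<subseteq> T"
    "\<And>s t. s \<in> S \<Longrightarrow> t \<in> S \<Longrightarrow> s \<noteq> t \<Longrightarrow>
         12 * \<rho> powi (fst s - 1) + 12 * \<rho> powi (fst t - 1) < dist (snd s) (snd t)"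
    "\<And>t. t \<in> T \<Longrightarrow> \<exists>s\<in>S. 12 * \<rho> powi (fst t - 1) \<le> 12 * \<rho> powi (fst s - 1) \<and>
         dist (snd s) (snd t) \<le> 12 * \<rho> powi (fst s - 1) + 12 * \<rho> powi (fst t - 1)"
    by metis
  have fS: "finite S" using S(1) T(1) by (rule finite_subset)
  define b where "b p = cball (snd p) (5 * \<rho> powi (fst p - 1)) \<inter> Z" for p
  have "(\<Sum>p\<in>S. ennreal (\<tau> * (\<rho> powi fst p) ^ n)) \<le> (\<Sum>p\<in>S. hausdorff n (b p))"
    using S(1) T(2) by (intro sum_mono) (auto simp: b_def)
  also have "\<dots> \<le> hausdorff n (\<Union>p\<in>S. b p)"
  proof (rule hausdorff_separated_UN[OF n, of "\<rho> powi (m - 1)"])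
    fix i j u v assume *: "i \<in> S" "j \<in> S" "i \<noteq> j" "u \<in> b i" "v \<in> b j"
    have "dist (snd i) (snd j) \<le> dist (snd i) u + dist u v + dist (snd j) v"
      using dist_triangle[of "snd i" "snd j" u] dist_triangle2[of u "snd j" v] by linarith
    moreover have "dist (snd i) u \<le> 5 * \<rho> powi (fst i - 1)" "dist (snd j) v \<le> 5 * \<rho> powi (fst j - 1)"
      using *(4,5) by (auto simp: b_def)
    moreover have "\<rho> powi (m - 1) \<le> \<rho> powi (fst i - 1)"
      using T(2)[of i] *(1) S(1) by (intro scale_antimono[OF rho]) auto
    ultimately show "\<rho> powi (m - 1) \<le> dist u v"
      using S(2)[OF *(1,2,3)] scale_pos[of "fst i - 1"] scale_pos[of "fst j - 1"] by linarith
  qed (use fS in auto)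
  also have "\<dots> \<le> hausdorff n (cball x (2 * \<rho> powi k) \<inter> Z)"
  proof (intro hausdorff_mono subsetI)
    fix u assume "u \<in> (\<Union>p\<in>S. b p)"
    then obtain p where p: "p \<in> T" "dist (snd p) u \<le> 5 * \<rho> powi (fst p - 1)" "u \<in> Z"
      using S(1) by (auto simp: b_def)
    have "1000 * \<rho> powi (fst p - 1) < \<rho> powi k" using T(2)[OF p(1)] by (intro scale_less[OF rho]) auto
    then have "dist x u \<le> 2 * \<rho> powi k"
      using p(2) T(2)[OF p(1)] dist_triangle[of x u "snd p"] scale_pos[of k] by linarith
    then show "u \<in> cball x (2 * \<rho> powi k) \<inter> Z" using p(3) by simp
  qed
  also have "\<dots> \<le> ennreal (\<tau> * (\<rho> * \<rho>) ^ n / 2 * (\<rho> powi k) ^ n)" by (rule Z)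
  finally have "ennreal (\<Sum>p\<in>S. \<tau> * (\<rho> powi fst p) ^ n) \<le> ennreal (\<tau> * (\<rho> * \<rho>) ^ n / 2 * (\<rho> powi k) ^ n)"
    using \<tau> by simp
  then have "(\<Sum>p\<in>S. \<tau> * (\<rho> powi fst p) ^ n) \<le> \<tau> * (\<rho> * \<rho>) ^ n / 2 * (\<rho> powi k) ^ n"
    using \<tau> rho by (subst (asm) ennreal_le_iff) auto
  then have "\<tau> * (\<Sum>p\<in>S. (\<rho> powi fst p) ^ n) \<le> \<tau> * ((\<rho> * \<rho>) ^ n * ((\<rho> powi k) ^ n / 2))"
    by (simp add: sum_distrib_left mult.assoc)
  then have sum: "(\<Sum>p\<in>S. (\<rho> powi fst p) ^ n) \<le> (\<rho> * \<rho>) ^ n * ((\<rho> powi k) ^ n / 2)"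
    using \<tau> by (simp only: mult_le_cancel_left_pos)
  have two: "(\<rho> powi i) ^ n = (\<rho> * \<rho>) ^ n * (\<rho> powi (i - 2)) ^ n" for i
  proof -
    have "\<rho> powi i = \<rho> * \<rho> * \<rho> powi (i - 2)"
      using scale_add1[OF rho(1), of "i - 1"] scale_add1[OF rho(1), of "i - 2"] by simp
    then show ?thesis by (simp only: power_mult_distrib)
  qed
  \<comment> \<open>going up two generations turns the enlarged Vitali balls into windows; this costs the factor \<open>(\<rho> * \<rho>) ^ n\<close>\<close>
  let ?g = "\<lambda>p. (fst p - 2, snd p)"
  show ?thesis
  proof (intro exI[of _ "?g ` S"] conjI ballI)
    show "finite (?g ` S)" using fS by simp
    fix s assume "s \<in> ?g ` S"
    then obtain p where "p \<in> S" "s = ?g p" by blast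
    then show "k < fst s" "snd s \<in> snd ` T" using T(2)[of p] S(1) by auto
  next
    have "inj_on ?g S" by (auto simp: inj_on_def prod_eq_iff)
    then have "(\<rho> * \<rho>) ^ n * (\<Sum>s\<in>?g ` S. (\<rho> powi fst s) ^ n) = (\<Sum>p\<in>S. (\<rho> * \<rho>) ^ n * (\<rho> powi (fst p - 2)) ^ n)"
      by (simp add: sum.reindex sum_distrib_left)
    also have "\<dots> = (\<Sum>p\<in>S. (\<rho> powi fst p) ^ n)" by (simp only: two[symmetric])
    also have "\<dots> \<le> (\<rho> * \<rho>) ^ n * ((\<rho> powi k) ^ n / 2)" by (rule sum)
    finally show "(\<Sum>s\<in>?g ` S. (\<rho> powi fst s) ^ n) \<le> (\<rho> powi k) ^ n / 2"
      using rho by (simp only: mult_le_cancel_left_pos zero_less_power mult_pos_pos)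
  next
    fix p assume "p \<in> T"
    then obtain s where s: "s \<in> S" "\<rho> powi (fst p - 1) \<le> \<rho> powi (fst s - 1)"
       "dist (snd s) (snd p) \<le> 12 * \<rho> powi (fst s - 1) + 12 * \<rho> powi (fst p - 1)"
      using S(3) by fastforce
    have "fst s \<le> fst p"
    proof (rule ccontr)
      assume "\<not> ?thesis"
      then have "1000 * \<rho> powi (fst s - 1) < \<rho> powi (fst p - 1)" by (intro scale_less[OF rho]) auto
      then show False using s(2) scale_pos[of "fst s - 1"] by linarith
    qed
    moreover have "dist (snd s) (snd p) \<le> \<rho> powi (fst s - 2)"
      using s scale_less[OF rho, of "fst s - 2" "fst s - 1"] scale_pos[of "fst s - 1"] by linarith
    ultimately show "\<exists>s\<in>?g ` S. fst s \<le> fst p \<and> dist (snd s) (snd p) \<le> \<rho> powi fst s"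
      using s(1) by (intro bexI[of _ "?g s"]) auto
  qed
qed

text \<open>In every ball a set \<open>Z\<close> of small measure is given. The pairs near which \<open>Z\<close> is noticeable are
  stopped and carry little mass, the other ones are packed by assumption, and the first \<open>M\<close>
  generations are counted crudely.\<close>

lemma packing_of_windows:
  assumes B: "\<And>p. p \<in> B \<Longrightarrow> snd p \<in> net L (fst p) \<and> ennreal (2 * \<rho> powi fst p) < ediam W"
    and \<tau>: "\<tau> > 0" and M: "M \<ge> 2" and A: "0 \<le> A"
    and piece: "\<And>x k. x \<in> W \<Longrightarrow> ennreal (2 * \<rho> powi k) < ediam W \<Longrightarrow>
      \<exists>Z. hausdorff n (cball x (2 * \<rho> powi k) \<inter> Z) \<le> ennreal (\<tau> * (\<rho> * \<rho>) ^ n / 2 * (\<rho> powi k) ^ n) \<and>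
       (\<forall>T. finite T \<longrightarrow> (\<forall>p\<in>T. p \<in> B \<and> k + int M < fst p \<and> dist x (snd p) \<le> \<rho> powi k \<and>
          hausdorff n (cball (snd p) (5 * \<rho> powi (fst p - 1)) \<inter> Z) < ennreal (\<tau> * (\<rho> powi fst p) ^ n)) \<longrightarrow>
          (\<Sum>p\<in>T. (\<rho> powi fst p) ^ n) \<le> A * (\<rho> powi k) ^ n)"
    and x: "x \<in> W" "ennreal (2 * \<rho> powi k) < ediam W"
  shows "(\<Sum>p\<in>window \<rho> B x k m. (\<rho> powi fst p) ^ n)
    \<le> 2 * (real (M + 1) * (C * C\<^sub>1 * 6 ^ n) + A) * (\<rho> powi k) ^ n"
proof -
  let ?good = "\<lambda>x k. x \<in> W \<and> ennreal (2 * \<rho> powi k) < ediam W"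
  let ?w = "\<lambda>p. (\<rho> powi fst p) ^ n"
  let ?A = "real (M + 1) * (C * C\<^sub>1 * 6 ^ n) + A"
  have fin: "finite (window \<rho> B x k m)" for x k m using B by (intro finite_window) auto
  have step: "\<exists>S. finite S \<and> (\<forall>s\<in>S. ?good (snd s) (fst s) \<and> k < fst s) \<and>
      (\<Sum>s\<in>S. (\<rho> powi fst s) ^ n) \<le> (\<rho> powi k) ^ n / 2 \<and>
      (\<Sum>p\<in>window \<rho> B x k m - (\<Union>s\<in>S. window \<rho> B (snd s) (fst s) m). (\<rho> powi fst p) ^ n)
        \<le> ?A * (\<rho> powi k) ^ n" if x: "?good x k" for x k m
  proof -
    obtain Z where Z: "hausdorff n (cball x (2 * \<rho> powi k) \<inter> Z) \<le> ennreal (\<tau> * (\<rho> * \<rho>) ^ n / 2 * (\<rho> powi k) ^ n)"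
      "\<And>T. finite T \<Longrightarrow> (\<forall>p\<in>T. p \<in> B \<and> k + int M < fst p \<and> dist x (snd p) \<le> \<rho> powi k \<and>
          hausdorff n (cball (snd p) (5 * \<rho> powi (fst p - 1)) \<inter> Z) < ennreal (\<tau> * (\<rho> powi fst p) ^ n)) \<Longrightarrow>
          sum ?w T \<le> A * (\<rho> powi k) ^ n"
      using piece[of x k] x by blast
    define T where "T = {p \<in> window \<rho> B x k m. k + int M < fst p \<and>
      ennreal (\<tau> * (\<rho> powi fst p) ^ n) \<le> hausdorff n (cball (snd p) (5 * \<rho> powi (fst p - 1)) \<inter> Z)}"
    have "\<exists>S. finite S \<and> (\<forall>s\<in>S. k < fst s \<and> snd s \<in> snd ` T) \<and>
     (\<Sum>s\<in>S. (\<rho> powi fst s) ^ n) \<le> (\<rho> powi k) ^ n / 2 \<and>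
     (\<forall>p\<in>T. \<exists>s\<in>S. fst s \<le> fst p \<and> dist (snd s) (snd p) \<le> \<rho> powi fst s)"
    proof (rule stopping_family[OF \<tau> _ _ Z(1), where m = m])
      show "finite T" unfolding T_def using fin by simp
    qed (use M in \<open>auto simp: T_def window_def\<close>)
    then obtain S where S: "finite S" "\<And>s. s \<in> S \<Longrightarrow> k < fst s \<and> snd s \<in> snd ` T"
      "(\<Sum>s\<in>S. (\<rho> powi fst s) ^ n) \<le> (\<rho> powi k) ^ n / 2"
      "\<And>p. p \<in> T \<Longrightarrow> \<exists>s\<in>S. fst s \<le> fst p \<and> dist (snd s) (snd p) \<le> \<rho> powi fst s" by blast
    have good: "?good (snd s) (fst s)" if s: "s \<in> S" for s
    proof
      obtain p where "p \<in> T" "snd s = snd p" using S(2)[OF s] by blast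
      then show "snd s \<in> W" using B[of p] net_subset by (auto simp: T_def window_def)
      have "\<rho> powi fst s \<le> \<rho> powi k" using S(2)[OF s] by (intro scale_antimono[OF rho]) auto
      then have "2 * \<rho> powi fst s \<le> 2 * \<rho> powi k" by simp
      then show "ennreal (2 * \<rho> powi fst s) < ediam W" using x ennreal_leI le_less_trans by blast
    qed
    let ?P = "window \<rho> B x k m - (\<Union>s\<in>S. window \<rho> B (snd s) (fst s) m)"
    have T_out: "p \<notin> T" if "p \<in> ?P" for p
      using S(4)[of p] that by (force simp: window_def)
    let ?P1 = "{p \<in> ?P. fst p \<le> k + int M}" and ?P2 = "{p \<in> ?P. k + int M < fst p}"
    have "sum ?w ?P1 \<le> real (card {k..k + int M}) * (C * C\<^sub>1 * 3 ^ n * (\<rho> powi k + \<rho> powi k) ^ n)"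
    proof (rule generations_sum[where z = x])
      show "finite ?P1" using fin by simp
      fix p assume p: "p \<in> ?P1"
      then have pB: "p \<in> B" "k \<le> fst p" "dist x (snd p) \<le> \<rho> powi k" by (auto simp: window_def)
      then show "snd p \<in> net L (fst p) \<and> dist x (snd p) \<le> \<rho> powi k" using B by blast
      have "\<rho> powi fst p / 3 \<le> 2 * \<rho> powi fst p" using scale_pos[of "fst p"] by linarith
      then have "ennreal (\<rho> powi fst p / 3) < ediam W"
        using B[OF pB(1)] ennreal_leI le_less_trans by blast
      then show "\<rho> powi fst p \<le> \<rho> powi k \<and> ennreal (\<rho> powi fst p / 3) < ediam W"
        using scale_antimono[OF rho pB(2)] by blast
    qed (auto simp: window_def)
    also have "\<dots> = real (M + 1) * (C * C\<^sub>1 * 6 ^ n) * (\<rho> powi k) ^ n"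
    proof -
      have "(3::real) ^ n * (\<rho> powi k + \<rho> powi k) ^ n = (3 * (2 * \<rho> powi k)) ^ n"
        by (simp only: power_mult_distrib[symmetric] mult_2)
      also have "\<dots> = 6 ^ n * (\<rho> powi k) ^ n" by (simp only: power_mult_distrib[symmetric]) simp
      finally show ?thesis by (simp add: mult.assoc nat_add_distrib)
    qed
    finally have P1: "sum ?w ?P1 \<le> real (M + 1) * (C * C\<^sub>1 * 6 ^ n) * (\<rho> powi k) ^ n" .
    have P2: "sum ?w ?P2 \<le> A * (\<rho> powi k) ^ n"
    proof (rule Z(2))
      show "finite ?P2" using fin by simp
      show "\<forall>p\<in>?P2. p \<in> B \<and> k + int M < fst p \<and> dist x (snd p) \<le> \<rho> powi k \<and>
          hausdorff n (cball (snd p) (5 * \<rho> powi (fst p - 1)) \<inter> Z) < ennreal (\<tau> * (\<rho> powi fst p) ^ n)"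
        using T_out by (auto simp: T_def window_def not_le)
    qed
    have "?P = ?P1 \<union> ?P2" by auto
    then have "sum ?w ?P = sum ?w (?P1 \<union> ?P2)" by (rule arg_cong)
    also have "\<dots> = sum ?w ?P1 + sum ?w ?P2"
      using fin by (intro sum.union_disjoint) auto
    finally have "sum ?w ?P \<le> ?A * (\<rho> powi k) ^ n" using P1 P2 by (simp only: distrib_right)
    then show ?thesis using S good by blast
  qed
  show ?thesis
    by (rule stopping_time_packing[where good = ?good]) (use fin rho A C C1 step x in auto)
qed

end

section \<open>From net points to cubes\<close>

context regular_cube_system
begin

lemma card_cubes_with_centre:
  assumes "ennreal (5 * \<rho> powi k) < ediam W"
  shows "finite {Q \<in> cubes L k. Q \<subseteq> cball x (5 * \<rho> powi k)}"
    and "real (card {Q \<in> cubes L k. Q \<subseteq> cball x (5 * \<rho> powi k)}) \<le> 2 ^ nat \<lfloor>C * C\<^sub>1 * (18 / \<rho>) ^ n\<rfloor>"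
proof -
  let ?N = "net L (k + 1) \<inter> cball x (5 * \<rho> powi k)"
  let ?s = "\<rho> powi (k + 1)"
  have s: "1000 * ?s < \<rho> powi k" by (rule scale_less[OF rho]) simp
  have "?s / 3 \<le> 5 * \<rho> powi k" using s scale_pos[of "k + 1"] by linarith
  then have small: "ennreal (?s / 3) < ediam W" using assms ennreal_leI le_less_trans by blast
  have "real (card ?N) * ?s ^ n \<le> C * C\<^sub>1 * 3 ^ n * (5 * \<rho> powi k + ?s) ^ n"
    by (rule net_count(2)[OF small]) simp
  also have "\<dots> \<le> C * C\<^sub>1 * 3 ^ n * (6 * \<rho> powi k) ^ n"
  proof -
    have "5 * \<rho> powi k + ?s \<le> 6 * \<rho> powi k" using s scale_pos[of "k + 1"] by linarith
    then show ?thesis using C C1 by (intro mult_left_mono power_mono) auto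
  qed
  also have "\<dots> = C * C\<^sub>1 * (3 * (6 * \<rho> powi k)) ^ n" by (simp only: power_mult_distrib mult.assoc)
  also have "3 * (6 * \<rho> powi k) = 18 / \<rho> * ?s" using rho by (simp add: scale_add1)
  finally have "real (card ?N) * ?s ^ n \<le> (C * C\<^sub>1 * (18 / \<rho>) ^ n) * ?s ^ n"
    by (simp only: power_mult_distrib mult.assoc)
  moreover have "0 < ?s ^ n" by simp
  ultimately have "real (card ?N) \<le> C * C\<^sub>1 * (18 / \<rho>) ^ n"
    using mult_le_cancel_right_pos by blast
  then have cN: "card ?N \<le> nat \<lfloor>C * C\<^sub>1 * (18 / \<rho>) ^ n\<rfloor>" by (rule le_nat_floor)
  show "finite {Q \<in> cubes L k. Q \<subseteq> cball x (5 * \<rho> powi k)}"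
    by (rule finite_cubes_in(1)[OF finite_net])
  have "card {Q \<in> cubes L k. Q \<subseteq> cball x (5 * \<rho> powi k)} \<le> 2 ^ card ?N"
    by (rule finite_cubes_in(2)[OF finite_net])
  also have "\<dots> \<le> 2 ^ nat \<lfloor>C * C\<^sub>1 * (18 / \<rho>) ^ n\<rfloor>" by (rule power_increasing[OF cN]) simp
  finally show "real (card {Q \<in> cubes L k. Q \<subseteq> cball x (5 * \<rho> powi k)}) \<le> 2 ^ nat \<lfloor>C * C\<^sub>1 * (18 / \<rho>) ^ n\<rfloor>"
    by (simp only: of_nat_le_iff[symmetric, where ?'a = real]) simp
qed

text \<open>Comparing measures controls the scale of a cube that is contained in another one as a set, though it
  may belong to a coarser generation.\<close>

lemma scale_of_subcube:
  assumes Q: "Q \<in> cubes L k" and R: "R \<in> cubes L j" and "Q \<subseteq> R" "ennreal (5 * \<rho> powi k) < ediam W"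
  defines "D \<equiv> max 1 (C * C\<^sub>1 * 500 ^ n)"
  shows "\<rho> powi k \<le> D * \<rho> powi j" and "j - int (nat \<lceil>D\<rceil>) \<le> k"
proof -
  have D: "D \<ge> 1" by (simp add: D_def)
  have "\<rho> powi k / 100 \<le> 5 * \<rho> powi k" using scale_pos[of k] by linarith
  then have "ennreal (\<rho> powi k / 100) < ediam W" using assms(4) ennreal_leI le_less_trans by blast
  then have "ennreal (inverse C * (\<rho> powi k / 100) ^ n) \<le> hausdorff n (cball (centre L k Q) (\<rho> powi k / 100) \<inter> W)"
    using centre_mem[OF Q] cube_subset[OF Q] by (intro ahlfors_lower[OF reg]) auto
  also have "\<dots> \<le> hausdorff n (cball (centre L j R) (5 * \<rho> powi j) \<inter> W)"
    using inner[OF Q] outer[OF R] assms(3) by (intro hausdorff_mono) blast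
  also have "\<dots> \<le> ennreal (C\<^sub>1 * (5 * \<rho> powi j) ^ n)" by (rule upper) simp
  finally have "inverse C * (\<rho> powi k / 100) ^ n \<le> C\<^sub>1 * (5 * \<rho> powi j) ^ n"
    using C1 by (subst (asm) ennreal_le_iff) auto
  then have le: "100 ^ n * C * (inverse C * (\<rho> powi k / 100) ^ n) \<le> 100 ^ n * C * (C\<^sub>1 * (5 * \<rho> powi j) ^ n)"
    using C by (intro mult_left_mono) auto
  have 1: "100 ^ n * C * (inverse C * (\<rho> powi k / 100) ^ n) = (\<rho> powi k) ^ n"
    using C by (simp add: power_divide)
  have "(500 :: real) ^ n = (100 * 5) ^ n" by simp
  then have 2: "100 ^ n * C * (C\<^sub>1 * (5 * \<rho> powi j) ^ n) = C * C\<^sub>1 * 500 ^ n * (\<rho> powi j) ^ n"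
    by (simp only: power_mult_distrib mult_ac)
  have "(\<rho> powi k) ^ n \<le> C * C\<^sub>1 * 500 ^ n * (\<rho> powi j) ^ n" using le unfolding 1 2 .
  also have "\<dots> \<le> D * (\<rho> powi j) ^ n" by (intro mult_right_mono) (auto simp: D_def)
  also have "\<dots> \<le> D ^ n * (\<rho> powi j) ^ n"
    using self_le_power[OF D] n by (intro mult_right_mono) auto
  also have "\<dots> = (D * \<rho> powi j) ^ n" by (simp add: power_mult_distrib)
  finally show kD: "\<rho> powi k \<le> D * \<rho> powi j"
    using D n by (subst (asm) power_mono_iff) auto
  show "j - int (nat \<lceil>D\<rceil>) \<le> k"
  proof (rule ccontr)
    assume "\<not> ?thesis"
    then have "\<rho> powi (j - int (nat \<lceil>D\<rceil>)) \<le> \<rho> powi k" by (intro scale_antimono[OF rho]) auto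
    also note kD
    finally have *: "\<rho> powi (j - int (nat \<lceil>D\<rceil>)) \<le> D * \<rho> powi j" .
    define P where "P = nat \<lceil>D\<rceil>"
    have "\<rho> powi (j - int P) = \<rho> powi j / \<rho> ^ P"
      using rho by (simp add: power_int_diff)
    then have "(1 / \<rho> ^ P) * \<rho> powi j \<le> D * \<rho> powi j" using * by (simp add: P_def)
    then have "1 / \<rho> ^ P \<le> D" using scale_pos[of j] by (simp only: mult_le_cancel_right_pos)
    moreover have "2 ^ P \<le> 1 / \<rho> ^ P"
    proof -
      have "2 ^ P \<le> (1 / \<rho>) ^ P" using rho by (intro power_mono) (auto simp: field_simps)
      then show ?thesis by (simp add: power_divide)
    qed
    moreover have "real P < 2 ^ P" by (rule of_nat_less_two_power)
    moreover have "D \<le> real P" using D by (simp add: P_def)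
    ultimately show False by linarith
  qed
qed

text \<open>Cubes are counted through their centres, with bounded multiplicity. On a bounded set, no
  window at the scale of a large cube \<open>R\<close> is available; the windows then start at the coarsest generation
  \<open>a\<close> that occurs, where the defining condition \<open>side \<rho> a < ediam W\<close> of a bad pair makes them
  admissible.\<close>

lemma carleson_packing_from_windows:
  assumes A: "0 \<le> A"
    and windows: "\<And>x k m. x \<in> W \<Longrightarrow> ennreal (2 * \<rho> powi k) < ediam W \<Longrightarrow>
      (\<Sum>p\<in>window \<rho> {p. snd p \<in> net L (fst p) \<and> ennreal (side \<rho> (fst p)) < ediam W \<and>
          \<epsilon> < \<beta> (snd p) (side \<rho> (fst p))} x k m. (\<rho> powi fst p) ^ n) \<le> A * (\<rho> powi k) ^ n"
  shows "\<exists>A'>0. carleson_packing n \<rho> W L \<beta> \<epsilon> A'"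
proof -
  define B where "B = {p. snd p \<in> net L (fst p) \<and> ennreal (side \<rho> (fst p)) < ediam W \<and>
          \<epsilon> < \<beta> (snd p) (side \<rho> (fst p))}"
  let ?w = "\<lambda>p. (\<rho> powi fst p) ^ n"
  define D where "D = max 1 (C * C\<^sub>1 * 500 ^ n)"
  define P where "P = nat \<lceil>D\<rceil>"
  define \<mu> :: real where "\<mu> = 2 ^ nat \<lfloor>C * C\<^sub>1 * (18 / \<rho>) ^ n\<rfloor>"
  define A' where "A' = real P * (C * C\<^sub>1 * 3 ^ n * (5 + D) ^ n) + A * (C * C\<^sub>1 * 3 ^ n * 7 ^ n)"
  have D: "D \<ge> 1" by (simp add: D_def)
  have A'0: "0 \<le> A'" using C C1 A D by (auto simp: A'_def intro!: add_nonneg_nonneg mult_nonneg_nonneg)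
  have scale3: "ennreal (\<rho> powi k / 3) < ediam W" if "ennreal (2 * \<rho> powi k) < ediam W" for k
  proof -
    have "\<rho> powi k / 3 \<le> 2 * \<rho> powi k" using scale_pos[of k] by linarith
    then show ?thesis using that ennreal_leI le_less_trans by blast
  qed
  have scale2: "ennreal (2 * \<rho> powi l) < ediam W" if "ennreal (side \<rho> k) < ediam W" "k \<le> l" for k l
  proof -
    have "\<rho> powi l \<le> \<rho> powi k" using that(2) by (rule scale_antimono[OF rho])
    then have "2 * \<rho> powi l \<le> side \<rho> k" unfolding side_def using scale_pos[of k] by linarith
    then show ?thesis using that(1) ennreal_leI le_less_trans by blast
  qed
  have pairs: "sum ?w T \<le> A' * (\<rho> powi j) ^ n"
    if T: "finite T" "T \<subseteq> B" and near: "\<And>p. p \<in> T \<Longrightarrow> dist z (snd p) \<le> 5 * \<rho> powi j"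
      and scale: "\<And>p. p \<in> T \<Longrightarrow> \<rho> powi fst p \<le> D * \<rho> powi j \<and> j - int P \<le> fst p" for T z j
  proof (cases "T = {}")
    case True
    then show ?thesis using A'0 by simp
  next
    case False
    define a where "a = Min (fst ` T)"
    have a_in: "a \<in> fst ` T" unfolding a_def using False T(1) by (intro Min_in) auto
    have a_le: "a \<le> fst p" if "p \<in> T" for p unfolding a_def using that T(1) by (intro Min_le) auto
    define m where "m = Max (fst ` T)"
    have m_ge: "fst p \<le> m" if "p \<in> T" for p unfolding m_def using that T(1) by (intro Max_ge) auto
    \<comment> \<open>below \<open>k\<close> there remain at most \<open>P\<close> generations, and only if \<open>k = j\<close>\<close>
    define k where "k = max j a"
    have "ennreal (side \<rho> a) < ediam W" using a_in T(2) by (auto simp: B_def)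
    then have small: "ennreal (2 * \<rho> powi l) < ediam W" if "a \<le> l" for l using scale2 that by blast
    have ak: "a \<le> k" by (simp add: k_def)
    have kj: "\<rho> powi k \<le> \<rho> powi j" by (rule scale_antimono[OF rho]) (simp add: k_def)
    let ?Ta = "{p \<in> T. fst p < k}" and ?Tb = "{p \<in> T. k \<le> fst p}"
    have "sum ?w ?Ta \<le> real (card {j - int P..<j}) * (C * C\<^sub>1 * 3 ^ n * (5 * \<rho> powi j + D * \<rho> powi j) ^ n)"
    proof (rule generations_sum[where z = z])
      show "fst ` ?Ta \<subseteq> {j - int P..<j}"
        using scale a_le by (force simp: k_def)
      fix p assume "p \<in> ?Ta"
      then have p: "p \<in> T" by simp
      show "snd p \<in> net L (fst p) \<and> dist z (snd p) \<le> 5 * \<rho> powi j" using p T(2) near by (auto simp: B_def)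
      show "\<rho> powi fst p \<le> D * \<rho> powi j \<and> ennreal (\<rho> powi fst p / 3) < ediam W"
        using scale[OF p] scale3[OF small[OF a_le[OF p]]] by blast
    qed (use T(1) D in auto)
    also have "5 * \<rho> powi j + D * \<rho> powi j = (5 + D) * \<rho> powi j" by (simp add: algebra_simps)
    finally have Ta: "sum ?w ?Ta \<le> real P * (C * C\<^sub>1 * 3 ^ n * (5 + D) ^ n) * (\<rho> powi j) ^ n"
      by (simp add: power_mult_distrib mult.assoc)
    let ?N = "net L k \<inter> cball z (6 * \<rho> powi j)"
    have cov: "?Tb \<subseteq> (\<Union>y\<in>?N. window \<rho> B y k m)"
    proof
      fix p assume p: "p \<in> ?Tb"
      then have pB: "p \<in> B" using T(2) by blast
      then have "snd p \<in> W" using net_subset by (auto simp: B_def)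
      then obtain y where y: "y \<in> net L k" "dist (snd p) y < \<rho> powi k"
        using maximal_net_dense[OF maximal_net[of k]] by auto
      have "dist z y \<le> 6 * \<rho> powi j"
        using near[of p] p y(2) kj dist_triangle[of z y "snd p"] by simp
      moreover have "p \<in> window \<rho> B y k m"
        using p pB y(2) m_ge[of p] by (simp add: window_def dist_commute)
      ultimately show "p \<in> (\<Union>y\<in>?N. window \<rho> B y k m)" using y(1) by auto
    qed
    have finw: "finite (window \<rho> B y k m)" for y by (rule finite_window) (simp add: B_def)
    have "sum ?w ?Tb \<le> sum ?w (\<Union>y\<in>?N. window \<rho> B y k m)"
      using finite_net finw by (intro sum_mono2 cov) auto
    also have "\<dots> \<le> (\<Sum>y\<in>?N. sum ?w (window \<rho> B y k m))"
      using finite_net finw by (intro sum_UN_le) auto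
    also have "\<dots> \<le> (\<Sum>y\<in>?N. A * (\<rho> powi k) ^ n)"
      using net_subset by (intro sum_mono windows[folded B_def] small ak) auto
    also have "\<dots> = A * (real (card ?N) * (\<rho> powi k) ^ n)" by simp
    also have "\<dots> \<le> A * (C * C\<^sub>1 * 3 ^ n * (6 * \<rho> powi j + \<rho> powi k) ^ n)"
      using A by (intro mult_left_mono net_count(2) scale3 small ak) auto
    also have "\<dots> \<le> A * (C * C\<^sub>1 * 3 ^ n * (7 * \<rho> powi j) ^ n)"
      using A C C1 kj by (intro mult_left_mono power_mono) auto
    finally have Tb: "sum ?w ?Tb \<le> A * (C * C\<^sub>1 * 3 ^ n * 7 ^ n) * (\<rho> powi j) ^ n"
      by (simp only: power_mult_distrib mult.assoc)
    have "T = ?Ta \<union> ?Tb" by auto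
    then have "sum ?w T = sum ?w (?Ta \<union> ?Tb)" by (rule arg_cong)
    also have "\<dots> = sum ?w ?Ta + sum ?w ?Tb" using T(1) by (intro sum.union_disjoint) auto
    finally show ?thesis using Ta Tb unfolding A'_def by (simp only: distrib_right)
  qed
  have "carleson_packing n \<rho> W L \<beta> \<epsilon> (\<mu> * A' + 1)"
    unfolding carleson_packing_def
  proof (intro allI ballI infsum_le_ennreal)
    fix j R F assume R: "R \<in> cubes L j" and F: "finite F" "F \<subseteq> {(k, Q). Q \<in> cubes L k \<and> Q \<subseteq> R \<and>
        ennreal (side \<rho> k) < ediam W \<and> \<epsilon> < \<beta> (centre L k Q) (side \<rho> k)}"
    define g where "g q = (fst q, centre L (fst q) (snd q))" for q :: "int \<times> 'a set"
    have Fq: "snd q \<in> cubes L (fst q)" "snd q \<subseteq> R" "ennreal (side \<rho> (fst q)) < ediam W"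
        "\<epsilon> < \<beta> (centre L (fst q) (snd q)) (side \<rho> (fst q))" if "q \<in> F" for q
      using subsetD[OF F(2) that] by (simp_all add: case_prod_beta)
    have fibre: "(\<Sum>q\<in>{q \<in> F. g q = p}. ?w q) \<le> \<mu> * ?w p" if p: "p \<in> g ` F" for p
    proof -
      let ?S = "{Q \<in> cubes L (fst p). Q \<subseteq> cball (snd p) (5 * \<rho> powi fst p)}"
      have small: "ennreal (5 * \<rho> powi fst p) < ediam W" using p Fq(3) by (auto simp: g_def side_def)
      have sub: "{q \<in> F. g q = p} \<subseteq> Pair (fst p) ` ?S"
      proof
        fix q assume q: "q \<in> {q \<in> F. g q = p}"
        then have "snd q \<in> ?S" using Fq(1)[of q] outer[of "snd q" "fst q"] by (auto simp: g_def)
        then show "q \<in> Pair (fst p) ` ?S" using q by (intro image_eqI[of _ _ "snd q"]) (auto simp: g_def)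
      qed
      have "(\<Sum>q\<in>{q \<in> F. g q = p}. ?w q) = (\<Sum>q\<in>{q \<in> F. g q = p}. ?w p)"
        by (intro sum.cong) (auto simp: g_def)
      also have "\<dots> = real (card {q \<in> F. g q = p}) * ?w p" by simp
      also have "\<dots> \<le> real (card ?S) * ?w p"
        using surj_card_le[OF card_cubes_with_centre(1)[OF small] sub] by (intro mult_right_mono) auto
      also have "\<dots> \<le> \<mu> * ?w p"
        unfolding \<mu>_def by (intro mult_right_mono card_cubes_with_centre(2)[OF small]) simp
      finally show ?thesis .
    qed
    have "sum ?w F = (\<Sum>p\<in>g ` F. \<Sum>q\<in>{q \<in> F. g q = p}. ?w q)" by (rule sum.image_gen[OF F(1)])
    also have "\<dots> \<le> (\<Sum>p\<in>g ` F. \<mu> * ?w p)" by (rule sum_mono[OF fibre])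
    also have "\<dots> = \<mu> * sum ?w (g ` F)" by (simp add: sum_distrib_left)
    also have "\<dots> \<le> \<mu> * (A' * (\<rho> powi j) ^ n)"
    proof (rule mult_left_mono[OF pairs])
      show "finite (g ` F)" using F(1) by simp
      show "g ` F \<subseteq> B" using Fq centre_in_net by (auto simp: B_def g_def)
      fix p assume "p \<in> g ` F"
      then obtain q where q: "q \<in> F" "p = g q" by blast
      show "dist (centre L j R) (snd p) \<le> 5 * \<rho> powi j"
        using outer[OF R] Fq(2)[OF q(1)] centre_mem[OF Fq(1)[OF q(1)]] q(2) by (auto simp: g_def)
      show "\<rho> powi fst p \<le> D * \<rho> powi j \<and> j - int P \<le> fst p"
        using scale_of_subcube[OF Fq(1)[OF q(1)] R Fq(2)[OF q(1)]] Fq(3)[OF q(1)] q(2)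
        by (simp add: g_def side_def D_def P_def)
    qed (simp add: \<mu>_def)
    also have "\<dots> \<le> (\<mu> * A' + 1) * (\<rho> powi j) ^ n" by (simp add: algebra_simps)
    finally have "5 ^ n * sum ?w F \<le> 5 ^ n * ((\<mu> * A' + 1) * (\<rho> powi j) ^ n)" by simp
    then have "(\<Sum>q\<in>F. side \<rho> (fst q) ^ n) \<le> (\<mu> * A' + 1) * side \<rho> j ^ n"
      by (simp add: side_def power_mult_distrib sum_distrib_left mult_ac)
    then show "(\<Sum>(k, Q)\<in>F. ennreal (side \<rho> k ^ n)) \<le> ennreal ((\<mu> * A' + 1) * side \<rho> j ^ n)"
      by (simp add: case_prod_beta side_def ennreal_leI)
  qed
  moreover have "\<mu> * A' + 1 > 0" using A'0 by (auto simp: \<mu>_def intro: add_nonneg_pos)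
  ultimately show ?thesis by blast
qed

end

section \<open>Approximation by the pieces\<close>

lemma hausdorff_measurable_split:
  assumes "hausdorff_measurable n Y"
  shows "hausdorff n (A \<inter> Y) + hausdorff n (A - Y) = hausdorff n A"
proof -
  have "hausdorff n (Y \<inter> A) + hausdorff n ((UNIV - Y) \<inter> A) = hausdorff n A"
    using assms unfolding hausdorff_measurable_def lambda_system_def by blast
  moreover have "Y \<inter> A = A \<inter> Y" "(UNIV - Y) \<inter> A = A - Y" by auto
  ultimately show ?thesis by simp
qed

lemma hausdorff_outside_piece:
  assumes Y: "hausdorff_measurable n Y" and U: "hausdorff n A \<le> ennreal U" "0 \<le> U"
    and e: "0 \<le> e" "e \<le> 1" and big: "ennreal (1 - e) * hausdorff n A \<le> hausdorff n (A \<inter> Y)"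
  shows "hausdorff n (A - Y) \<le> ennreal (e * U)"
proof -
  obtain h where h: "hausdorff n A = ennreal h" "0 \<le> h"
    using U by (cases "hausdorff n A" rule: ennreal_cases) (auto simp: top_unique)
  have "hausdorff n (A \<inter> Y) \<le> ennreal h" "hausdorff n (A - Y) \<le> ennreal h"
    unfolding h(1)[symmetric] by (intro hausdorff_mono; blast)+
  then obtain a d where a: "hausdorff n (A \<inter> Y) = ennreal a" "0 \<le> a"
    and d: "hausdorff n (A - Y) = ennreal d" "0 \<le> d"
    by (cases "hausdorff n (A \<inter> Y)" rule: ennreal_cases; cases "hausdorff n (A - Y)" rule: ennreal_cases)
       (auto simp: top_unique)
  have "ennreal (a + d) = ennreal h"
    using hausdorff_measurable_split[OF Y, of A] a d h by (simp add: ennreal_plus)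
  then have "a + d = h" using a d h by (simp add: ennreal_inj del: ennreal_plus)
  moreover have "(1 - e) * h \<le> a"
    using big a h e by (simp add: ennreal_mult[symmetric] ennreal_le_iff)
  ultimately have "d \<le> e * h" by (simp add: algebra_simps)
  also have "\<dots> \<le> e * U" using U h e by (intro mult_left_mono) (auto simp: ennreal_le_iff)
  finally show ?thesis using d by (simp add: ennreal_leI)
qed

context regular_cube_system
begin

text \<open>If the diameter were smaller, the part of the piece in the ball would lie in a much smaller ball, which by the upper bound
  carries less than half of the mass.\<close>

lemma piece_diameter:
  assumes x: "x \<in> W" "ennreal (2 * \<rho> powi k) < ediam W"
    and big: "ennreal (1 / 2) * hausdorff n (cball x (2 * \<rho> powi k) \<inter> W)
      \<le> hausdorff n (cball x (2 * \<rho> powi k) \<inter> W \<inter> Y)"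
    and M: "2 * C * C\<^sub>1 * (28 * \<rho> ^ M) ^ n < 1"
  shows "ennreal (28 * \<rho> powi (k + int M)) < ediam Y"
proof (rule ccontr)
  define d where "d = 28 * \<rho> powi (k + int M)"
  assume "\<not> ?thesis"
  then have d: "ediam Y \<le> ennreal d" "0 < d" by (auto simp: d_def)
  let ?S = "cball x (2 * \<rho> powi k) \<inter> W \<inter> Y"
  have "hausdorff n ?S \<le> ennreal (C\<^sub>1 * d ^ n)"
  proof (cases "?S = {}")
    case True
    then show ?thesis using n by (simp only: hausdorff_empty) simp
  next
    case False
    then obtain y where y: "y \<in> ?S" by blast
    have "?S \<subseteq> cball y d \<inter> W"
    proof
      fix u assume u: "u \<in> ?S"
      then have "ennreal (dist y u) \<le> ennreal d" using dist_le_ediam[of y Y u] y d(1) by auto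
      then have "dist y u \<le> d" using d(2) by (subst (asm) ennreal_le_iff) auto
      then show "u \<in> cball y d \<inter> W" using u by simp
    qed
    then have "hausdorff n ?S \<le> hausdorff n (cball y d \<inter> W)" by (rule hausdorff_mono)
    also have "\<dots> \<le> ennreal (C\<^sub>1 * d ^ n)" by (rule upper[OF d(2)])
    finally show ?thesis .
  qed
  moreover have "ennreal (1 / 2) * ennreal (inverse C * (2 * \<rho> powi k) ^ n)
      \<le> ennreal (1 / 2) * hausdorff n (cball x (2 * \<rho> powi k) \<inter> W)"
    using x by (intro mult_left_mono ahlfors_lower[OF reg]) auto
  ultimately have "ennreal (1 / 2) * ennreal (inverse C * (2 * \<rho> powi k) ^ n) \<le> ennreal (C\<^sub>1 * d ^ n)"
    using big by (meson order_trans)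
  then have "ennreal (1 / 2 * (inverse C * (2 * \<rho> powi k) ^ n)) \<le> ennreal (C\<^sub>1 * d ^ n)"
    using C by (subst ennreal_mult) auto
  then have "1 / 2 * (inverse C * (2 * \<rho> powi k) ^ n) \<le> C\<^sub>1 * d ^ n"
    using C1 d(2) by (subst (asm) ennreal_le_iff) auto
  then have "2 * C * (1 / 2 * (inverse C * (2 * \<rho> powi k) ^ n)) \<le> 2 * C * (C\<^sub>1 * d ^ n)"
    using C by (intro mult_left_mono) auto
  also have "2 * C * (1 / 2 * (inverse C * (2 * \<rho> powi k) ^ n)) = (2 * \<rho> powi k) ^ n"
    using C by simp
  also have "d = (28 * \<rho> ^ M) * \<rho> powi k"
    using rho by (simp add: d_def power_int_add)
  also have "2 * C * (C\<^sub>1 * ((28 * \<rho> ^ M) * \<rho> powi k) ^ n) = (2 * C * C\<^sub>1 * (28 * \<rho> ^ M) ^ n) * (\<rho> powi k) ^ n"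
    by (simp only: power_mult_distrib mult.assoc)
  also have "\<dots> < 1 * (\<rho> powi k) ^ n" using M by (intro mult_strict_right_mono) auto
  also have "\<dots> \<le> (2 * \<rho> powi k) ^ n" by (simp add: power_mono)
  finally show False by simp
qed

text \<open>The transfer at radius \<open>\<rho> powi k\<close>: this ball is covered by balls \<open>M\<close> generations finer, whose scale is
  below the diameter of \<open>V\<close>.\<close>

lemma packing_transfer_near:
  assumes V: "cube_system \<rho> V LV" and regV: "ahlfors_regular n C' V"
    and pack: "carleson_packing n \<rho> V LV \<gamma> \<epsilon>' A" and "0 \<le> A"
    and \<gamma>: "coefficient_with f UNIV \<gamma>" and f: "f 500 * \<epsilon>' \<le> \<epsilon>"
    and k: "ennreal (28 * \<rho> powi (k + int M)) < ediam V" "ennreal (28 * \<rho> powi (k + int M)) < ediam W"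
    and T: "finite T" "\<And>p. p \<in> T \<Longrightarrow> k + int M < fst p \<and> snd p \<in> net L (fst p) \<and> dist x (snd p) \<le> \<rho> powi k \<and>
      \<epsilon> < \<gamma> (snd p) (\<rho> powi (fst p - 1) / 100) \<and> (\<exists>v\<in>V. dist (snd p) v \<le> \<rho> powi (fst p))"
  shows "(\<Sum>p\<in>T. (\<rho> powi fst p) ^ n)
    \<le> (C * C\<^sub>1 * 6 ^ n) * (2 ^ nat \<lfloor>C' * C' * (84 / \<rho>) ^ n\<rfloor> * A) * (C * C\<^sub>1 * 9 ^ n) * (\<rho> powi k) ^ n"
proof -
  let ?w = "\<lambda>p. (\<rho> powi fst p) ^ n"
  let ?k1 = "k + int M"
  define B where "B = (C * C\<^sub>1 * 6 ^ n) * (2 ^ nat \<lfloor>C' * C' * (84 / \<rho>) ^ n\<rfloor> * A)"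
  have B: "B \<ge> 0" using C C1 \<open>0 \<le> A\<close> by (auto simp: B_def intro!: mult_nonneg_nonneg)
  have k1: "\<rho> powi ?k1 \<le> \<rho> powi k" by (rule scale_antimono[OF rho]) simp
  let ?N = "net L ?k1 \<inter> cball x (2 * \<rho> powi k)"
  let ?T = "\<lambda>z. {p \<in> T. dist z (snd p) \<le> \<rho> powi ?k1}"
  have cov: "T \<subseteq> (\<Union>z\<in>?N. ?T z)"
  proof
    fix p assume p: "p \<in> T"
    have "snd p \<in> W" using T(2)[OF p] net_subset by blast
    then obtain z where z: "z \<in> net L ?k1" "dist (snd p) z < \<rho> powi ?k1"
      using maximal_net_dense[OF maximal_net[of ?k1]] by auto
    have "dist x z \<le> 2 * \<rho> powi k"
      using dist_triangle[of x z "snd p"] z(2) T(2)[OF p] k1 by linarith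
    then show "p \<in> (\<Union>z\<in>?N. ?T z)"
      using z p by (intro UN_I[of z]) (auto simp: dist_commute)
  qed
  have "\<rho> powi ?k1 / 3 \<le> 28 * \<rho> powi ?k1" using scale_pos[of ?k1] by linarith
  then have small: "ennreal (\<rho> powi ?k1 / 3) < ediam W" using k(2) ennreal_leI le_less_trans by blast
  have each: "sum ?w (?T z) \<le> B * (\<rho> powi ?k1) ^ n" for z
  proof -
    have "sum ?w (?T z) \<le> (C * C\<^sub>1 * 6 ^ n) * (2 ^ nat \<lfloor>C' * C' * (84 / \<rho>) ^ n\<rfloor> * A * (\<rho> powi ?k1) ^ n)"
      by (rule packing_transfer[OF V regV pack \<open>0 \<le> A\<close> \<gamma> f k, where z = z]) (use T in auto)
    then show ?thesis by (simp add: B_def mult.assoc)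
  qed
  have "sum ?w T \<le> sum ?w (\<Union>z\<in>?N. ?T z)"
    using finite_net T(1) by (intro sum_mono2 cov) auto
  also have "\<dots> \<le> (\<Sum>z\<in>?N. sum ?w (?T z))" using finite_net T(1) by (intro sum_UN_le) auto
  also have "\<dots> \<le> (\<Sum>z\<in>?N. B * (\<rho> powi ?k1) ^ n)" by (rule sum_mono[OF each])
  also have "\<dots> = B * (real (card ?N) * (\<rho> powi ?k1) ^ n)" by simp
  also have "\<dots> \<le> B * (C * C\<^sub>1 * 3 ^ n * (2 * \<rho> powi k + \<rho> powi ?k1) ^ n)"
    using B by (intro mult_left_mono net_count(2) small) auto
  also have "\<dots> \<le> B * (C * C\<^sub>1 * 3 ^ n * (3 * \<rho> powi k) ^ n)"
    using B C C1 k1 by (intro mult_left_mono power_mono) auto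
  also have "\<dots> = B * (C * C\<^sub>1 * (3 * 3) ^ n) * (\<rho> powi k) ^ n"
    by (simp only: power_mult_distrib mult.assoc)
  finally show ?thesis by (simp add: B_def)
qed

text \<open>The ball of radius \<open>side \<rho> k\<close> is compared with the ball \<open>c\<^sub>0 B_Q\<close> of a cube \<open>Q\<close> of generation \<open>k - 1\<close> with
  the same centre. If \<open>Q\<close> has only a small part outside of \<open>Y\<close>, then the coefficient of \<open>Y\<close> has to be large, and
  \<open>Y\<close> has to meet the ball of radius \<open>\<rho> powi k\<close>, since otherwise that ball would lie in the small part.\<close>

lemma bad_pair_near_piece:
  assumes \<beta>: "coefficient_with f W \<beta>" and "K > 0" "\<epsilon> > 0"
    and \<tau>: "0 < \<tau>" "\<tau> \<le> \<epsilon> / (2 * K * f (1 / (500 * \<rho>)))" "\<tau> < inverse C"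
    and x: "x \<in> W" "ennreal (2 * \<rho> powi (k - 1)) < ediam W" and bad: "\<epsilon> < \<beta> x (side \<rho> k)"
    and Q: "Q \<subseteq> cball x (5 * \<rho> powi (k - 1))" "Q \<subseteq> W"
      "ereal (\<beta> x (c\<^sub>0 * side \<rho> (k - 1)))
        \<le> ereal K * (enn2ereal (hausdorff n (Q - Y) / ennreal (side \<rho> (k - 1) ^ n))
                      + ereal (\<gamma> x (c\<^sub>0 * side \<rho> (k - 1))))"
    and small: "hausdorff n (cball x (5 * \<rho> powi (k - 1)) \<inter> (W - Y)) < ennreal (\<tau> * (\<rho> powi k) ^ n)"
  shows "\<epsilon> / (2 * K * f (1 / (500 * \<rho>))) < \<gamma> x (\<rho> powi (k - 1) / 100)"
    and "\<exists>y\<in>W \<inter> Y. dist x y \<le> \<rho> powi k"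
proof -
  let ?s = "\<rho> powi (k - 1)" and ?F = "f (1 / (500 * \<rho>))"
  have ks: "\<rho> powi k = \<rho> * ?s" using scale_add1[OF rho(1), of "k - 1"] by simp
  have k1000: "1000 * \<rho> powi k < ?s" by (rule scale_less[OF rho]) simp
  have f: "mono f" "f 1 = 1" using \<beta> unfolding coefficient_with_def by auto
  have F: "?F > 0" using monoD[OF f(1), of 1 "1 / (500 * \<rho>)"] f(2) rho by (simp add: field_simps)
  have "?s / 100 \<le> 2 * ?s" using scale_pos[of "k - 1"] by linarith
  then have "ennreal (?s / 100) < ediam W" using x(2) ennreal_leI le_less_trans by blast
  moreover have "side \<rho> k < ?s / 100" using k1000 scale_pos[of k] unfolding side_def by linarith
  moreover have "cball x (side \<rho> k) \<subseteq> cball x (?s / 100)" using \<open>side \<rho> k < ?s / 100\<close> by auto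
  moreover have "side \<rho> k > 0" by (simp add: side_def)
  ultimately have "\<beta> x (side \<rho> k) \<le> f (?s / 100 / side \<rho> k) * \<beta> x (?s / 100)"
    by (intro coefficient_withD[OF \<beta> x(1) x(1)])
  also have "?s / 100 / side \<rho> k = 1 / (500 * \<rho>)"
    using rho scale_pos[of "k - 1"] by (simp add: side_def ks field_simps)
  finally have \<beta>': "\<epsilon> < ?F * \<beta> x (?s / 100)" using bad by linarith
  have "hausdorff n (Q - Y) \<le> hausdorff n (cball x (5 * ?s) \<inter> (W - Y))"
    using Q by (intro hausdorff_mono) blast
  also have "\<dots> \<le> ennreal (\<tau> * (\<rho> powi k) ^ n)" using small by simp
  also have "\<dots> \<le> ennreal (\<tau> * side \<rho> (k - 1) ^ n)"
  proof -
    have "\<rho> powi k \<le> side \<rho> (k - 1)"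
      using k1000 scale_pos[of k] unfolding side_def by linarith
    then show ?thesis using \<tau> by (intro ennreal_leI mult_left_mono power_mono) auto
  qed
  finally have "hausdorff n (Q - Y) / ennreal (side \<rho> (k - 1) ^ n) \<le> ennreal (\<tau> * side \<rho> (k - 1) ^ n) / ennreal (side \<rho> (k - 1) ^ n)"
    by (rule divide_right_mono_ennreal)
  also have "\<dots> = ennreal \<tau>"
    using \<tau> rho by (subst divide_ennreal) (auto simp: side_def)
  finally have "enn2ereal (hausdorff n (Q - Y) / ennreal (side \<rho> (k - 1) ^ n)) \<le> ereal \<tau>"
    using \<tau> by (simp add: less_eq_ennreal.rep_eq enn2ereal_ennreal)
  then have "ereal K * (enn2ereal (hausdorff n (Q - Y) / ennreal (side \<rho> (k - 1) ^ n))
      + ereal (\<gamma> x (c\<^sub>0 * side \<rho> (k - 1)))) \<le> ereal K * (ereal \<tau> + ereal (\<gamma> x (c\<^sub>0 * side \<rho> (k - 1))))"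
    using \<open>K > 0\<close> by (intro ereal_mult_left_mono add_right_mono) auto
  from order_trans[OF Q(3) this]
  have "ereal (\<beta> x (c\<^sub>0 * side \<rho> (k - 1))) \<le> ereal (K * (\<tau> + \<gamma> x (c\<^sub>0 * side \<rho> (k - 1))))"
    by simp
  then have "\<beta> x (?s / 100) \<le> K * (\<tau> + \<gamma> x (?s / 100))" by (simp add: c0_side)
  then have "?F * \<beta> x (?s / 100) \<le> ?F * (K * (\<tau> + \<gamma> x (?s / 100)))" using F by simp
  then have *: "\<epsilon> < ?F * K * (\<tau> + \<gamma> x (?s / 100))" using \<beta>' by (simp add: mult.assoc)
  have FK: "?F * K > 0" using F \<open>K > 0\<close> by simp
  have "\<epsilon> / (?F * K) < \<tau> + \<gamma> x (?s / 100)"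
    using * FK by (simp add: pos_divide_less_eq mult.commute)
  moreover have "\<epsilon> / (?F * K) = 2 * (\<epsilon> / (2 * K * ?F))" using FK by (simp add: field_simps)
  ultimately show "\<epsilon> / (2 * K * ?F) < \<gamma> x (?s / 100)" using \<tau>(2) by linarith
  show "\<exists>y\<in>W \<inter> Y. dist x y \<le> \<rho> powi k"
  proof (rule ccontr)
    assume none: "\<not> ?thesis"
    have "\<rho> powi k \<le> 2 * ?s" using k1000 scale_pos[of k] by linarith
    then have "ennreal (\<rho> powi k) < ediam W" using x(2) ennreal_leI le_less_trans by blast
    then have "ennreal (inverse C * (\<rho> powi k) ^ n) \<le> hausdorff n (cball x (\<rho> powi k) \<inter> W)"
      using x(1) by (intro ahlfors_lower[OF reg]) auto
    also have "\<dots> \<le> hausdorff n (cball x (5 * ?s) \<inter> (W - Y))"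
    proof (intro hausdorff_mono subsetI)
      fix u assume u: "u \<in> cball x (\<rho> powi k) \<inter> W"
      then have "dist x u \<le> \<rho> powi k" by simp
      then have "dist x u \<le> 5 * ?s" using k1000 scale_pos[of k] by linarith
      then show "u \<in> cball x (5 * ?s) \<inter> (W - Y)" using u none by auto
    qed
    also have "\<dots> < ennreal (\<tau> * (\<rho> powi k) ^ n)" by (rule small)
    finally have "inverse C * (\<rho> powi k) ^ n < \<tau> * (\<rho> powi k) ^ n"
      using C by (subst (asm) ennreal_less_iff) auto
    then show False using \<tau>(3) by (simp add: mult_less_cancel_right)
  qed
qed

end

section \<open>The stability of the weak Carleson condition under very big pieces\<close>

theorem theorem4p10:
  fixes n :: nat and \<rho> K :: real
    and X :: "'a::metric_space set" and \<Y> :: "'a set set"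
    and \<D> :: "'a set \<Rightarrow> 'a lattice_data"
    and \<beta> :: "'a \<Rightarrow> real \<Rightarrow> real"
  assumes "n \<ge> 1"
    and "0 < \<rho>" and "\<rho> < 1 / 1000"
    and "\<exists>C\<^sub>0. ahlfors_regular n C\<^sub>0 X"
    and "\<forall>Y\<in>\<Y>. (\<exists>C\<^sub>0. ahlfors_regular n C\<^sub>0 Y) \<and> hausdorff_measurable n Y"
    and "\<forall>W\<in>insert X \<Y>. christ_david_lattice n \<rho> W (\<D> W)"
    and "very_big_pieces n X \<Y>"
    and "coefficient X \<beta>"
    and "K > 0"
    and "\<exists>(f :: real \<Rightarrow> real \<Rightarrow> real) (C :: real \<Rightarrow> real \<Rightarrow> real). \<forall>Y\<in>\<Y>. \<exists>\<beta>\<^sub>Y :: 'a \<Rightarrow> real \<Rightarrow> real.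
       (\<forall>C\<^sub>0. ahlfors_regular n C\<^sub>0 Y \<longrightarrow>
          coefficient_with (f C\<^sub>0) UNIV \<beta>\<^sub>Y \<and>
          (\<exists>W\<in>{X, Y}. \<forall>\<epsilon>>0. C C\<^sub>0 \<epsilon> > 0 \<and> carleson_packing n \<rho> W (\<D> W) \<beta>\<^sub>Y \<epsilon> (C C\<^sub>0 \<epsilon>))) \<and>
       (\<forall>L k. \<forall>Q\<in>cubes L k. christ_david_lattice n \<rho> X L \<and> ennreal (c\<^sub>0 * side \<rho> k) < ediam X \<longrightarrow>
          ereal (\<beta> (centre L k Q) (c\<^sub>0 * side \<rho> k))
            \<le> ereal K * (enn2ereal (hausdorff n (Q - Y) / ennreal (side \<rho> k ^ n))
                          + ereal (\<beta>\<^sub>Y (centre L k Q) (c\<^sub>0 * side \<rho> k))))"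
  shows "weak_carleson n \<rho> X (\<D> X) \<beta>"
proof -
  obtain C where reg: "ahlfors_regular n C X" using assms(4) by blast
  have latX: "christ_david_lattice n \<rho> X (\<D> X)" using assms(6) by blast
  have dbl: "doubling_space X" using latX unfolding christ_david_lattice_def by (elim conjE)
  have csX: "cube_system \<rho> X (\<D> X)"
    by (rule christ_david_lattice_cube_system[OF latX assms(2,3)])
  obtain f where f: "coefficient_with f X \<beta>" using assms(8) unfolding coefficient_def by blast
  from assms(10) obtain fY :: "real \<Rightarrow> real \<Rightarrow> real" and CY :: "real \<Rightarrow> real \<Rightarrow> real" where fY:
    "\<And>Y. Y \<in> \<Y> \<Longrightarrow> \<exists>\<beta>\<^sub>Y :: 'a \<Rightarrow> real \<Rightarrow> real.
       (\<forall>C\<^sub>0. ahlfors_regular n C\<^sub>0 Y \<longrightarrow>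
          coefficient_with (fY C\<^sub>0) UNIV \<beta>\<^sub>Y \<and>
          (\<exists>W\<in>{X, Y}. \<forall>\<epsilon>>0. CY C\<^sub>0 \<epsilon> > 0 \<and> carleson_packing n \<rho> W (\<D> W) \<beta>\<^sub>Y \<epsilon> (CY C\<^sub>0 \<epsilon>))) \<and>
       (\<forall>L k. \<forall>Q\<in>cubes L k. christ_david_lattice n \<rho> X L \<and> ennreal (c\<^sub>0 * side \<rho> k) < ediam X \<longrightarrow>
          ereal (\<beta> (centre L k Q) (c\<^sub>0 * side \<rho> k))
            \<le> ereal K * (enn2ereal (hausdorff n (Q - Y) / ennreal (side \<rho> k ^ n))
                          + ereal (\<beta>\<^sub>Y (centre L k Q) (c\<^sub>0 * side \<rho> k))))"
    by blast
  have "\<exists>A>0. carleson_packing n \<rho> X (\<D> X) \<beta> \<epsilon> A" if \<epsilon>: "\<epsilon> > 0" for \<epsilon>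
  proof (cases "ediam X = 0")
    case True
    then have "carleson_packing n \<rho> X (\<D> X) \<beta> \<epsilon> 1" by (simp add: carleson_packing_def)
    then show ?thesis using zero_less_one by blast
  next
    case False
    then have diam: "0 < ediam X" by (simp add: zero_less_iff_neq_zero)
    obtain C\<^sub>1 where C1: "C\<^sub>1 > 0" "\<And>z r. r > 0 \<Longrightarrow> hausdorff n (cball z r \<inter> X) \<le> ennreal (C\<^sub>1 * r ^ n)"
      using ahlfors_upper[OF assms(1) reg dbl diam] by blast
    interpret X: cube_system \<rho> X "\<D> X" by (rule csX)
    interpret X: regular_cube_system \<rho> X "\<D> X" n C C\<^sub>1
      using assms(1) reg C1 by unfold_locales
    note rho = X.rho and C = X.C
    have f1: "mono f" "f 1 = 1" using f unfolding coefficient_with_def by auto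
    let ?F = "f (1 / (500 * \<rho>))"
    have F: "?F > 0" using monoD[OF f1(1), of 1 "1 / (500 * \<rho>)"] f1(2) rho by (simp add: field_simps)
    \<comment> \<open>The threshold \<open>e\<close> for the pieces and the size \<open>\<tau>\<close> of a noticeable complement do not depend on the pieces.\<close>
    \<comment> \<open>They fix the proportion \<open>\<eta>\<close> of the pieces, this fixes the constant \<open>C\<^sub>0\<close>, and only then the level \<open>e'\<close> at\<close>
    \<comment> \<open>which the coefficients of the pieces are used, since their doubling function depends on \<open>C\<^sub>0\<close>.\<close>
    define e where "e = \<epsilon> / (2 * K * ?F)"
    have e: "e > 0" using \<epsilon> F \<open>K > 0\<close> by (simp add: e_def)
    define \<tau> where "\<tau> = min e (inverse C / 2)"
    have \<tau>: "0 < \<tau>" "\<tau> \<le> e" "\<tau> < inverse C" using e C by (auto simp: \<tau>_def min_less_iff_disj)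
    obtain M where M: "M \<ge> 2" "2 * C * C\<^sub>1 * (28 * \<rho> ^ M) ^ n < 1"
    proof -
      have pos: "2 * C * C\<^sub>1 * 28 ^ n > 0" using C C1 by simp
      then obtain N where N: "\<rho> ^ N < 1 / (2 * C * C\<^sub>1 * 28 ^ n)"
        using real_arch_pow_inv[of "1 / (2 * C * C\<^sub>1 * 28 ^ n)" \<rho>] rho by auto
      define M where "M = N + 2"
      have "\<rho> ^ M \<le> \<rho> ^ N" using rho by (intro power_decreasing) (auto simp: M_def)
      then have less: "\<rho> ^ M < 1 / (2 * C * C\<^sub>1 * 28 ^ n)" using N by linarith
      have "(\<rho> ^ M) ^ n \<le> (\<rho> ^ M) ^ 1"
        using assms(1) rho by (intro power_decreasing power_le_one) auto
      then have "(\<rho> ^ M) ^ n < 1 / (2 * C * C\<^sub>1 * 28 ^ n)" using less by simp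
      then have "(\<rho> ^ M) ^ n * (2 * C * C\<^sub>1 * 28 ^ n) < 1" using pos by (simp only: pos_less_divide_eq)
      then have "2 * C * C\<^sub>1 * (28 * \<rho> ^ M) ^ n < 1" by (simp only: power_mult_distrib mult_ac)
      then show ?thesis using that[of M] by (simp add: M_def)
    qed
    define \<eta> where "\<eta> = min (1 / 2) (\<tau> * (\<rho> * \<rho>) ^ n / 2 / (C * 2 ^ n))"
    have \<eta>: "0 < \<eta>" "\<eta> \<le> 1 / 2" "\<eta> * (C * 2 ^ n) \<le> \<tau> * (\<rho> * \<rho>) ^ n / 2"
    proof -
      show "0 < \<eta>" using \<tau> C rho by (simp add: \<eta>_def)
      show "\<eta> \<le> 1 / 2" by (simp add: \<eta>_def)
      have "\<eta> \<le> \<tau> * (\<rho> * \<rho>) ^ n / 2 / (C * 2 ^ n)" by (simp add: \<eta>_def)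
      then show "\<eta> * (C * 2 ^ n) \<le> \<tau> * (\<rho> * \<rho>) ^ n / 2" using C by (simp only: pos_le_divide_eq mult_pos_pos zero_less_power zero_less_numeral)
    qed
    obtain C\<^sub>0 where pieces: "\<forall>x\<in>X. \<forall>r>0. ennreal r < ediam X \<longrightarrow>
        (\<exists>Y\<in>\<Y>. ahlfors_regular n C\<^sub>0 Y \<and>
           hausdorff n (cball x r \<inter> X \<inter> Y) \<ge> ennreal (1 - \<eta>) * hausdorff n (cball x r \<inter> X))"
      using assms(7)[unfolded very_big_pieces_def, THEN spec, THEN mp, OF \<eta>(1)] by (elim exE conjE)
    \<comment> \<open>the maxima keep the level positive, and the packing constant nonnegative, even if no piece has constant \<open>C\<^sub>0\<close>\<close>
    define e' where "e' = e / max 1 (fY C\<^sub>0 500)"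
    have e': "e' > 0" using e by (simp add: e'_def)
    define C' where "C' = max C C\<^sub>0"
    define A where "A = (C * C\<^sub>1 * 6 ^ n) * (2 ^ nat \<lfloor>C' * C' * (84 / \<rho>) ^ n\<rfloor> * max 0 (CY C\<^sub>0 e')) * (C * C\<^sub>1 * 9 ^ n)"
    have A: "0 \<le> A" using C C1 by (auto simp: A_def intro!: mult_nonneg_nonneg)
    define B where "B = {p. snd p \<in> net (\<D> X) (fst p) \<and> ennreal (side \<rho> (fst p)) < ediam X \<and>
          \<epsilon> < \<beta> (snd p) (side \<rho> (fst p))}"
    have piece: "\<exists>Z. hausdorff n (cball x (2 * \<rho> powi k) \<inter> Z) \<le> ennreal (\<tau> * (\<rho> * \<rho>) ^ n / 2 * (\<rho> powi k) ^ n) \<and>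
       (\<forall>T. finite T \<longrightarrow> (\<forall>p\<in>T. p \<in> B \<and> k + int M < fst p \<and> dist x (snd p) \<le> \<rho> powi k \<and>
          hausdorff n (cball (snd p) (5 * \<rho> powi (fst p - 1)) \<inter> Z) < ennreal (\<tau> * (\<rho> powi fst p) ^ n)) \<longrightarrow>
          (\<Sum>p\<in>T. (\<rho> powi fst p) ^ n) \<le> A * (\<rho> powi k) ^ n)"
      if x: "x \<in> X" "ennreal (2 * \<rho> powi k) < ediam X" for x k
    proof -
      have r: "0 < 2 * \<rho> powi k" by simp
      let ?ball = "cball x (2 * \<rho> powi k) \<inter> X"
      obtain Y where Y: "Y \<in> \<Y>" "ahlfors_regular n C\<^sub>0 Y"
         "ennreal (1 - \<eta>) * hausdorff n ?ball \<le> hausdorff n (?ball \<inter> Y)"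
        using pieces[THEN bspec, OF x(1), THEN spec, THEN mp, OF r, THEN mp, OF x(2)] by blast
      obtain \<gamma> where \<gamma>: "\<And>C\<^sub>0. ahlfors_regular n C\<^sub>0 Y \<Longrightarrow>
          coefficient_with (fY C\<^sub>0) UNIV \<gamma> \<and>
          (\<exists>W\<in>{X, Y}. \<forall>\<epsilon>>0. CY C\<^sub>0 \<epsilon> > 0 \<and> carleson_packing n \<rho> W (\<D> W) \<gamma> \<epsilon> (CY C\<^sub>0 \<epsilon>))"
        and local: "\<And>L k Q. Q \<in> cubes L k \<Longrightarrow> christ_david_lattice n \<rho> X L \<Longrightarrow> ennreal (c\<^sub>0 * side \<rho> k) < ediam X \<Longrightarrow>
          ereal (\<beta> (centre L k Q) (c\<^sub>0 * side \<rho> k))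
            \<le> ereal K * (enn2ereal (hausdorff n (Q - Y) / ennreal (side \<rho> k ^ n))
                          + ereal (\<gamma> (centre L k Q) (c\<^sub>0 * side \<rho> k)))"
        using fY[OF Y(1)] by blast
      have \<gamma>coef: "coefficient_with (fY C\<^sub>0) UNIV \<gamma>" using \<gamma>[OF Y(2)] by blast
      obtain V where V: "V \<in> {X, Y}" "\<And>\<epsilon>. \<epsilon> > 0 \<Longrightarrow> CY C\<^sub>0 \<epsilon> > 0 \<and> carleson_packing n \<rho> V (\<D> V) \<gamma> \<epsilon> (CY C\<^sub>0 \<epsilon>)"
        using \<gamma>[OF Y(2)] by blast
      have Ymeas: "hausdorff_measurable n Y" using assms(5) Y(1) by blast
      have ball: "hausdorff n ?ball \<le> ennreal (C * (2 * \<rho> powi k) ^ n)"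
        by (rule ahlfors_upper_local[OF reg x(1) r x(2)])
      have outside: "hausdorff n (cball x (2 * \<rho> powi k) \<inter> (X - Y)) \<le> ennreal (\<tau> * (\<rho> * \<rho>) ^ n / 2 * (\<rho> powi k) ^ n)"
      proof -
        have "cball x (2 * \<rho> powi k) \<inter> (X - Y) = ?ball - Y" by auto
        then have "hausdorff n (cball x (2 * \<rho> powi k) \<inter> (X - Y)) \<le> ennreal (\<eta> * (C * (2 * \<rho> powi k) ^ n))"
          using hausdorff_outside_piece[OF Ymeas ball _ _ _ Y(3)] C \<eta> by simp
        also have "\<eta> * (C * (2 * \<rho> powi k) ^ n) = \<eta> * (C * 2 ^ n) * (\<rho> powi k) ^ n"
          by (simp only: power_mult_distrib mult.assoc)
        also have "ennreal \<dots> \<le> ennreal (\<tau> * (\<rho> * \<rho>) ^ n / 2 * (\<rho> powi k) ^ n)"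
          using \<eta>(3) by (intro ennreal_leI mult_right_mono) auto
        finally show ?thesis .
      qed
      have "ennreal (1 / 2) * hausdorff n ?ball \<le> ennreal (1 - \<eta>) * hausdorff n ?ball"
        using \<eta>(2) by (intro mult_right_mono ennreal_leI) auto
      then have half: "ennreal (1 / 2) * hausdorff n ?ball \<le> hausdorff n (?ball \<inter> Y)"
        using Y(3) by (rule order_trans)
      have diamX: "ennreal (28 * \<rho> powi (k + int M)) < ediam X"
      proof -
        have "1000 * \<rho> powi (k + int M) < \<rho> powi k" using M(1) by (intro scale_less[OF rho]) auto
        then have "28 * \<rho> powi (k + int M) \<le> 2 * \<rho> powi k"
          using X.scale_pos[of "k + int M"] X.scale_pos[of k] by linarith
        then show ?thesis using x(2) ennreal_leI le_less_trans by blast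
      qed
      have diamV: "ennreal (28 * \<rho> powi (k + int M)) < ediam V"
        using V(1) diamX X.piece_diameter[OF x half M(2)] by auto
      have latV: "cube_system \<rho> V (\<D> V)"
        using assms(2,3,6) V(1) Y(1) by (intro christ_david_lattice_cube_system[of n]) auto
      have regV: "ahlfors_regular n C' V"
        using V(1) ahlfors_regular_mono[OF reg, of C'] ahlfors_regular_mono[OF Y(2), of C'] by (auto simp: C'_def)
      have f500: "fY C\<^sub>0 500 * e' \<le> e"
      proof -
        have "fY C\<^sub>0 500 * e' \<le> max 1 (fY C\<^sub>0 500) * e'" using e' by (intro mult_right_mono) auto
        also have "\<dots> = e" by (simp add: e'_def)
        finally show ?thesis .
      qed
      have pack: "carleson_packing n \<rho> V (\<D> V) \<gamma> e' (max 0 (CY C\<^sub>0 e'))"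
        using V(2)[OF e'] by (simp add: max_def)
      have "(\<Sum>p\<in>T. (\<rho> powi fst p) ^ n) \<le> A * (\<rho> powi k) ^ n"
        if T: "finite T" "\<And>p. p \<in> T \<Longrightarrow> p \<in> B \<and> k + int M < fst p \<and> dist x (snd p) \<le> \<rho> powi k \<and>
          hausdorff n (cball (snd p) (5 * \<rho> powi (fst p - 1)) \<inter> (X - Y)) < ennreal (\<tau> * (\<rho> powi fst p) ^ n)" for T
        unfolding A_def
      proof (rule X.packing_transfer_near[OF latV regV pack _ \<gamma>coef f500 diamV diamX T(1), where x = x])
        fix p assume p: "p \<in> T"
        let ?y = "snd p" and ?l = "fst p"
        note Tp = T(2)[OF p]
        have y: "?y \<in> net (\<D> X) ?l" "?y \<in> X" using Tp X.net_subset by (auto simp: B_def)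
        have "\<rho> powi (?l - 1) \<le> \<rho> powi k" using Tp by (intro scale_antimono[OF rho]) auto
        then have "2 * \<rho> powi (?l - 1) \<le> 2 * \<rho> powi k" by simp
        then have small: "ennreal (2 * \<rho> powi (?l - 1)) < ediam X" using x(2) ennreal_leI le_less_trans by blast
        have "c\<^sub>0 * side \<rho> (?l - 1) \<le> 2 * \<rho> powi (?l - 1)"
          unfolding c0_side using X.scale_pos[of "?l - 1"] by linarith
        then have small': "ennreal (c\<^sub>0 * side \<rho> (?l - 1)) < ediam X" using small ennreal_leI le_less_trans by blast
        obtain L Q where L: "cube_system \<rho> X L" "Q \<in> cubes L (?l - 1)" "centre L (?l - 1) Q = ?y"
          using X.cube_system_with_centre[OF y(2) X.finite_net] by blast
        have "christ_david_lattice n \<rho> X L"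
          by (rule cube_system.christ_david_lattice[OF L(1) assms(1) reg dbl diam])
        note Q3 = local[OF L(2) this small', unfolded L(3)]
        have Q1: "Q \<subseteq> cball ?y (5 * \<rho> powi (?l - 1))" using cube_system.outer[OF L(1,2)] L(3) by simp
        have Q2: "Q \<subseteq> X" by (rule cube_system.cube_subset[OF L(1,2)])
        have bad: "\<epsilon> < \<beta> ?y (side \<rho> ?l)" using Tp by (simp add: B_def)
        have hY: "hausdorff n (cball ?y (5 * \<rho> powi (?l - 1)) \<inter> (X - Y)) < ennreal (\<tau> * (\<rho> powi ?l) ^ n)"
          using Tp by blast
        note near = X.bad_pair_near_piece[where f = f and \<gamma> = \<gamma> and x = "?y" and k = "?l" and Q = Q and Y = Y, OF f \<open>K > 0\<close> \<epsilon> \<tau>(1) \<tau>(2)[unfolded e_def] \<tau>(3) y(2) small bad Q1 Q2 Q3 hY]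
        have "\<exists>v\<in>V. dist ?y v \<le> \<rho> powi ?l"
        proof (cases "V = X")
          case True
          then show ?thesis using y(2) by (intro bexI[of _ ?y]) auto
        next
          case False
          then show ?thesis using V(1) near(2) by blast
        qed
        then show "k + int M < ?l \<and> ?y \<in> net (\<D> X) ?l \<and> dist x ?y \<le> \<rho> powi k \<and>
          e < \<gamma> ?y (\<rho> powi (?l - 1) / 100) \<and> (\<exists>v\<in>V. dist ?y v \<le> \<rho> powi ?l)"
          using Tp y(1) near(1) by (simp add: e_def)
      qed simp
      then show ?thesis using outside by (intro exI[of _ "X - Y"]) blast
    qed
    have BX: "snd p \<in> net (\<D> X) (fst p) \<and> ennreal (2 * \<rho> powi fst p) < ediam X" if "p \<in> B" for p
    proof -
      have "2 * \<rho> powi fst p \<le> side \<rho> (fst p)" unfolding side_def using X.scale_pos[of "fst p"] by linarith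
      then show ?thesis using that ennreal_leI le_less_trans unfolding B_def by blast
    qed
    show ?thesis
    proof (rule X.carleson_packing_from_windows)
      show "0 \<le> 2 * (real (M + 1) * (C * C\<^sub>1 * 6 ^ n) + A)"
        using A C C1 by (auto intro!: add_nonneg_nonneg mult_nonneg_nonneg)
      fix x k m assume xk: "x \<in> X" "ennreal (2 * \<rho> powi k) < ediam X"
      show "(\<Sum>p\<in>window \<rho> {p. snd p \<in> net (\<D> X) (fst p) \<and> ennreal (side \<rho> (fst p)) < ediam X \<and>
          \<epsilon> < \<beta> (snd p) (side \<rho> (fst p))} x k m. (\<rho> powi fst p) ^ n)
          \<le> 2 * (real (M + 1) * (C * C\<^sub>1 * 6 ^ n) + A) * (\<rho> powi k) ^ n"
        unfolding B_def[symmetric] by (rule X.packing_of_windows[where B = B and \<tau> = \<tau>, OF BX \<tau>(1) M(1) A piece xk])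
    qed
  qed
  then show ?thesis using assms(8) unfolding weak_carleson_def by blast
qed

end
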